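(* Let $(C,\Delta_C)$ be a quantum group with associated universal quantum group $(C^{\mathrm u},\Delta_{C^{\mathrm u}})$, and let $(A,\Delta_A)$ be a $C^*$-bialgebra. Bicharacters in $\mathcal U\mathcal M(\hat C\otimes A)$ correspond bijectively to Hopf $^*$-homomorphisms from $(C^{\mathrm u},\Delta_{C^{\mathrm u}})$ to $(A,\Delta_A)$.
   Context: Tensor products of $C^*$-algebras are spatial; $\mathcal M(A)$ is the multiplier algebra, $\mathcal U\mathcal M(A)$ its unitary group; leg numbering notation is used. A morphism $A\to B$ of $C^*$-algebras is a nondegenerate $*$-homomorphism $A\to\mathcal M(B)$ (extended to $\mathcal M(A)\to\mathcal M(B)$). A $C^*$-bialgebra is a $C^*$-algebra $A$ with a coassociative morphism $\Delta_A\colon A\to A\otimes A$. A Hopf $^*$-homomorphism $f\colon(C,\Delta_C)\to(A,\Delta_A)$ between $C^*$-bialgebras is a morphism $f\colon C\to A$ with $\Delta_A\circ f=(f\otimes f)\circ\Delta_C$. A unitary $\mathbb W$ on $\mathcal H\otimes\mathcal H$, for a Hilbert space $\mathcal H$, is multiplicative if $\mathbb W_{23}\mathbb W_{12}=\mathbb W_{12}\mathbb W_{13}\mathbb W_{23}$. It is modular if there are positive self-adjoint operators $\hat Q,Q$ on $\mathcal H$ with trivial kernels and a unitary $\widetilde{\mathbb W}$ on $\overline{\mathcal H}\otimes\mathcal H$ ($\overline{\mathcal H}$ the complex-conjugate Hilbert space) such that $\mathbb W^*(\hat Q\otimes Q)\mathbb W=\hat Q\otimes Q$ and $(x\otimes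 y\mid\mathbb W\mid z\otimes u)=(\overline z\otimes Qy\mid\widetilde{\mathbb W}\mid\overline x\otimes Q^{-1}u)$ for all $x,z\in\mathcal H$, $y\in\mathrm{dom}(Q)$, $u\in\mathrm{dom}(Q^{-1})$, where $(x\mid T\mid y):=(x\mid Ty)$. A quantum group is a pair $(C,\Delta_C)$ obtained from some modular multiplicative unitary $\mathbb W^C$ on $\mathcal H_C\otimes\mathcal H_C$: $C\subseteq\mathbb B(\mathcal H_C)$ is the norm closure of $\{(\omega\otimes\mathrm{id})(\mathbb W^C):\omega\in\mathbb B(\mathcal H_C)_*\}$ and $\Delta_C(x)=\mathbb W^C(x\otimes1)(\mathbb W^C)^*$; its dual is $(\hat C,\Delta_{\hat C})$, where $\hat C$ is the norm closure of $\{(\mathrm{id}\otimes\omega)((\mathbb W^C)^* ):\omega\in\mathbb B(\mathcal H_C)_*\}$ and $\Delta_{\hat C}(y)=\Sigma(\mathbb W^C)^*(1\otimes y)\mathbb W^C\Sigma$ with $\Sigma$ the flip on $\mathcal H_C\otimes\mathcal H_C$. A left corepresentation of $(\hat C,\Delta_{\hat C})$ on a $C^*$-algebra $D$ is $U\in\mathcal U\mathcal M(\hat C\otimes D)$ with $(\Delta_{\hat C}\otimes\mathrm{id}_D)(U)=U_{23}U_{13}$. The universal quantum group of $(C,\Delta_C)$ has as underlying $C^*$-algebra the algebra $C^{\mathrm u}$ carrying a left corepresentation $\mathcal V\in\mathcal U\mathcal M(\hat C\otimes C^{\mathrm u})$ of $\hat C$ that is universal: for every left corepresentation $U\in\mathcal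 U\mathcal M(\hat C\otimes D)$ there is a unique morphism $\varphi\colon C^{\mathrm u}\to D$ with $U=(\mathrm{id}_{\hat C}\otimes\varphi)(\mathcal V)$ (such a pair $(C^{\mathrm u},\mathcal V)$ exists and is unique up to isomorphism). The comultiplication $\Delta_{C^{\mathrm u}}$ is the morphism with $(\mathrm{id}_{\hat C}\otimes\Delta_{C^{\mathrm u}})(\mathcal V)=\mathcal V_{12}\mathcal V_{13}$; $(C^{\mathrm u},\Delta_{C^{\mathrm u}})$ is a $C^*$-bialgebra. For a $C^*$-bialgebra $(A,\Delta_A)$, a bicharacter in $\mathcal U\mathcal M(\hat C\otimes A)$ is a unitary $V\in\mathcal U\mathcal M(\hat C\otimes A)$ with $(\Delta_{\hat C}\otimes\mathrm{id}_A)V=V_{23}V_{13}$ and $(\mathrm{id}_{\hat C}\otimes\Delta_A)V=V_{12}V_{13}$. *)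

theory Defs
  imports "HOL-Analysis.Analysis"
begin

section \<open>Complex Hilbert spaces\<close>

text \<open>\<open>cinner\<close> is linear in the second variable.\<close>

class complex_inner = real_inner +
  fixes scaleC :: "complex \<Rightarrow> 'a \<Rightarrow> 'a"  (infixr "*\<^sub>C" 75)
    and cinner :: "'a \<Rightarrow> 'a \<Rightarrow> complex"
  assumes scaleC_add_right: "c *\<^sub>C (x + y) = c *\<^sub>C x + c *\<^sub>C y"
    and scaleC_add_left: "(c + d) *\<^sub>C x = c *\<^sub>C x + d *\<^sub>C x"
    and scaleC_scaleC: "c *\<^sub>C d *\<^sub>C x = (c * d) *\<^sub>C x"
    and scaleC_of_real: "complex_of_real r *\<^sub>C x = r *\<^sub>R x"
    and cinner_commute: "cinner x y = cnj (cinner y x)"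
    and cinner_add_right: "cinner x (y + z) = cinner x y + cinner x z"
    and cinner_scaleC_right: "cinner x (c *\<^sub>C y) = c * cinner x y"
    and Re_cinner: "Re (cinner x y) = inner x y"

class chilbert_space = complex_inner + complete_space

subclass (in chilbert_space) banach ..

lemma cinner_add_left: "cinner (x + y) z = cinner x z + cinner y z"
  by (metis cinner_add_right cinner_commute complex_cnj_add)

lemma cinner_scaleC_left: "cinner (c *\<^sub>C x) y = cnj c * cinner x y"
  by (metis cinner_commute cinner_scaleC_right complex_cnj_mult)

lemma scaleC_one [simp]: "1 *\<^sub>C x = x"
  using scaleC_of_real[of 1 x] by simp

lemma scaleC_zero_left [simp]: "0 *\<^sub>C x = 0"
  using scaleC_of_real[of 0 x] by simp

lemma cinner_scaleR_right: "cinner x (r *\<^sub>R y) = complex_of_real r * cinner x y"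
  by (metis cinner_scaleC_right scaleC_of_real)

lemma cinner_scaleR_left: "cinner (r *\<^sub>R x) y = complex_of_real r * cinner x y"
  by (metis cinner_scaleC_left scaleC_of_real complex_cnj_complex_of_real)

lemma cinner_zero_right [simp]: "cinner x 0 = 0"
  using cinner_scaleR_right[of x 0 x] by simp

lemma cinner_zero_left [simp]: "cinner 0 x = 0"
  using cinner_scaleR_left[of 0 x x] by simp

lemma cinner_minus_right: "cinner x (- y) = - cinner x y"
  using cinner_scaleR_right[of x "-1" y] by simp

lemma cinner_minus_left: "cinner (- x) y = - cinner x y"
  using cinner_scaleR_left[of "-1" x y] by simp

lemma cinner_diff_right: "cinner x (y - z) = cinner x y - cinner x z"
  using cinner_add_right[of x y "- z"] cinner_minus_right[of x z] by simp

lemma cinner_diff_left: "cinner (x - y) z = cinner x z - cinner y z"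
  using cinner_add_left[of x "- y" z] cinner_minus_left[of y z] by simp

lemma scaleC_zero_right [simp]: "c *\<^sub>C 0 = 0"
  using scaleC_scaleC[of c 0 0] by simp

lemma cinner_self: "cinner x x = complex_of_real (inner x x)"
proof -
  have "Im (cinner x x) = 0"
    using arg_cong[OF cinner_commute[of x x], of Im] by simp
  then show ?thesis
    using Re_cinner[of x x] by (simp add: complex_eq_iff)
qed

lemma cinner_self_norm: "cinner x x = complex_of_real ((norm x)\<^sup>2)"
  by (simp add: cinner_self power2_norm_eq_inner)

lemma norm_scaleC: "norm (c *\<^sub>C x) = cmod c * norm x"
proof -
  have "complex_of_real ((norm (c *\<^sub>C x))\<^sup>2) = cnj c * c * complex_of_real ((norm x)\<^sup>2)"
    by (simp only: cinner_self_norm[symmetric] cinner_scaleC_left cinner_scaleC_right mult_ac)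
  also have "cnj c * c = complex_of_real ((cmod c)\<^sup>2)"
    by (metis complex_norm_square mult.commute)
  finally have "(norm (c *\<^sub>C x))\<^sup>2 = (cmod c * norm x)\<^sup>2"
    by (metis of_real_eq_iff of_real_mult power_mult_distrib)
  then show ?thesis by (simp add: power2_eq_iff_nonneg)
qed

lemma norm_cinner_le: "cmod (cinner x y) \<le> norm x * norm y"
proof (cases "cinner x y = 0")
  case False
  define c where "c = cnj (cinner x y) / cmod (cinner x y)"
  have c: "cmod c = 1" using False by (simp add: c_def norm_divide)
  have "cinner x (c *\<^sub>C y) = complex_of_real (cmod (cinner x y))"
    using False
    by (simp add: cinner_scaleC_right c_def field_simps complex_norm_square[symmetric] power2_eq_square)
  then have "cmod (cinner x y) = inner x (c *\<^sub>C y)"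
    by (metis Re_cinner Re_complex_of_real)
  also have "\<dots> \<le> norm x * norm (c *\<^sub>C y)" by (rule norm_cauchy_schwarz)
  finally show ?thesis by (simp add: norm_scaleC c)
qed simp

lemma bounded_linear_cinner_right: "bounded_linear (cinner x)"
proof (rule bounded_linear_intro[where K = "norm x"])
  show "norm (cinner x y) \<le> norm y * norm x" for y
    using norm_cinner_le[of x y] by (simp add: mult.commute)
qed (simp_all add: cinner_add_right cinner_scaleR_right scaleR_conv_of_real)

lemma bounded_linear_scaleC: "bounded_linear (\<lambda>x. c *\<^sub>C x)"
proof (rule bounded_linear_intro[where K = "cmod c"])
  show "c *\<^sub>C (r *\<^sub>R x) = r *\<^sub>R (c *\<^sub>C x)" for r and x :: 'a
    by (metis mult.commute scaleC_of_real scaleC_scaleC)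
qed (simp_all add: scaleC_add_right norm_scaleC mult.commute)

lemma bounded_linear_scaleC_left: "bounded_linear (\<lambda>c. c *\<^sub>C x)"
  by (rule bounded_linear_intro[where K = "norm x"])
    (simp_all add: scaleC_add_left norm_scaleC scaleC_scaleC[symmetric] scaleC_of_real
      scaleR_conv_of_real)


section \<open>Orthonormal bases\<close>

definition onset :: "'a::complex_inner set \<Rightarrow> bool"
  where "onset B \<longleftrightarrow> (\<forall>e\<in>B. \<forall>f\<in>B. cinner e f = (if e = f then 1 else 0))"

definition onbasis :: "'a::complex_inner set \<Rightarrow> bool"
  where "onbasis B \<longleftrightarrow> onset B \<and> (\<forall>x. (\<forall>e\<in>B. cinner e x = 0) \<longrightarrow> x = 0)"

lemma onbasis_exists: "\<exists>B :: 'a::complex_inner set. onbasis B"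
proof -
  have "\<exists>M\<in>{B. onset B}. \<forall>X\<in>{B :: 'a set. onset B}. M \<subseteq> X \<longrightarrow> X = M"
  proof (rule subset_Zorn')
    fix C :: "'a set set"
    assume "subset.chain {B. onset B} C"
    then have C: "\<And>B. B \<in> C \<Longrightarrow> onset B" "\<And>A B. A \<in> C \<Longrightarrow> B \<in> C \<Longrightarrow> A \<subseteq> B \<or> B \<subseteq> A"
      by (auto simp: subset.chain_def)
    have "onset (\<Union>C)"
      unfolding onset_def
    proof (intro ballI)
      fix e f assume "e \<in> \<Union>C" "f \<in> \<Union>C"
      then obtain B where "B \<in> C" "e \<in> B" "f \<in> B" using C(2) by blast
      then show "cinner e f = (if e = f then 1 else 0)"
        using C(1) unfolding onset_def by blast
    qed
    then show "\<Union>C \<in> {B. onset B}" by simp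
  qed
  then obtain M :: "'a set" where M: "onset M" "\<And>X. onset X \<Longrightarrow> M \<subseteq> X \<Longrightarrow> X = M" by auto
  have "x = 0" if x: "\<forall>e\<in>M. cinner e x = 0" for x
  proof (rule ccontr)
    assume "x \<noteq> 0"
    define u where "u = (1 / norm x) *\<^sub>R x"
    have u: "cinner u u = 1"
      using \<open>x \<noteq> 0\<close> by (simp add: cinner_self_norm u_def)
    have e: "cinner e u = 0" "cinner u e = 0" if "e \<in> M" for e
    proof -
      show "cinner e u = 0" using x that by (simp add: u_def cinner_scaleR_right)
      then show "cinner u e = 0" by (metis cinner_commute complex_cnj_zero)
    qed
    have "onset (insert u M)"
      using M(1) u e unfolding onset_def by auto
    then have "u \<in> M" using M(2)[of "insert u M"] by blast
    then show False using e u by fastforce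
  qed
  with M(1) show ?thesis unfolding onbasis_def by blast
qed

definition some_onb :: "'a::complex_inner set"
  where "some_onb = (SOME B. onbasis B)"

lemma some_onb: "onbasis (some_onb :: 'a::complex_inner set)"
  unfolding some_onb_def by (rule someI_ex) (rule onbasis_exists)

lemma some_onb_cinner:
  "e \<in> some_onb \<Longrightarrow> f \<in> some_onb \<Longrightarrow> cinner e f = (if e = f then 1 else 0)"
  using some_onb unfolding onbasis_def onset_def by blast

lemma some_onb_total: "(\<And>e. e \<in> some_onb \<Longrightarrow> cinner e x = 0) \<Longrightarrow> x = 0"
  using some_onb unfolding onbasis_def by blast

lemma onb_partial_sum:
  fixes a :: "'a::complex_inner \<Rightarrow> complex"
  assumes F: "finite F" "F \<subseteq> some_onb"
  shows "(norm (\<Sum>e\<in>F. a e *\<^sub>C e))\<^sup>2 = (\<Sum>e\<in>F. (cmod (a e))\<^sup>2)"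
proof -
  have right: "cinner y (\<Sum>f\<in>F. a f *\<^sub>C f) = (\<Sum>f\<in>F. a f * cinner y f)" for y
    using linear_sum[OF bounded_linear.linear[OF bounded_linear_cinner_right[of y]],
        of "\<lambda>f. a f *\<^sub>C f" F]
    by (simp add: cinner_scaleC_right)
  have on: "cinner e (\<Sum>f\<in>F. a f *\<^sub>C f) = a e" if "e \<in> F" for e
  proof -
    have "(\<Sum>f\<in>F. a f * cinner e f) = (\<Sum>f\<in>F. if f = e then a e else 0)"
      using F that by (intro sum.cong) (auto simp: some_onb_cinner subset_iff)
    then show ?thesis using F that by (simp add: right)
  qed
  have "complex_of_real ((norm (\<Sum>e\<in>F. a e *\<^sub>C e))\<^sup>2)
      = cnj (cinner (\<Sum>f\<in>F. a f *\<^sub>C f) (\<Sum>f\<in>F. a f *\<^sub>C f))"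
    by (simp add: cinner_self_norm)
  also have "\<dots> = (\<Sum>e\<in>F. cnj (a e * cinner (\<Sum>f\<in>F. a f *\<^sub>C f) e))"
    by (simp add: right)
  also have "\<dots> = (\<Sum>e\<in>F. cnj (a e) * a e)"
  proof (rule sum.cong)
    fix e assume "e \<in> F"
    then show "cnj (a e * cinner (\<Sum>f\<in>F. a f *\<^sub>C f) e) = cnj (a e) * a e"
      using on[of e] cinner_commute[of e "\<Sum>f\<in>F. a f *\<^sub>C f"] by simp
  qed simp
  also have "\<dots> = complex_of_real (\<Sum>e\<in>F. (cmod (a e))\<^sup>2)"
    by (simp only: of_real_sum complex_norm_square mult.commute)
  finally show ?thesis by (metis of_real_eq_iff)
qed

lemma bessel:
  fixes x :: "'a::complex_inner"
  assumes F: "finite F" "F \<subseteq> some_onb"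
  shows "(\<Sum>e\<in>F. (cmod (cinner e x))\<^sup>2) \<le> (norm x)\<^sup>2"
proof -
  define p where "p = (\<Sum>e\<in>F. cinner e x *\<^sub>C e)"
  have np: "(norm p)\<^sup>2 = (\<Sum>e\<in>F. (cmod (cinner e x))\<^sup>2)"
    unfolding p_def by (rule onb_partial_sum[OF F])
  have "cinner x p = (\<Sum>e\<in>F. cinner e x * cinner x e)"
    unfolding p_def
    using linear_sum[OF bounded_linear.linear[OF bounded_linear_cinner_right[of x]],
        of "\<lambda>e. cinner e x *\<^sub>C e" F]
    by (simp add: cinner_scaleC_right)
  also have "\<dots> = complex_of_real (\<Sum>e\<in>F. (cmod (cinner e x))\<^sup>2)"
    by (simp only: of_real_sum complex_norm_square cinner_commute[of x])
  finally have xp: "inner x p = (norm p)\<^sup>2"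
    by (metis Re_cinner Re_complex_of_real np)
  have "0 \<le> inner (x - p) (x - p)" by simp
  also have "\<dots> = (norm x)\<^sup>2 - (norm p)\<^sup>2"
    by (simp add: inner_diff inner_commute[of p x] xp power2_norm_eq_inner)
  finally show ?thesis by (simp add: np)
qed

lemma onb_coeff_summable:
  fixes x :: "'a::complex_inner"
  shows "(\<lambda>e. (cmod (cinner e x))\<^sup>2) summable_on some_onb"
proof (rule nonneg_bdd_above_summable_on)
  show "bdd_above (sum (\<lambda>e. (cmod (cinner e x))\<^sup>2) ` {F. F \<subseteq> some_onb \<and> finite F})"
    by (rule bdd_aboveI2[where M = "(norm x)\<^sup>2"]) (auto intro: bessel)
qed simp


lemma fourier:
  fixes x :: "'a::chilbert_space"
  shows "((\<lambda>e. cinner e x *\<^sub>C e) has_sum x) some_onb"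
proof -
  let ?B = "some_onb :: 'a set"
  let ?c = "\<lambda>e. (cmod (cinner e x))\<^sup>2"
  let ?s = "sum (\<lambda>e. cinner e x *\<^sub>C e)"
  have lim: "(sum ?c \<longlongrightarrow> infsum ?c ?B) (finite_subsets_at_top ?B)"
    using has_sum_infsum[OF onb_coeff_summable[of x]] by (simp add: has_sum_def)
  have le: "sum ?c F \<le> infsum ?c ?B" if "finite F" "F \<subseteq> ?B" for F
    using that onb_coeff_summable[of x] by (intro finite_sum_le_infsum) auto
  have "cauchy_filter (filtermap ?s (finite_subsets_at_top ?B))"
    unfolding cauchy_filter_metric_filtermap
  proof (intro allI impI)
    fix r :: real assume "r > 0"
    then have "\<forall>\<^sub>F F in finite_subsets_at_top ?B. dist (sum ?c F) (infsum ?c ?B) < (r/2)\<^sup>2"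
      by (intro tendstoD[OF lim]) simp
    then obtain F0 where F0: "finite F0" "F0 \<subseteq> ?B" "dist (sum ?c F0) (infsum ?c ?B) < (r/2)\<^sup>2"
      unfolding eventually_finite_subsets_at_top by blast
    have near: "dist (?s F) (?s F0) < r/2" if F: "finite F" "F0 \<subseteq> F" "F \<subseteq> ?B" for F
    proof -
      have "(norm (?s (F - F0)))\<^sup>2 = sum ?c (F - F0)"
        using F by (intro onb_partial_sum) auto
      also have "\<dots> = sum ?c F - sum ?c F0"
        using F by (simp add: sum_diff)
      also have "\<dots> < (r/2)\<^sup>2"
        using F0(3) le[of F] le[of F0] F F0 by (auto simp: dist_real_def)
      finally have "norm (?s (F - F0)) < r/2"
        using \<open>r > 0\<close> by - (rule power2_less_imp_less, simp_all)
      moreover have "?s (F - F0) = ?s F - ?s F0"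
        using F by (simp add: sum_diff)
      ultimately show ?thesis by (simp add: dist_norm)
    qed
    show "\<exists>P. eventually P (finite_subsets_at_top ?B) \<and> (\<forall>F G. P F \<and> P G \<longrightarrow> dist (?s F) (?s G) < r)"
    proof (intro exI[of _ "\<lambda>F. finite F \<and> F0 \<subseteq> F \<and> F \<subseteq> ?B"] conjI allI impI)
      show "\<forall>\<^sub>F F in finite_subsets_at_top ?B. finite F \<and> F0 \<subseteq> F \<and> F \<subseteq> ?B"
        unfolding eventually_finite_subsets_at_top using F0 by blast
      fix F G assume "(finite F \<and> F0 \<subseteq> F \<and> F \<subseteq> ?B) \<and> (finite G \<and> F0 \<subseteq> G \<and> G \<subseteq> ?B)"
      then show "dist (?s F) (?s G) < r"
        using near[of F] near[of G] dist_triangle2[of "?s F" "?s G" "?s F0"] by linarith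
    qed
  qed
  moreover have "complete (UNIV :: 'a set)"
    by (meson Cauchy_convergent UNIV_I complete_def convergent_def)
  ultimately obtain p where p: "(?s \<longlongrightarrow> p) (finite_subsets_at_top ?B)"
    using complete_uniform[where S = UNIV] by (force simp add: filterlim_def)
  then have p': "((\<lambda>e. cinner e x *\<^sub>C e) has_sum p) ?B" by (simp add: has_sum_def)
  have "cinner f (x - p) = 0" if f: "f \<in> ?B" for f
  proof -
    have "((\<lambda>e. cinner f (cinner e x *\<^sub>C e)) has_sum cinner f p) ?B"
      by (rule has_sum_bounded_linear[OF bounded_linear_cinner_right p'])
    moreover have "((\<lambda>e. cinner f (cinner e x *\<^sub>C e)) has_sum cinner f x) ?B"
    proof (rule has_sum_finite_neutralI[where B = "{f}"])
      show "cinner f (cinner e x *\<^sub>C e) = 0" if "e \<in> ?B - {f}" for e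
        using that f some_onb_cinner[of f e] by (auto simp: cinner_scaleC_right)
      show "cinner f x = (\<Sum>e\<in>{f}. cinner f (cinner e x *\<^sub>C e))"
        using f some_onb_cinner[of f f] by (simp add: cinner_scaleC_right)
    qed (use f in auto)
    ultimately have "cinner f p = cinner f x" by (rule has_sum_unique)
    then show ?thesis by (simp add: cinner_diff_right)
  qed
  then have "x - p = 0" by (rule some_onb_total)
  with p' show ?thesis by simp
qed

lemma parseval:
  fixes x y :: "'a::chilbert_space"
  shows "((\<lambda>e. cnj (cinner e x) * cinner e y) has_sum cinner x y) some_onb"
proof -
  have "((\<lambda>e. cinner x (cinner e y *\<^sub>C e)) has_sum cinner x y) some_onb"
    by (rule has_sum_bounded_linear[OF bounded_linear_cinner_right fourier])
  moreover have "cinner x (cinner e y *\<^sub>C e) = cnj (cinner e x) * cinner e y" for e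
    by (metis cinner_commute cinner_scaleC_right mult.commute)
  ultimately show ?thesis by simp
qed


section \<open>The conjugate Hilbert space\<close>

typedef 'a conjugate = "UNIV :: 'a set"
  morphisms unbar bar ..

instantiation conjugate :: (complex_inner) complex_inner
begin

definition "0 = bar 0"
definition "x + y = bar (unbar x + unbar y)"
definition "x - y = bar (unbar x - unbar y)"
definition "- x = bar (- unbar x)"
definition "r *\<^sub>R x = bar (r *\<^sub>R unbar x)"
definition "c *\<^sub>C x = bar (cnj c *\<^sub>C unbar x)"
definition "cinner x y = cinner (unbar y) (unbar x)"
definition "inner x y = inner (unbar x) (unbar y)" for x y :: "'a conjugate"
definition "norm x = norm (unbar x)" for x :: "'a conjugate"
definition "dist x y = dist (unbar x) (unbar y)" for x y :: "'a conjugate"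
definition "sgn x = bar (sgn (unbar x))" for x :: "'a conjugate"
definition "(uniformity :: ('a conjugate \<times> 'a conjugate) filter)
  = (INF e\<in>{0 <..}. principal {(x, y). dist x y < e})"
definition "open S \<longleftrightarrow> (\<forall>x\<in>S. \<forall>\<^sub>F (x', y) in uniformity. x' = x \<longrightarrow> y \<in> S)" for S :: "'a conjugate set"

instance
proof
  note defs = zero_conjugate_def plus_conjugate_def minus_conjugate_def uminus_conjugate_def
    scaleR_conjugate_def scaleC_conjugate_def cinner_conjugate_def inner_conjugate_def
    norm_conjugate_def dist_conjugate_def sgn_conjugate_def
  fix x y z :: "'a conjugate" and r s :: real and c d :: complex
  show "x + y + z = x + (y + z)" "x + y = y + x" "0 + x = x" "- x + x = 0" "x - y = x + - y"
    by (simp_all add: defs bar_inverse unbar_inverse add_ac)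
  show "r *\<^sub>R (x + y) = r *\<^sub>R x + r *\<^sub>R y" "(r + s) *\<^sub>R x = r *\<^sub>R x + s *\<^sub>R x"
    "r *\<^sub>R s *\<^sub>R x = (r * s) *\<^sub>R x" "1 *\<^sub>R x = x"
    by (simp_all add: defs bar_inverse unbar_inverse scaleR_add_right scaleR_add_left)
  show "sgn x = inverse (norm x) *\<^sub>R x" by (simp add: defs sgn_div_norm)
  show "dist x y = norm (x - y)" by (simp add: defs bar_inverse dist_norm)
  show "inner x y = inner y x" by (simp add: defs inner_commute)
  show "inner (x + y) z = inner x z + inner y z" by (simp add: defs bar_inverse inner_add_left)
  show "inner (r *\<^sub>R x) y = r * inner x y" by (simp add: defs bar_inverse)
  show "0 \<le> inner x x" by (simp add: defs)
  show "inner x x = 0 \<longleftrightarrow> x = 0" by (metis inner_conjugate_def inner_eq_zero_iff zero_conjugate_def bar_inverse unbar_inverse UNIV_I)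
  show "norm x = sqrt (inner x x)" by (simp add: defs norm_eq_sqrt_inner)
  show "c *\<^sub>C (x + y) = c *\<^sub>C x + c *\<^sub>C y" by (simp add: defs bar_inverse scaleC_add_right)
  show "(c + d) *\<^sub>C x = c *\<^sub>C x + d *\<^sub>C x" by (simp add: defs bar_inverse scaleC_add_left)
  show "c *\<^sub>C d *\<^sub>C x = (c * d) *\<^sub>C x" by (simp add: defs bar_inverse scaleC_scaleC)
  show "complex_of_real r *\<^sub>C x = r *\<^sub>R x" by (simp add: defs scaleC_of_real)
  show "cinner x y = cnj (cinner y x)" by (simp add: defs cinner_commute[of "unbar x" "unbar y"])
  show "cinner x (y + z) = cinner x y + cinner x z" by (simp add: defs bar_inverse cinner_add_left)
  show "cinner x (c *\<^sub>C y) = c * cinner x y" by (simp add: defs bar_inverse cinner_scaleC_left)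
  show "Re (cinner x y) = inner x y" by (simp add: defs Re_cinner inner_commute)
qed (simp_all add: uniformity_conjugate_def open_conjugate_def)

end

instance conjugate :: (chilbert_space) chilbert_space
proof
  fix X :: "nat \<Rightarrow> 'a conjugate" assume "Cauchy X"
  then have "Cauchy (\<lambda>n. unbar (X n))" by (simp add: Cauchy_def dist_conjugate_def)
  then obtain l where "(\<lambda>n. unbar (X n)) \<longlonglongrightarrow> l" using Cauchy_convergent convergent_def by blast
  then have "X \<longlonglongrightarrow> bar l"
    by (simp add: tendsto_iff dist_conjugate_def bar_inverse)
  then show "convergent X" by (auto simp: convergent_def)
qed


section \<open>Tensor products of Hilbert spaces\<close>

text \<open>The Hilbert tensor product \<open>H \<otimes> K\<close> is modelled by the square-summable families in \<open>K\<close> that are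
  indexed by an orthonormal basis of \<open>H\<close>.  It is determined up to a canonical unitary by
  \<open>cinner_tensor\<close> and \<open>tensor_dense\<close> below, so the choice of the basis is immaterial.\<close>

definition ell2 :: "('a::chilbert_space \<Rightarrow> 'b::chilbert_space) set"
  where "ell2 = {f. (\<forall>e. e \<notin> some_onb \<longrightarrow> f e = 0) \<and> (\<lambda>e. (norm (f e))\<^sup>2) summable_on UNIV}"

lemma ell2_zero: "(\<lambda>_. 0) \<in> ell2"
  by (simp add: ell2_def)

lemma ell2_add:
  assumes "f \<in> ell2" "g \<in> ell2" shows "(\<lambda>e. f e + g e) \<in> ell2"
proof -
  have "(\<lambda>e. 2 * (norm (f e))\<^sup>2 + 2 * (norm (g e))\<^sup>2) summable_on UNIV"
    using assms by (intro summable_on_add summable_on_cmult_right) (auto simp: ell2_def)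
  moreover have "(norm (x + y))\<^sup>2 \<le> 2 * (norm x)\<^sup>2 + 2 * (norm y)\<^sup>2" for x y :: 'b
    using inner_ge_zero[of "x - y"]
    by (simp add: power2_norm_eq_inner inner_diff inner_add inner_commute[of y x])
  ultimately have "(\<lambda>e. (norm (f e + g e))\<^sup>2) summable_on UNIV"
    by (rule summable_on_comparison_test) auto
  then show ?thesis using assms by (simp add: ell2_def)
qed

lemma ell2_scaleC:
  assumes "f \<in> ell2" shows "(\<lambda>e. c *\<^sub>C f e) \<in> ell2"
  using assms summable_on_cmult_right[of "\<lambda>e. (norm (f e))\<^sup>2" UNIV "(cmod c)\<^sup>2"]
  by (auto simp: ell2_def norm_scaleC power_mult_distrib)

lemma ell2_scaleR:
  assumes "f \<in> ell2" shows "(\<lambda>e. r *\<^sub>R f e) \<in> ell2"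
  using ell2_scaleC[OF assms, of "complex_of_real r"] by (simp add: scaleC_of_real)

lemma ell2_minus:
  assumes "f \<in> ell2" shows "(\<lambda>e. - f e) \<in> ell2"
  using ell2_scaleR[OF assms, of "-1"] by simp

lemma ell2_diff:
  assumes "f \<in> ell2" "g \<in> ell2" shows "(\<lambda>e. f e - g e) \<in> ell2"
  using ell2_add[OF assms(1) ell2_minus[OF assms(2)]] by simp

lemma ell2_cinner_summable:
  assumes "f \<in> ell2" "g \<in> ell2" shows "(\<lambda>e. cinner (f e) (g e)) summable_on UNIV"
proof (rule abs_summable_summable)
  have "(\<lambda>e. (norm (f e))\<^sup>2 + (norm (g e))\<^sup>2) summable_on UNIV"
    using assms by (intro summable_on_add) (auto simp: ell2_def)
  moreover have "cmod (cinner x y) \<le> (norm x)\<^sup>2 + (norm y)\<^sup>2" for x y :: 'b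
  proof -
    have "2 * (norm x * norm y) \<le> (norm x)\<^sup>2 + (norm y)\<^sup>2"
      using sum_squares_bound[of "norm x" "norm y"] by simp
    moreover have "0 \<le> norm x * norm y" by simp
    ultimately show ?thesis using norm_cinner_le[of x y] by linarith
  qed
  ultimately show "(\<lambda>e. norm (cinner (f e) (g e))) summable_on UNIV"
    by (rule summable_on_comparison_test) auto
qed

lemma ell2_inner_summable:
  assumes "f \<in> ell2" "g \<in> ell2" shows "(\<lambda>e. inner (f e) (g e)) summable_on UNIV"
  using summable_on_bounded_linear[OF bounded_linear_Re ell2_cinner_summable[OF assms]]
  by (simp add: Re_cinner)

typedef (overloaded) ('a, 'b) htensor = "ell2 :: ('a::chilbert_space \<Rightarrow> 'b::chilbert_space) set"
  morphisms coord Abs_htensor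
  using ell2_zero by blast

lemma coord_ell2 [simp]: "coord x \<in> ell2"
  by (rule coord)

instantiation htensor :: (chilbert_space, chilbert_space) complex_inner
begin

definition "0 = Abs_htensor (\<lambda>_. 0)"
definition "x + y = Abs_htensor (\<lambda>e. coord x e + coord y e)"
definition "x - y = Abs_htensor (\<lambda>e. coord x e - coord y e)"
definition "- x = Abs_htensor (\<lambda>e. - coord x e)"
definition "r *\<^sub>R x = Abs_htensor (\<lambda>e. r *\<^sub>R coord x e)"
definition "c *\<^sub>C x = Abs_htensor (\<lambda>e. c *\<^sub>C coord x e)"
definition "cinner x y = (\<Sum>\<^sub>\<infinity>e. cinner (coord x e) (coord y e))"
definition "inner x y = (\<Sum>\<^sub>\<infinity>e. inner (coord x e) (coord y e))" for x y :: "('a, 'b) htensor"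
definition "norm x = sqrt (inner x x)" for x :: "('a, 'b) htensor"
definition "dist x y = norm (x - y)" for x y :: "('a, 'b) htensor"
definition "sgn x = inverse (norm x) *\<^sub>R x" for x :: "('a, 'b) htensor"
definition "(uniformity :: (('a, 'b) htensor \<times> ('a, 'b) htensor) filter)
  = (INF e\<in>{0 <..}. principal {(x, y). dist x y < e})"
definition "open S \<longleftrightarrow> (\<forall>x\<in>S. \<forall>\<^sub>F (x', y) in uniformity. x' = x \<longrightarrow> y \<in> S)"
  for S :: "('a, 'b) htensor set"

lemma coord_simps [simp]:
  "coord (0 :: ('a, 'b) htensor) = (\<lambda>_. 0)"
  "coord (x + y) = (\<lambda>e. coord x e + coord y e)"
  "coord (x - y) = (\<lambda>e. coord x e - coord y e)"
  "coord (- x) = (\<lambda>e. - coord x e)"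
  "coord (r *\<^sub>R x) = (\<lambda>e. r *\<^sub>R coord x e)"
  "coord (c *\<^sub>C x) = (\<lambda>e. c *\<^sub>C coord x e)"
  for x y :: "('a, 'b) htensor"
  by (simp_all add: zero_htensor_def plus_htensor_def minus_htensor_def uminus_htensor_def
      scaleR_htensor_def scaleC_htensor_def Abs_htensor_inverse ell2_zero ell2_add ell2_diff
      ell2_minus ell2_scaleR ell2_scaleC)

instance
proof
  note eqI = coord_inject[THEN iffD1] and cs = ell2_cinner_summable[OF coord coord]
    and ins = ell2_inner_summable[OF coord coord]
  fix x y z :: "('a, 'b) htensor" and r s :: real and c d :: complex
  show "x + y + z = x + (y + z)" "x + y = y + x" "0 + x = x" "- x + x = 0" "x - y = x + - y"
    by (rule eqI; simp add: add_ac)+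
  show "r *\<^sub>R (x + y) = r *\<^sub>R x + r *\<^sub>R y" "(r + s) *\<^sub>R x = r *\<^sub>R x + s *\<^sub>R x"
    "r *\<^sub>R s *\<^sub>R x = (r * s) *\<^sub>R x" "1 *\<^sub>R x = x"
    by (rule eqI; simp add: scaleR_add_right scaleR_add_left)+
  show "inner x y = inner y x" by (simp add: inner_htensor_def inner_commute)
  show "inner (x + y) z = inner x z + inner y z"
    by (simp add: inner_htensor_def inner_add_left infsum_add ins)
  show "inner (r *\<^sub>R x) y = r * inner x y"
    by (simp add: inner_htensor_def infsum_cmult_right')
  show "0 \<le> inner x x" by (simp add: inner_htensor_def infsum_nonneg)
  show "inner x x = 0 \<longleftrightarrow> x = 0"
  proof
    assume "inner x x = 0"
    then have "inner (coord x e) (coord x e) = 0" for e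
      by (intro nonneg_infsum_le_0D[OF _ ins]) (auto simp: inner_htensor_def)
    then show "x = 0" by (intro eqI) auto
  qed (simp add: inner_htensor_def)
  show "c *\<^sub>C (x + y) = c *\<^sub>C x + c *\<^sub>C y" "(c + d) *\<^sub>C x = c *\<^sub>C x + d *\<^sub>C x"
    "c *\<^sub>C d *\<^sub>C x = (c * d) *\<^sub>C x" "complex_of_real r *\<^sub>C x = r *\<^sub>R x"
    by (rule eqI; simp add: scaleC_add_right scaleC_add_left scaleC_scaleC scaleC_of_real)+
  show "cinner x y = cnj (cinner y x)"
    unfolding cinner_htensor_def infsum_cnj[symmetric] by (simp add: cinner_commute[symmetric])
  show "cinner x (y + z) = cinner x y + cinner x z"
    by (simp add: cinner_htensor_def cinner_add_right infsum_add cs)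
  show "cinner x (c *\<^sub>C y) = c * cinner x y"
    by (simp add: cinner_htensor_def cinner_scaleC_right infsum_cmult_right')
  show "Re (cinner x y) = inner x y"
    using infsumI[OF has_sum_bounded_linear[OF bounded_linear_Re has_sum_infsum[OF cs[of x y]]]]
    by (simp add: cinner_htensor_def inner_htensor_def Re_cinner)
qed (simp_all add: uniformity_htensor_def open_htensor_def norm_htensor_def dist_htensor_def
    sgn_htensor_def)

end

lemma norm_htensor_has_sum: "((\<lambda>e. (norm (coord x e))\<^sup>2) has_sum (norm x)\<^sup>2) UNIV"
proof -
  have "(\<lambda>e. (norm (coord x e))\<^sup>2) summable_on UNIV"
    using coord[of x] by (simp add: ell2_def)
  moreover have "(norm x)\<^sup>2 = (\<Sum>\<^sub>\<infinity>e. (norm (coord x e))\<^sup>2)"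
    by (simp only: power2_norm_eq_inner inner_htensor_def)
  ultimately show ?thesis by simp
qed

lemma sum_norm_coord_le:
  assumes "finite F" shows "(\<Sum>e\<in>F. (norm (coord x e))\<^sup>2) \<le> (norm x)\<^sup>2"
  using assms norm_htensor_has_sum[of x] by (intro finite_sum_le_has_sum) auto

instance htensor :: (chilbert_space, chilbert_space) chilbert_space
proof
  fix X :: "nat \<Rightarrow> ('a, 'b) htensor" assume X: "Cauchy X"
  have le: "norm (coord x e) \<le> norm x" for x :: "('a, 'b) htensor" and e
    using sum_norm_coord_le[of "{e}" x] by - (rule power2_le_imp_le, simp_all)
  have "Cauchy (\<lambda>n. coord (X n) e)" for e
    unfolding Cauchy_def
  proof (intro allI impI)
    fix r :: real assume "r > 0"
    then obtain M where M: "\<forall>m\<ge>M. \<forall>n\<ge>M. dist (X m) (X n) < r" using X unfolding Cauchy_def by blast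
    have "dist (coord (X m) e) (coord (X n) e) \<le> dist (X m) (X n)" for m n
      using le[of "X m - X n" e] by (simp add: dist_norm)
    then show "\<exists>M. \<forall>m\<ge>M. \<forall>n\<ge>M. dist (coord (X m) e) (coord (X n) e) < r"
      using M by (meson le_less_trans)
  qed
  then have "\<forall>e. \<exists>l. (\<lambda>n. coord (X n) e) \<longlonglongrightarrow> l"
    using Cauchy_convergent convergent_def by blast
  then obtain g where g: "\<And>e. (\<lambda>n. coord (X n) e) \<longlonglongrightarrow> g e" by metis
  have sup: "g e = 0" if "e \<notin> some_onb" for e
  proof -
    have "coord (X n) e = 0" for n using coord[of "X n"] that by (simp add: ell2_def)
    then show ?thesis using g[of e] by (simp add: LIMSEQ_const_iff)
  qed
  have tail: "\<exists>N. \<forall>n\<ge>N. \<forall>F. finite F \<longrightarrow> (\<Sum>e\<in>F. (norm (g e - coord (X n) e))\<^sup>2) \<le> r\<^sup>2"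
    if "r > 0" for r
  proof -
    obtain N where N: "\<forall>m\<ge>N. \<forall>n\<ge>N. dist (X m) (X n) < r" using X \<open>r > 0\<close> unfolding Cauchy_def by blast
    have "(\<Sum>e\<in>F. (norm (g e - coord (X n) e))\<^sup>2) \<le> r\<^sup>2" if "n \<ge> N" "finite F" for n F
    proof (rule tendsto_upperbound)
      show "(\<lambda>m. \<Sum>e\<in>F. (norm (coord (X m) e - coord (X n) e))\<^sup>2)
          \<longlonglongrightarrow> (\<Sum>e\<in>F. (norm (g e - coord (X n) e))\<^sup>2)"
        by (intro tendsto_intros g)
      have "(\<Sum>e\<in>F. (norm (coord (X m) e - coord (X n) e))\<^sup>2) \<le> r\<^sup>2" if "m \<ge> N" for m
      proof -
        have "(\<Sum>e\<in>F. (norm (coord (X m - X n) e))\<^sup>2) \<le> (norm (X m - X n))\<^sup>2"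
          by (rule sum_norm_coord_le) fact
        also have "\<dots> \<le> r\<^sup>2"
          using N that \<open>n \<ge> N\<close> by (intro power_mono) (auto simp: dist_norm intro: less_imp_le)
        finally show ?thesis by simp
      qed
      then show "\<forall>\<^sub>F m in sequentially. (\<Sum>e\<in>F. (norm (coord (X m) e - coord (X n) e))\<^sup>2) \<le> r\<^sup>2"
        unfolding eventually_sequentially by blast
    qed simp
    then show ?thesis by blast
  qed
  have d_ell2: "(\<lambda>e. g e - coord (X n) e) \<in> ell2"
    if "\<forall>F. finite F \<longrightarrow> (\<Sum>e\<in>F. (norm (g e - coord (X n) e))\<^sup>2) \<le> r\<^sup>2" for n r
  proof -
    have "(\<lambda>e. (norm (g e - coord (X n) e))\<^sup>2) summable_on UNIV"
      using that by (intro nonneg_bdd_above_summable_on bdd_aboveI2[where M = "r\<^sup>2"]) auto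
    then show ?thesis using sup coord[of "X n"] by (simp add: ell2_def)
  qed
  obtain N where "\<forall>n\<ge>N. \<forall>F. finite F \<longrightarrow> (\<Sum>e\<in>F. (norm (g e - coord (X n) e))\<^sup>2) \<le> 1\<^sup>2"
    using tail[of 1] by auto
  then have "(\<lambda>e. (g e - coord (X N) e) + coord (X N) e) \<in> ell2"
    by (intro ell2_add d_ell2[where r = 1]) auto
  then have G: "coord (Abs_htensor g) = g" by (simp add: Abs_htensor_inverse)
  have "X \<longlonglongrightarrow> Abs_htensor g"
  proof (rule metric_LIMSEQ_I)
    fix r :: real assume "r > 0"
    then obtain N where N: "\<forall>n\<ge>N. \<forall>F. finite F \<longrightarrow> (\<Sum>e\<in>F. (norm (g e - coord (X n) e))\<^sup>2) \<le> (r/2)\<^sup>2"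
      using tail[of "r/2"] by auto
    have "dist (X n) (Abs_htensor g) < r" if "n \<ge> N" for n
    proof -
      have "(norm (Abs_htensor g - X n))\<^sup>2 \<le> (r/2)\<^sup>2"
        by (rule has_sum_le_finite_sums[OF norm_htensor_has_sum]) (use N that in \<open>auto simp: G\<close>)
      then have "norm (Abs_htensor g - X n) \<le> r/2"
        using \<open>r > 0\<close> by - (rule power2_le_imp_le, simp_all)
      then show ?thesis using \<open>r > 0\<close> by (simp add: dist_norm norm_minus_commute)
    qed
    then show "\<exists>N. \<forall>n\<ge>N. dist (X n) (Abs_htensor g) < r" by blast
  qed
  then show "convergent X" by (auto simp: convergent_def)
qed

definition tensor :: "'a::chilbert_space \<Rightarrow> 'b::chilbert_space \<Rightarrow> ('a, 'b) htensor"  (infixr "\<otimes>\<^sub>h" 70)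
  where "x \<otimes>\<^sub>h y = Abs_htensor (\<lambda>e. if e \<in> some_onb then cinner e x *\<^sub>C y else 0)"

lemma coord_tensor: "coord (x \<otimes>\<^sub>h y) = (\<lambda>e. if e \<in> some_onb then cinner e x *\<^sub>C y else 0)"
proof -
  have "(\<lambda>e. (norm y)\<^sup>2 * (cmod (cinner e x))\<^sup>2) summable_on some_onb"
    by (intro summable_on_cmult_right onb_coeff_summable)
  then have "(\<lambda>e. (norm (if e \<in> some_onb then cinner e x *\<^sub>C y else 0))\<^sup>2) summable_on UNIV"
    by (rule summable_on_cong_neutral[THEN iffD1, rotated 3])
      (auto simp: norm_scaleC power_mult_distrib)
  then have "(\<lambda>e. if e \<in> some_onb then cinner e x *\<^sub>C y else 0) \<in> ell2"
    by (simp add: ell2_def)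
  then show ?thesis by (simp add: tensor_def Abs_htensor_inverse)
qed

lemma cinner_tensor: "cinner (x \<otimes>\<^sub>h y) (x' \<otimes>\<^sub>h y') = cinner x x' * cinner y y'"
proof -
  have "((\<lambda>e. cnj (cinner e x) * cinner e x' * cinner y y') has_sum cinner x x' * cinner y y') some_onb"
    by (intro has_sum_cmult_left parseval)
  then have "((\<lambda>e. cinner (coord (x \<otimes>\<^sub>h y) e) (coord (x' \<otimes>\<^sub>h y') e)) has_sum cinner x x' * cinner y y') UNIV"
    by (rule has_sum_cong_neutral[THEN iffD1, rotated 3])
      (auto simp: coord_tensor cinner_scaleC_left cinner_scaleC_right)
  then show ?thesis by (simp add: cinner_htensor_def infsumI)
qed

lemma tensor_linear:
  "(x + x') \<otimes>\<^sub>h y = x \<otimes>\<^sub>h y + x' \<otimes>\<^sub>h y" "x \<otimes>\<^sub>h (y + y') = x \<otimes>\<^sub>h y + x \<otimes>\<^sub>h y'"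
  "(c *\<^sub>C x) \<otimes>\<^sub>h y = c *\<^sub>C (x \<otimes>\<^sub>h y)" "x \<otimes>\<^sub>h (c *\<^sub>C y) = c *\<^sub>C (x \<otimes>\<^sub>h y)"
  by (rule coord_inject[THEN iffD1];
      auto simp: coord_tensor cinner_add_right cinner_scaleC_right scaleC_add_left scaleC_add_right
        scaleC_scaleC mult.commute)+

lemma tensor_dense: "closure (span {x \<otimes>\<^sub>h y |x y. True}) = (UNIV :: ('a::chilbert_space, 'b::chilbert_space) htensor set)"
proof -
  have "z \<in> closure (span {x \<otimes>\<^sub>h y |x y. True})" for z :: "('a, 'b) htensor"
    unfolding closure_approachable
  proof (intro allI impI)
    fix r :: real assume "r > 0"
    let ?c = "\<lambda>e. (norm (coord z e))\<^sup>2"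
    have "\<forall>\<^sub>F F in finite_subsets_at_top UNIV. dist (sum ?c F) ((norm z)\<^sup>2) < r\<^sup>2"
      using norm_htensor_has_sum[of z] \<open>r > 0\<close> by (intro tendstoD) (simp_all add: has_sum_def)
    then obtain F where F: "finite F" "dist (sum ?c F) ((norm z)\<^sup>2) < r\<^sup>2"
      unfolding eventually_finite_subsets_at_top by blast
    define G where "G = F \<inter> some_onb"
    have G: "finite G" "G \<subseteq> some_onb" using F by (auto simp: G_def)
    have off: "coord z e = 0" if "e \<notin> some_onb" for e
      using coord[of z] that by (simp add: ell2_def)
    have FG: "sum ?c F = sum ?c G"
      unfolding G_def using F off by (intro sum.mono_neutral_right) auto
    define w where "w = (\<Sum>e\<in>G. e \<otimes>\<^sub>h coord z e)"
    have "coord (\<Sum>e\<in>S. e \<otimes>\<^sub>h coord z e) f = (if f \<in> S then coord z f else 0)"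
      if "finite S" "S \<subseteq> some_onb" for S f
      using that
      by (induction S rule: finite_induct)
        (auto simp: coord_tensor some_onb_cinner)
    then have cw: "coord w f = (if f \<in> G then coord z f else 0)" for f
      using G by (simp add: w_def)
    have "(?c has_sum sum ?c G) G" using G by (simp add: has_sum_finite)
    then have "((\<lambda>e. if e \<in> G then ?c e else 0) has_sum sum ?c G) UNIV"
      by (rule has_sum_cong_neutral[THEN iffD1, rotated 3]) auto
    from has_sum_add[OF norm_htensor_has_sum[of z] has_sum_cmult_right[OF this, of "-1"]]
    have "((\<lambda>e. ?c e - (if e \<in> G then ?c e else 0)) has_sum (norm z)\<^sup>2 - sum ?c G) UNIV"
      by simp
    moreover have "?c e - (if e \<in> G then ?c e else 0) = (norm (coord (w - z) e))\<^sup>2" for e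
      by (simp add: cw)
    ultimately have "(norm (w - z))\<^sup>2 = (norm z)\<^sup>2 - sum ?c G"
      using has_sum_unique[OF norm_htensor_has_sum[of "w - z"]] by simp
    also have "\<dots> < r\<^sup>2"
      using F(2) by (simp add: FG dist_real_def)
    finally have "norm (w - z) < r"
      using \<open>r > 0\<close> by - (rule power2_less_imp_less, simp_all)
    then have "dist w z < r" by (simp add: dist_norm)
    moreover have "w \<in> span {x \<otimes>\<^sub>h y |x y. True}"
      unfolding w_def by (intro span_sum span_base) blast
    ultimately show "\<exists>y\<in>span {x \<otimes>\<^sub>h y |x y. True}. dist y z < r" by blast
  qed
  then show ?thesis by blast
qed


section \<open>Bounded operators\<close>

type_synonym 'a op = "'a \<Rightarrow>\<^sub>L 'a"

text \<open>\<open>blinfun\<close> is the type of bounded real-linear maps; \<open>clinear\<close> cuts out the complex-linear ones.\<close>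

definition clinear :: "('a::chilbert_space \<Rightarrow>\<^sub>L 'b::chilbert_space) \<Rightarrow> bool"
  where "clinear T \<longleftrightarrow> (\<forall>c x. blinfun_apply T (c *\<^sub>C x) = c *\<^sub>C blinfun_apply T x)"

definition cscale :: "complex \<Rightarrow> ('a::chilbert_space \<Rightarrow>\<^sub>L 'b::chilbert_space) \<Rightarrow> ('a \<Rightarrow>\<^sub>L 'b)"
  where "cscale c T = Blinfun (\<lambda>x. c *\<^sub>C blinfun_apply T x)"

definition adj :: "('a::chilbert_space \<Rightarrow>\<^sub>L 'b::chilbert_space) \<Rightarrow> ('b \<Rightarrow>\<^sub>L 'a)"
  where "adj T = (THE S. \<forall>x y. cinner (blinfun_apply S x) y = cinner x (blinfun_apply T y))"

definition unitary :: "('a::chilbert_space \<Rightarrow>\<^sub>L 'b::chilbert_space) \<Rightarrow> bool"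
  where "unitary U \<longleftrightarrow> clinear U \<and> adj U o\<^sub>L U = id_blinfun \<and> U o\<^sub>L adj U = id_blinfun"

definition op_tensor :: "('a::chilbert_space \<Rightarrow>\<^sub>L 'c::chilbert_space) \<Rightarrow> ('b::chilbert_space \<Rightarrow>\<^sub>L 'd::chilbert_space)
    \<Rightarrow> (('a, 'b) htensor \<Rightarrow>\<^sub>L ('c, 'd) htensor)"  (infixr "\<otimes>\<^sub>o" 70)
  where "S \<otimes>\<^sub>o T = (THE R. \<forall>x y. blinfun_apply R (x \<otimes>\<^sub>h y) = blinfun_apply S x \<otimes>\<^sub>h blinfun_apply T y)"

definition flip :: "('a::chilbert_space, 'b::chilbert_space) htensor \<Rightarrow>\<^sub>L ('b, 'a) htensor"
  where "flip = (THE R. \<forall>x y. blinfun_apply R (x \<otimes>\<^sub>h y) = y \<otimes>\<^sub>h x)"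

definition assoc :: "(('a::chilbert_space, 'b::chilbert_space) htensor, 'c::chilbert_space) htensor
    \<Rightarrow>\<^sub>L ('a, ('b, 'c) htensor) htensor"
  where "assoc = (THE R. \<forall>x y z. blinfun_apply R ((x \<otimes>\<^sub>h y) \<otimes>\<^sub>h z) = x \<otimes>\<^sub>h (y \<otimes>\<^sub>h z))"

text \<open>Threefold tensor products are bracketed to the right; \<open>reassoc\<close> transports operators there.\<close>

definition reassoc :: "(('a::chilbert_space, 'b::chilbert_space) htensor, 'c::chilbert_space) htensor op
    \<Rightarrow> ('a, ('b, 'c) htensor) htensor op"
  where "reassoc X = assoc o\<^sub>L X o\<^sub>L adj assoc"

definition leg12 :: "('a::chilbert_space, 'b::chilbert_space) htensor op
    \<Rightarrow> ('a, ('b, 'c::chilbert_space) htensor) htensor op"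
  where "leg12 X = reassoc (X \<otimes>\<^sub>o id_blinfun)"

definition leg23 :: "('b::chilbert_space, 'c::chilbert_space) htensor op
    \<Rightarrow> ('a::chilbert_space, ('b, 'c) htensor) htensor op"
  where "leg23 X = id_blinfun \<otimes>\<^sub>o X"

definition leg13 :: "('a::chilbert_space, 'c::chilbert_space) htensor op
    \<Rightarrow> ('a, ('b::chilbert_space, 'c) htensor) htensor op"
  where "leg13 X = (id_blinfun \<otimes>\<^sub>o flip) o\<^sub>L leg12 X o\<^sub>L (id_blinfun \<otimes>\<^sub>o flip)"


section \<open>\<open>C\<^sup>*\<close>-algebras and their morphisms\<close>

text \<open>A \<open>C\<^sup>*\<close>-algebra is given by a faithful nondegenerate representation, that is, as a norm-closed
  *-subalgebra \<open>A\<close> of the bounded operators on a Hilbert space \<open>H\<close> such that \<open>A H\<close> is total in \<open>H\<close>.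
  By the Gelfand--Naimark theorem every \<open>C\<^sup>*\<close>-algebra is of this form.  In such a representation the
  spatial tensor product is the closed span of the elementary tensors, and the multiplier algebra is
  the idealiser of \<open>A\<close>.

  \<open>span\<close> is the real span, but it is only applied to sets that are closed under complex scalars.\<close>

definition cstar_alg :: "'a::chilbert_space op set \<Rightarrow> bool"
  where "cstar_alg A \<longleftrightarrow>
    (\<forall>T\<in>A. clinear T) \<and> 0 \<in> A \<and>
    (\<forall>S\<in>A. \<forall>T\<in>A. S + T \<in> A \<and> S o\<^sub>L T \<in> A) \<and>
    (\<forall>c. \<forall>T\<in>A. cscale c T \<in> A) \<and> (\<forall>T\<in>A. adj T \<in> A) \<and> closed A \<and>
    closure (span {blinfun_apply T x |T x. T \<in> A}) = UNIV"

definition spatial :: "'a::chilbert_space op set \<Rightarrow> 'b::chilbert_space op set \<Rightarrow> ('a, 'b) htensor op set"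
    (infixr "\<otimes>\<^sub>C" 70)
  where "A \<otimes>\<^sub>C B = closure (span {a \<otimes>\<^sub>o b |a b. a \<in> A \<and> b \<in> B})"

definition multipliers :: "'a::chilbert_space op set \<Rightarrow> 'a op set"
  where "multipliers A = {T. clinear T \<and> (\<forall>a\<in>A. T o\<^sub>L a \<in> A \<and> a o\<^sub>L T \<in> A)}"

definition unitary_multipliers :: "'a::chilbert_space op set \<Rightarrow> 'a op set"
  where "unitary_multipliers A = {U \<in> multipliers A. unitary U}"

definition cstar_mor :: "'a::chilbert_space op set \<Rightarrow> 'b::chilbert_space op set \<Rightarrow> ('a op \<Rightarrow> 'b op) set"
  where "cstar_mor A B = {\<phi> \<in> A \<rightarrow>\<^sub>E multipliers B.
    (\<forall>S\<in>A. \<forall>T\<in>A. \<phi> (S + T) = \<phi> S + \<phi> T \<and> \<phi> (S o\<^sub>L T) = \<phi> S o\<^sub>L \<phi> T) \<and>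
    (\<forall>c. \<forall>T\<in>A. \<phi> (cscale c T) = cscale c (\<phi> T)) \<and>
    (\<forall>T\<in>A. \<phi> (adj T) = adj (\<phi> T)) \<and>
    closure (span {\<phi> a o\<^sub>L b |a b. a \<in> A \<and> b \<in> B}) = B}"

text \<open>The extension of a nondegenerate homomorphism \<open>\<phi>\<close> on \<open>A\<close> to the multiplier algebra of \<open>A\<close>; it is
  unique because the operators \<open>\<phi> a\<close> have total range.\<close>

definition mor_ext :: "'a::chilbert_space op set \<Rightarrow> ('a op \<Rightarrow> 'b::chilbert_space op) \<Rightarrow> 'a op \<Rightarrow> 'b op"
  where "mor_ext A \<phi> T = (THE S. \<forall>a\<in>A. S o\<^sub>L \<phi> a = \<phi> (T o\<^sub>L a))"

text \<open>The map \<open>\<phi> \<otimes> \<psi>\<close> on \<open>A \<otimes> B\<close>; continuity and linearity make it unique.\<close>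

definition mor_tensor :: "'a::chilbert_space op set \<Rightarrow> 'b::chilbert_space op set \<Rightarrow>
    ('a op \<Rightarrow> 'c::chilbert_space op) \<Rightarrow> ('b op \<Rightarrow> 'd::chilbert_space op) \<Rightarrow>
    ('a, 'b) htensor op \<Rightarrow> ('c, 'd) htensor op"
  where "mor_tensor A B \<phi> \<psi> = (THE h. h \<in> extensional (A \<otimes>\<^sub>C B) \<and> continuous_on (A \<otimes>\<^sub>C B) h \<and>
    (\<forall>X\<in>A \<otimes>\<^sub>C B. \<forall>Y\<in>A \<otimes>\<^sub>C B. h (X + Y) = h X + h Y) \<and>
    (\<forall>c. \<forall>X\<in>A \<otimes>\<^sub>C B. h (cscale c X) = cscale c (h X)) \<and>
    (\<forall>a\<in>A. \<forall>b\<in>B. h (a \<otimes>\<^sub>o b) = \<phi> a \<otimes>\<^sub>o \<psi> b))"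

definition cstar_bialgebra :: "'a::chilbert_space op set \<Rightarrow> ('a op \<Rightarrow> ('a, 'a) htensor op) \<Rightarrow> bool"
  where "cstar_bialgebra A \<Delta> \<longleftrightarrow> cstar_alg A \<and> \<Delta> \<in> cstar_mor A (A \<otimes>\<^sub>C A) \<and>
    (\<forall>a\<in>A. reassoc (mor_ext (A \<otimes>\<^sub>C A) (mor_tensor A A \<Delta> (\<lambda>x. x)) (\<Delta> a))
      = mor_ext (A \<otimes>\<^sub>C A) (mor_tensor A A (\<lambda>x. x) \<Delta>) (\<Delta> a))"

definition hopf_homs :: "'a::chilbert_space op set \<Rightarrow> ('a op \<Rightarrow> ('a, 'a) htensor op) \<Rightarrow>
    'b::chilbert_space op set \<Rightarrow> ('b op \<Rightarrow> ('b, 'b) htensor op) \<Rightarrow> ('a op \<Rightarrow> 'b op) set"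
  where "hopf_homs C \<Delta>C A \<Delta>A = {f \<in> cstar_mor C A.
    \<forall>c\<in>C. mor_ext A \<Delta>A (f c) = mor_ext (C \<otimes>\<^sub>C C) (mor_tensor C C f f) (\<Delta>C c)}"


section \<open>Modular multiplicative unitaries\<close>

text \<open>Unbounded operators are represented by their graphs.\<close>

definition self_adjoint :: "'a::chilbert_space rel \<Rightarrow> bool"
  where "self_adjoint G \<longleftrightarrow> subspace G \<and> (\<forall>c. \<forall>(x, y)\<in>G. (c *\<^sub>C x, c *\<^sub>C y) \<in> G) \<and>
    single_valued G \<and> closure (Domain G) = UNIV \<and>
    G = {(x, y). \<forall>(u, v)\<in>G. cinner x v = cinner y u}"

definition positive_injective :: "'a::chilbert_space rel \<Rightarrow> bool"
  where "positive_injective G \<longleftrightarrow> (\<forall>(x, y)\<in>G. cinner x y \<in> \<real>\<^sub>\<ge>\<^sub>0) \<and> (\<forall>x. (x, 0) \<in> G \<longrightarrow> x = 0)"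

definition graph_tensor :: "'a::chilbert_space rel \<Rightarrow> 'b::chilbert_space rel \<Rightarrow> ('a, 'b) htensor rel"
  where "graph_tensor G K = closure (span {(x \<otimes>\<^sub>h u, y \<otimes>\<^sub>h v) |x y u v. (x, y) \<in> G \<and> (u, v) \<in> K})"

definition multiplicative_unitary :: "('h::chilbert_space, 'h) htensor op \<Rightarrow> bool"
  where "multiplicative_unitary W \<longleftrightarrow> unitary W \<and>
    leg23 W o\<^sub>L leg12 W = (leg12 W o\<^sub>L leg13 W o\<^sub>L leg23 W :: ('h, ('h, 'h) htensor) htensor op)"

definition modular :: "('h::chilbert_space, 'h) htensor op \<Rightarrow> bool"
  where "modular W \<longleftrightarrow> (\<exists>(Qh :: 'h rel) (Q :: 'h rel) (Wt :: ('h conjugate, 'h) htensor op).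
    self_adjoint Qh \<and> positive_injective Qh \<and> self_adjoint Q \<and> positive_injective Q \<and> unitary Wt \<and>
    {(x, blinfun_apply (adj W) z) |x z. (blinfun_apply W x, z) \<in> graph_tensor Qh Q} = graph_tensor Qh Q \<and>
    (\<forall>x z. \<forall>(y, Qy)\<in>Q. \<forall>(u, Qinv_u)\<in>Q\<inverse>.
      cinner (x \<otimes>\<^sub>h y) (blinfun_apply W (z \<otimes>\<^sub>h u))
      = cinner (bar z \<otimes>\<^sub>h Qy) (blinfun_apply Wt (bar x \<otimes>\<^sub>h Qinv_u))))"


section \<open>Quantum groups, duals and universal quantum groups\<close>

text \<open>\<open>normal_functionals\<close> is the predual of the bounded operators: its elements are the functionals
  \<open>T \<mapsto> Tr(\<rho> T)\<close> with \<open>\<rho>\<close> of trace class.\<close>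

definition normal_functionals :: "('a::chilbert_space op \<Rightarrow> complex) set"
  where "normal_functionals = {\<omega>. \<exists>x y :: nat \<Rightarrow> 'a.
    summable (\<lambda>n. (norm (x n))\<^sup>2) \<and> summable (\<lambda>n. (norm (y n))\<^sup>2) \<and>
    \<omega> = (\<lambda>T. \<Sum>n. cinner (x n) (blinfun_apply T (y n)))}"

definition slice_left :: "('a::chilbert_space op \<Rightarrow> complex) \<Rightarrow> ('a, 'b::chilbert_space) htensor op \<Rightarrow> 'b op"
  where "slice_left \<omega> X = (THE S. \<forall>u v. cinner u (blinfun_apply S v)
    = \<omega> (adj (Blinfun (\<lambda>x. x \<otimes>\<^sub>h u)) o\<^sub>L X o\<^sub>L Blinfun (\<lambda>x. x \<otimes>\<^sub>h v)))"

definition slice_right :: "('b::chilbert_space op \<Rightarrow> complex) \<Rightarrow> ('a::chilbert_space, 'b) htensor op \<Rightarrow> 'a op"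
  where "slice_right \<omega> X = (THE S. \<forall>u v. cinner u (blinfun_apply S v)
    = \<omega> (adj (Blinfun (\<lambda>y. u \<otimes>\<^sub>h y)) o\<^sub>L X o\<^sub>L Blinfun (\<lambda>y. v \<otimes>\<^sub>h y)))"

definition quantum_group :: "('h::chilbert_space, 'h) htensor op \<Rightarrow> 'h op set \<Rightarrow>
    ('h op \<Rightarrow> ('h, 'h) htensor op) \<Rightarrow> bool"
  where "quantum_group W C \<Delta>C \<longleftrightarrow> multiplicative_unitary W \<and> modular W \<and>
    C = closure {slice_left \<omega> W |\<omega>. \<omega> \<in> normal_functionals} \<and>
    \<Delta>C = (\<lambda>x\<in>C. W o\<^sub>L (x \<otimes>\<^sub>o id_blinfun) o\<^sub>L adj W)"

definition dual :: "('h::chilbert_space, 'h) htensor op \<Rightarrow> 'h op set"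
  where "dual W = closure {slice_right \<omega> (adj W) |\<omega>. \<omega> \<in> normal_functionals}"

definition dual_comult :: "('h::chilbert_space, 'h) htensor op \<Rightarrow> 'h op \<Rightarrow> ('h, 'h) htensor op"
  where "dual_comult W = (\<lambda>y\<in>dual W. flip o\<^sub>L adj W o\<^sub>L (id_blinfun \<otimes>\<^sub>o y) o\<^sub>L W o\<^sub>L flip)"

text \<open>The extensions of \<open>\<Delta> \<otimes> id\<close>, with \<open>\<Delta>\<close> the comultiplication of the dual, and of \<open>id \<otimes> \<phi>\<close> to
  multipliers of \<open>dual W \<otimes>\<^sub>C D\<close>.\<close>

definition dual_comult_id :: "('h::chilbert_space, 'h) htensor op \<Rightarrow> 'd::chilbert_space op set \<Rightarrow>
    ('h, 'd) htensor op \<Rightarrow> ('h, ('h, 'd) htensor) htensor op"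
  where "dual_comult_id W D U = reassoc (mor_ext (dual W \<otimes>\<^sub>C D) (mor_tensor (dual W) D (dual_comult W) (\<lambda>x. x)) U)"

definition id_mor :: "('h::chilbert_space, 'h) htensor op \<Rightarrow> 'd::chilbert_space op set \<Rightarrow>
    ('d op \<Rightarrow> 'e::chilbert_space op) \<Rightarrow> ('h, 'd) htensor op \<Rightarrow> ('h, 'e) htensor op"
  where "id_mor W D \<phi> U = mor_ext (dual W \<otimes>\<^sub>C D) (mor_tensor (dual W) D (\<lambda>x. x) \<phi>) U"

definition left_corep :: "('h::chilbert_space, 'h) htensor op \<Rightarrow> 'd::chilbert_space op set \<Rightarrow>
    ('h, 'd) htensor op \<Rightarrow> bool"
  where "left_corep W D U \<longleftrightarrow> U \<in> unitary_multipliers (dual W \<otimes>\<^sub>C D) \<and>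
    dual_comult_id W D U = leg23 U o\<^sub>L leg13 U"

text \<open>Quantification over types is not possible inside a formula, so the Hilbert space type \<open>'d\<close> on
  which the test algebras \<open>D\<close> act is a parameter of the universal property.  A universal pair
  satisfies \<open>universal_corep\<close> for all choices of \<open>'d\<close>; a theorem that assumes it for some of them
  only is the stronger for it.\<close>

definition universal_corep :: "('h::chilbert_space, 'h) htensor op \<Rightarrow> 'u::chilbert_space op set \<Rightarrow>
    ('h, 'u) htensor op \<Rightarrow> 'd::chilbert_space itself \<Rightarrow> bool"
  where "universal_corep W Cu V (_ :: 'd itself) \<longleftrightarrow> cstar_alg Cu \<and> left_corep W Cu V \<and>
    (\<forall>(D :: 'd op set) U. cstar_alg D \<and> left_corep W D U \<longrightarrow>
      (\<exists>!\<phi>. \<phi> \<in> cstar_mor Cu D \<and> U = id_mor W Cu \<phi> V))"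

definition universal_comult :: "('h::chilbert_space, 'h) htensor op \<Rightarrow> 'u::chilbert_space op set \<Rightarrow>
    ('h, 'u) htensor op \<Rightarrow> ('u op \<Rightarrow> ('u, 'u) htensor op) \<Rightarrow> bool"
  where "universal_comult W Cu V \<Delta>u \<longleftrightarrow> \<Delta>u \<in> cstar_mor Cu (Cu \<otimes>\<^sub>C Cu) \<and>
    id_mor W Cu \<Delta>u V = leg12 V o\<^sub>L leg13 V"

definition bicharacters :: "('h::chilbert_space, 'h) htensor op \<Rightarrow> 'a::chilbert_space op set \<Rightarrow>
    ('a op \<Rightarrow> ('a, 'a) htensor op) \<Rightarrow> ('h, 'a) htensor op set"
  where "bicharacters W A \<Delta>A = {V \<in> unitary_multipliers (dual W \<otimes>\<^sub>C A).
    dual_comult_id W A V = leg23 V o\<^sub>L leg13 V \<and> id_mor W A \<Delta>A V = leg12 V o\<^sub>L leg13 V}"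

end

theory Submission
  imports Defs
begin

text \<open>
  Under the universal property, a morphism \<open>\<phi>\<close> from \<open>Cu\<close> to \<open>A\<close> is the same as the left
  corepresentation \<open>U = (id \<otimes> \<phi>)(V)\<close> on \<open>A\<close>.  The two morphisms \<open>\<Delta>A \<circ> \<phi>\<close> and \<open>(\<phi> \<otimes> \<phi>) \<circ> \<Delta>u\<close> into
  \<open>A \<otimes> A\<close> correspond in the same way to \<open>(id \<otimes> \<Delta>A)(U)\<close> and \<open>U\<^sub>1\<^sub>2 U\<^sub>1\<^sub>3\<close>, so \<open>\<phi>\<close> is a Hopf
  *-homomorphism if and only if \<open>U\<close> is a bicharacter.

  The work lies in showing that \<open>id \<otimes> \<phi>\<close> is well behaved on multipliers.  It is constructed on all
  adjointable operators \<open>T\<close> of the Hilbert module \<open>H \<otimes> C\<close>, and it is determined by the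
  matrix coefficients \<open>T\<^sub>x\<^sub>z\<close> in the multiplier algebra of \<open>C\<close>, to which the extension of \<open>\<phi>\<close> is applied.
  All identities between legs reduce to identities of such coefficients.  Applied with \<open>H \<otimes> H\<close> in
  place of \<open>H\<close>, where the comultiplication of the dual is conjugation by a unitary on \<open>H \<otimes> H\<close>,
  the construction shows that \<open>U\<close> is a corepresentation because \<open>V\<close> is one.
\<close>

section \<open>Functionals, adjoints and operators given on a total set\<close>

text \<open>The operations \<open>\<otimes>\<^sub>o\<close>, \<open>mor_ext\<close> and
  \<open>mor_tensor\<close> are definite descriptions, so each needs an existence proof, which comes
  down to a norm bound on finite combinations of total vectors. One device yields these bounds: if
  the inner products of the vectors moved by \<open>S\<close> and \<open>T\<close> depend only on
  \<open>adj S o\<^sub>L T\<close>, then the action of \<open>T\<close> is bounded by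
  \<open>norm T\<close>. The obstacle is that the identities to be transported leave
  \<open>dual W \<otimes>\<^sub>C C\<close>: the comultiplication of the dual and the leg
  \<open>V13\<close> involve \<open>W\<close> and the flip, acting on \<open>H \<otimes> H\<close>
  next to the identity of the last leg. This is why \<open>id \<otimes> \<phi>\<close> is enlarged
  to all adjointable operators of \<open>H \<otimes> C\<close>, usually known as the multipliers of
  \<open>K(H) \<otimes> C\<close> with \<open>K(H)\<close> the compact operators. They include every
  complex-linear \<open>S\<close> tensored with the identity, and \<open>id \<otimes> \<phi>\<close>
  sends it to \<open>S\<close> tensored with the identity. The corepresentation identity becomes an
  equation between such constants and shifted copies of \<open>V\<close>, and a multiplicative map
  may be applied to both sides.\<close>

abbreviation clspan :: "'a::real_normed_vector set \<Rightarrow> 'a set"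
  where "clspan S \<equiv> closure (span S)"

lemma closure_subspace:
  fixes S :: "'a::real_normed_vector set"
  assumes "subspace S" shows "subspace (closure S)"
proof -
  have "x + y \<in> closure S" if xy: "x \<in> closure S" "y \<in> closure S" for x y
  proof -
    from xy obtain X Y where "\<forall>n. X n \<in> S" "X \<longlonglongrightarrow> x" "\<forall>n. Y n \<in> S" "Y \<longlonglongrightarrow> y"
      unfolding closure_sequential by blast
    then show ?thesis unfolding closure_sequential
      by (intro exI[of _ "\<lambda>n. X n + Y n"]) (auto intro: subspace_add[OF assms] tendsto_add)
  qed
  moreover have "r *\<^sub>R x \<in> closure S" if x: "x \<in> closure S" for r x
  proof -
    from x obtain X where "\<forall>n. X n \<in> S" "X \<longlonglongrightarrow> x" unfolding closure_sequential by blast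
    then show ?thesis unfolding closure_sequential
      by (intro exI[of _ "\<lambda>n. r *\<^sub>R X n"]) (auto intro: subspace_scale[OF assms] tendsto_scaleR)
  qed
  ultimately show ?thesis
    using closure_subset[of S] subspace_0[OF assms] unfolding subspace_def by blast
qed

lemma subspace_clspan: "subspace (clspan S)"
  by (intro closure_subspace subspace_span)

lemma clspan_base: "x \<in> S \<Longrightarrow> x \<in> clspan S"
  using closure_subset span_base by blast

lemma clspan_minimal: "S \<subseteq> P \<Longrightarrow> subspace P \<Longrightarrow> closed P \<Longrightarrow> clspan S \<subseteq> P"
  by (intro closure_minimal span_minimal)

lemma subspace_linear_vimage: "bounded_linear f \<Longrightarrow> subspace P \<Longrightarrow> subspace {x. f x \<in> P}"
  by (auto simp: subspace_def dest: bounded_linear.linear simp: linear_0 linear_add linear_scale)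

lemma closed_linear_vimage: "bounded_linear f \<Longrightarrow> closed P \<Longrightarrow> closed {x. f x \<in> P}"
  using continuous_closed_vimage[of P f] linear_continuous_at[of f] by (simp add: vimage_def)

lemma clspan_subset_vimage:
  assumes "bounded_linear f" "\<And>x. x \<in> S \<Longrightarrow> f x \<in> P" "subspace P" "closed P" "x \<in> clspan S"
  shows "f x \<in> P"
  using clspan_minimal[OF _ subspace_linear_vimage[OF assms(1,3)] closed_linear_vimage[OF assms(1,4)], of S]
    assms(2,5) by blast

text \<open>Morphisms, \<open>amp C \<phi>\<close> and
  \<open>\<lambda>b. a \<otimes>\<^sub>o b\<close> are total functions whose linearity is known only
  on a subspace, so they are not \<open>bounded_linear\<close>; this supplies the continuity that
  stands in for it.\<close>

lemma partial_linear_continuous_on: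
  fixes f :: "'a::real_normed_vector \<Rightarrow> 'b::real_normed_vector"
  assumes Q: "subspace Q" and add: "\<And>x y. x \<in> Q \<Longrightarrow> y \<in> Q \<Longrightarrow> f (x + y) = f x + f y"
    and scale: "\<And>r x. x \<in> Q \<Longrightarrow> f (r *\<^sub>R x) = r *\<^sub>R f x"
    and bd: "\<And>x. x \<in> Q \<Longrightarrow> norm (f x) \<le> K * norm x"
  shows "continuous_on Q f"
proof (rule continuous_on_sequentiallyI)
  fix X l assume X: "\<forall>n. X n \<in> Q" "l \<in> Q" "X \<longlonglongrightarrow> l"
  have d: "f (X n) - f l = f (X n - l)" "X n - l \<in> Q" for n
    using add[of "X n" "(-1) *\<^sub>R l"] scale[OF X(2), of "-1"] subspace_scale[OF Q X(2), of "-1"] X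
      subspace_diff[OF Q] by auto
  have "(\<lambda>n. norm (f (X n) - f l)) \<longlonglongrightarrow> 0"
  proof (rule tendsto_sandwich[OF _ _ tendsto_const])
    have "(\<lambda>n. norm (X n - l)) \<longlonglongrightarrow> 0" using X(3) LIM_zero tendsto_norm_zero by blast
    then show "(\<lambda>n. K * norm (X n - l)) \<longlonglongrightarrow> 0" by (rule tendsto_mult_right_zero)
    show "\<forall>\<^sub>F n in sequentially. norm (f (X n) - f l) \<le> K * norm (X n - l)"
      unfolding d(1) by (intro always_eventually allI bd d(2))
  qed simp
  then show "(\<lambda>n. f (X n)) \<longlonglongrightarrow> f l" by (rule LIM_zero_cancel[OF tendsto_norm_zero_cancel])
qed

text \<open>The induction rule for such maps: the part of \<open>Q\<close> that \<open>f\<close>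
  sends into \<open>P\<close> is a closed subspace, so generators suffice. With
  \<open>P = {0}\<close> and a difference for \<open>f\<close> it proves equations.\<close>

lemma clspan_partial_linear:
  fixes f :: "'a::real_normed_vector \<Rightarrow> 'b::real_normed_vector"
  assumes Q: "subspace Q" "closed Q" and S: "S \<subseteq> Q"
    and add: "\<And>x y. x \<in> Q \<Longrightarrow> y \<in> Q \<Longrightarrow> f (x + y) = f x + f y"
    and scale: "\<And>r x. x \<in> Q \<Longrightarrow> f (r *\<^sub>R x) = r *\<^sub>R f x"
    and cont: "continuous_on Q f"
    and gen: "\<And>x. x \<in> S \<Longrightarrow> f x \<in> P" and P: "subspace P" "closed P"
    and x: "x \<in> clspan S"
  shows "f x \<in> P"
proof -
  have "f 0 = 0" using scale[OF subspace_0[OF Q(1)], of 0] by simp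
  then have "subspace (Q \<inter> f -` P)" using Q(1) P(1) by (auto simp: subspace_def add scale)
  moreover have "closed (Q \<inter> f -` P)" by (rule continuous_closed_preimage[OF cont Q(2) P(2)])
  ultimately have "clspan S \<subseteq> Q \<inter> f -` P" using S gen by (intro clspan_minimal) auto
  with x show ?thesis by blast
qed

lemma clspan_image:
  assumes "bounded_linear f" "\<And>x. x \<in> S \<Longrightarrow> f x \<in> clspan S'" "x \<in> clspan S"
  shows "f x \<in> clspan S'"
  using clspan_subset_vimage[OF assms(1,2) subspace_clspan closed_closure assms(3)] by blast

lemma clspan_mono: "S \<subseteq> clspan S' \<Longrightarrow> clspan S \<subseteq> clspan S'"
  by (intro clspan_minimal subspace_clspan closed_closure)

lemma bounded_linear_eq_on_clspan:
  fixes f g :: "'a::real_normed_vector \<Rightarrow> 'b::real_normed_vector"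
  assumes "bounded_linear f" "bounded_linear g" "\<And>x. x \<in> S \<Longrightarrow> f x = g x" "x \<in> clspan S"
  shows "f x = g x"
  using clspan_subset_vimage[of "\<lambda>x. f x - g x" S "{0}" x] assms
  by (auto intro: bounded_linear_sub)

lemma blinfun_eqI_total:
  assumes "clspan S = UNIV" "\<And>x. x \<in> S \<Longrightarrow> blinfun_apply T x = blinfun_apply T' x"
  shows "T = T'"
  by (rule blinfun_eqI, rule bounded_linear_eq_on_clspan[OF _ _ assms(2)])
    (auto simp: assms(1) blinfun.bounded_linear_right)

section \<open>Riesz representation and adjoints\<close>

lemma cinner_eqI: "(\<And>y. cinner y a = cinner y b) \<Longrightarrow> a = b"
  by (metis Re_cinner inner_eq_zero_iff inner_diff_right right_minus_eq)

lemma blinfun_eqI_cinner: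
  "(\<And>x y. cinner y (blinfun_apply S x) = cinner y (blinfun_apply T x)) \<Longrightarrow> S = T"
  by (intro blinfun_eqI cinner_eqI)

text \<open>The representing vector is the minimiser of \<open>g x = inner x x / 2 - f x\<close>,
  which is \<open>(norm (x - y))\<^sup>2 / 2\<close> up to a constant if \<open>f = inner y\<close>.
  Completeness gives the minimiser, and the variation of \<open>g\<close> at it gives the
  formula.\<close>

lemma riesz_real:
  fixes f :: "'a::{real_inner,complete_space} \<Rightarrow> real"
  assumes f: "bounded_linear f"
  shows "\<exists>y. \<forall>x. f x = inner y x"
proof -
  interpret f: bounded_linear f by fact
  obtain K where K: "\<And>x. norm (f x) \<le> norm x * K" using f.bounded by blast
  define g where "g x = inner x x / 2 - f x" for x
  have lower: "- (K\<^sup>2/2) \<le> g x" for x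
  proof -
    have "0 \<le> (norm x - K)\<^sup>2" by simp
    then have "norm x * K \<le> inner x x / 2 + K\<^sup>2/2"
      by (simp add: power2_diff power2_norm_eq_inner[symmetric] field_simps)
    then show ?thesis using K[of x] by (simp add: g_def abs_le_iff)
  qed
  define m where "m = Inf (range g)"
  have bdd: "bdd_below (range g)" using lower by (intro bdd_belowI2) auto
  have m: "m \<le> g x" for x unfolding m_def using bdd by (intro cInf_lower) auto
  have "\<exists>x. g x < m + 1 / Suc n" for n
  proof -
    have "Inf (range g) < m + 1 / Suc n" by (simp add: m_def)
    then show ?thesis by (subst (asm) cInf_less_iff) (use bdd in auto)
  qed
  then obtain X where X: "\<And>n. g (X n) < m + 1 / Suc n" by metis
  \<comment> \<open>The parallelogram law: the contributions of the linear \<open>f\<close> cancel,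
    so points where \<open>g\<close> is nearly minimal are close to each other.\<close>
  have par: "(norm (x - y))\<^sup>2 / 4 = g x + g y - 2 * g ((1/2) *\<^sub>R (x + y))" for x y
    by (simp add: g_def power2_norm_eq_inner inner_diff inner_add inner_commute[of y x] f.add f.scaleR
        field_simps)
  have "Cauchy X"
  proof (rule metric_CauchyI)
    fix e :: real assume "e > 0"
    then have "e\<^sup>2 / 8 > 0" by simp
    then obtain N where N: "1 / Suc N < e\<^sup>2 / 8" using nat_approx_posE by blast
    have "dist (X i) (X j) < e" if "i \<ge> N" "j \<ge> N" for i j
    proof -
      have "1 / Suc i \<le> 1 / Suc N" "1 / Suc j \<le> 1 / Suc N"
        using that by (simp_all add: field_simps)
      then have "(norm (X i - X j))\<^sup>2 / 4 < e\<^sup>2 / 4"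
        using par[of "X i" "X j"] X[of i] X[of j] m[of "(1/2) *\<^sub>R (X i + X j)"] N by linarith
      then have "(norm (X i - X j))\<^sup>2 < e\<^sup>2" by simp
      then show ?thesis
        using \<open>e > 0\<close> by (simp add: dist_norm power2_less_imp_less)
    qed
    then show "\<exists>M. \<forall>i\<ge>M. \<forall>j\<ge>M. dist (X i) (X j) < e" by blast
  qed
  then obtain y where y: "X \<longlonglongrightarrow> y" using Cauchy_convergent convergent_def by blast
  have "(\<lambda>n. g (X n)) \<longlonglongrightarrow> g y" unfolding g_def by (intro tendsto_intros y f.tendsto) simp
  moreover have "(\<lambda>n. m + 1 / Suc n) \<longlonglongrightarrow> m + 0" by (intro tendsto_intros LIMSEQ_Suc lim_1_over_n)
  ultimately have "g y \<le> m + 0"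
    using X by (intro LIMSEQ_le[where X = "\<lambda>n. g (X n)"]) (auto intro: less_imp_le)
  then have ymin: "g y \<le> g x" for x using m[of x] by simp
  have "f x = inner y x" for x
  proof (rule ccontr)
    assume "f x \<noteq> inner y x"
    define d where "d = f x - inner y x"
    \<comment> \<open>The optimal step would be \<open>d / inner x x\<close>; the summand
      \<open>1\<close> avoids division by zero and still makes \<open>g\<close> drop
      strictly.\<close>
    define t where "t = d / (1 + inner x x)"
    have q: "1 + inner x x > 0" by (simp add: add_pos_nonneg)
    have "g (y + t *\<^sub>R x) = g y - t * d + t\<^sup>2 * inner x x / 2"
      by (simp add: g_def d_def f.add f.scaleR inner_add inner_commute[of x y] power2_eq_square field_simps)
    moreover have "t * d = t\<^sup>2 * (1 + inner x x)"
      using q by (simp add: t_def power2_eq_square)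
    ultimately have "g (y + t *\<^sub>R x) = g y - t\<^sup>2 * (1 + inner x x / 2)"
      by (simp add: algebra_simps)
    moreover have "t\<^sup>2 * (1 + inner x x / 2) > 0"
    proof (rule mult_pos_pos)
      show "t\<^sup>2 > 0" using q \<open>f x \<noteq> inner y x\<close> by (simp add: t_def d_def)
      show "1 + inner x x / 2 > 0" by (simp add: add_pos_nonneg)
    qed
    ultimately show False using ymin[of "y + t *\<^sub>R x"] by simp
  qed
  then show ?thesis by blast
qed

lemma Im_cinner: "Im (cinner x y) = inner x ((- \<i>) *\<^sub>C y)"
  by (simp add: Re_cinner[symmetric] cinner_scaleC_right)

lemma cinner_eq_if_inner:
  assumes "\<And>y. inner a y = inner b y" shows "a = b"
  using assms by (metis inner_diff_left inner_eq_zero_iff right_minus_eq)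

text \<open>Riesz is applied to the real inner product. The imaginary part of
  \<open>cinner x y\<close> is a real inner product with \<open>(- \<i>) *\<^sub>C y\<close>, so
  complex linearity of \<open>T\<close> upgrades the real adjoint identity to the complex
  one.\<close>

lemma adjoint_exists:
  assumes "clinear (T :: 'a::chilbert_space \<Rightarrow>\<^sub>L 'b::chilbert_space)"
  shows "\<exists>S. \<forall>x y. cinner (blinfun_apply S x) y = cinner x (blinfun_apply T y)"
proof -
  have "\<exists>s. \<forall>y. inner x (blinfun_apply T y) = inner s y" for x
    by (rule riesz_real) (intro bounded_linear_intros)
  then obtain s where s: "\<And>x y. inner x (blinfun_apply T y) = inner (s x) y" by metis
  have sC: "cinner (s x) y = cinner x (blinfun_apply T y)" for x y
    using assms by (simp add: complex_eq_iff Re_cinner Im_cinner s[symmetric] clinear_def)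
  have "bounded_linear s"
  proof (rule bounded_linear_intro[where K = "norm T"])
    show "s (x + y) = s x + s y" for x y
      by (rule cinner_eq_if_inner) (simp add: s[symmetric] inner_add_left)
    show "s (r *\<^sub>R x) = r *\<^sub>R s x" for r x
      by (rule cinner_eq_if_inner) (simp add: s[symmetric])
    show "norm (s x) \<le> norm x * norm T" for x
    proof (cases "s x = 0")
      case False
      have "norm (s x) * norm (s x) = inner x (blinfun_apply T (s x))"
        by (simp add: s power2_norm_eq_inner[symmetric] power2_eq_square[symmetric])
      also have "\<dots> \<le> norm x * (norm T * norm (s x))"
        by (intro order_trans[OF norm_cauchy_schwarz] mult_left_mono norm_blinfun) simp
      finally show ?thesis using False by (simp add: mult.assoc[symmetric])
    qed simp
  qed
  then show ?thesis using sC by (intro exI[of _ "Blinfun s"]) (simp add: bounded_linear_Blinfun_apply)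
qed

lemma adj_eqI:
  assumes "\<And>x y. cinner (blinfun_apply S x) y = cinner x (blinfun_apply T y)"
  shows "adj T = S"
  unfolding adj_def
proof (rule the_equality)
  show "\<forall>x y. cinner (blinfun_apply S x) y = cinner x (blinfun_apply T y)" using assms by simp
  show "S' = S" if "\<forall>x y. cinner (blinfun_apply S' x) y = cinner x (blinfun_apply T y)" for S'
    by (rule blinfun_eqI_cinner) (metis assms that cinner_commute)
qed

lemma cinner_adj_left:
  assumes "clinear T" shows "cinner (blinfun_apply (adj T) x) y = cinner x (blinfun_apply T y)"
  using adjoint_exists[OF assms] adj_eqI by metis

lemma cinner_adj_right:
  assumes "clinear T" shows "cinner x (blinfun_apply (adj T) y) = cinner (blinfun_apply T x) y"
  using cinner_adj_left[OF assms] by (metis cinner_commute)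

lemma clinearD: "clinear T \<Longrightarrow> blinfun_apply T (c *\<^sub>C x) = c *\<^sub>C blinfun_apply T x"
  by (simp add: clinear_def)

lemma clinear_adj [simp]: "clinear T \<Longrightarrow> clinear (adj T)"
  unfolding clinear_def[of "adj T"]
  by (intro allI cinner_eqI) (simp add: cinner_adj_right cinner_scaleC_right)

lemma adj_adj [simp]: "clinear T \<Longrightarrow> adj (adj T) = T"
  by (rule adj_eqI) (simp add: cinner_adj_right)

lemma clinear_compose [simp]: "clinear S \<Longrightarrow> clinear T \<Longrightarrow> clinear (S o\<^sub>L T)"
  by (simp add: clinear_def)

lemma clinear_id [simp]: "clinear id_blinfun"
  by (simp add: clinear_def)

lemma clinear_zero [simp]: "clinear 0"
  by (simp add: clinear_def)

lemma clinear_add [simp]: "clinear S \<Longrightarrow> clinear T \<Longrightarrow> clinear (S + T)"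
  by (simp add: clinear_def blinfun.add_left scaleC_add_right)

lemma scaleR_scaleC: "r *\<^sub>R x = complex_of_real r *\<^sub>C x"
  by (simp add: scaleC_of_real)

lemma clinear_scaleR [simp]: "clinear T \<Longrightarrow> clinear (r *\<^sub>R T)"
  by (simp add: clinear_def blinfun.scaleR_left scaleR_scaleC scaleC_scaleC mult.commute)

lemma clinear_diff [simp]: "clinear S \<Longrightarrow> clinear T \<Longrightarrow> clinear (S - T)"
  using clinear_add[of S "(-1) *\<^sub>R T"] clinear_scaleR[of T "-1"] by simp

lemma subspace_clinear: "subspace {T. clinear T}"
  by (auto simp: subspace_def)

lemma closed_clinear: "closed {T :: 'a::chilbert_space \<Rightarrow>\<^sub>L 'b::chilbert_space. clinear T}"
proof -
  have "closed {T. blinfun_apply T (c *\<^sub>C x) = c *\<^sub>C blinfun_apply T x}" for c :: complex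
    and x :: "'a"
    by (intro closed_Collect_eq linear_continuous_on blinfun.bounded_linear_left
        bounded_linear_compose[OF bounded_linear_scaleC blinfun.bounded_linear_left])
  then show ?thesis unfolding clinear_def by (intro closed_Collect_all)
qed

lemma cscale_apply: "blinfun_apply (cscale c T) x = c *\<^sub>C blinfun_apply T x"
  unfolding cscale_def
  by (subst bounded_linear_Blinfun_apply)
    (auto intro: bounded_linear_compose[OF bounded_linear_scaleC] blinfun.bounded_linear_right)

lemma clinear_cscale [simp]: "clinear T \<Longrightarrow> clinear (cscale c T)"
  by (simp add: clinear_def cscale_apply scaleC_scaleC mult.commute)

lemma adj_compose: "clinear S \<Longrightarrow> clinear T \<Longrightarrow> adj (S o\<^sub>L T) = adj T o\<^sub>L adj S"
  by (rule adj_eqI) (simp add: cinner_adj_left)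

lemma adj_id [simp]: "adj id_blinfun = id_blinfun"
  by (rule adj_eqI) simp

lemma adj_zero [simp]: "adj 0 = 0"
  by (rule adj_eqI) simp

lemma adj_add: "clinear S \<Longrightarrow> clinear T \<Longrightarrow> adj (S + T) = adj S + adj T"
  by (rule adj_eqI) (simp add: blinfun.add_left cinner_adj_left cinner_add_left cinner_add_right)

lemma adj_scaleR: "clinear T \<Longrightarrow> adj (r *\<^sub>R T) = r *\<^sub>R adj T"
  by (rule adj_eqI) (simp add: blinfun.scaleR_left cinner_adj_left cinner_scaleR_left cinner_scaleR_right)

lemma adj_diff: "clinear S \<Longrightarrow> clinear T \<Longrightarrow> adj (S - T) = adj S - adj T"
  by (rule adj_eqI) (simp add: blinfun.diff_left cinner_adj_left cinner_diff_left cinner_diff_right)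

lemma norm_adj_le: assumes "clinear T" shows "norm (adj T) \<le> norm T"
proof (rule norm_blinfun_bound)
  fix x
  show "norm (blinfun_apply (adj T) x) \<le> norm T * norm x"
  proof (cases "blinfun_apply (adj T) x = 0")
    case False
    have "(norm (blinfun_apply (adj T) x))\<^sup>2 = cmod (cinner x (blinfun_apply T (blinfun_apply (adj T) x)))"
      by (metis cinner_adj_left[OF assms] cinner_self_norm norm_of_real abs_power2)
    also have "\<dots> \<le> norm x * (norm T * norm (blinfun_apply (adj T) x))"
      by (intro order_trans[OF norm_cinner_le] mult_left_mono norm_blinfun) simp
    finally show ?thesis using False by (simp add: power2_eq_square mult_ac)
  qed simp
qed simp

lemma norm_adj: "clinear T \<Longrightarrow> norm (adj T) = norm T"
  by (metis norm_adj_le adj_adj clinear_adj order_antisym)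

lemma tendsto_adj:
  assumes "\<And>n. clinear (T n)" "T \<longlonglongrightarrow> L" shows "(\<lambda>n. adj (T n)) \<longlonglongrightarrow> adj L"
proof -
  have L: "clinear L" using closed_sequentially[OF closed_clinear] assms by auto
  have "(\<lambda>n. norm (T n - L)) \<longlonglongrightarrow> 0" using assms(2) LIM_zero tendsto_norm_zero by blast
  then have "(\<lambda>n. norm (adj (T n) - adj L)) \<longlonglongrightarrow> 0"
    by (simp only: adj_diff[OF assms(1) L, symmetric] norm_adj[OF clinear_diff[OF assms(1) L]])
  then show ?thesis by (rule LIM_zero_cancel[OF tendsto_norm_zero_cancel])
qed

text \<open>\<open>adj\<close> is under control on complex-linear operators only, so complex
  linearity and the membership of the adjoint are carried through the closure together.\<close>

lemma clspan_adj:
  assumes "X \<in> clspan S" "\<And>T. T \<in> S \<Longrightarrow> clinear T" "\<And>T. T \<in> S \<Longrightarrow> adj T \<in> P" "subspace P" "closed P"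
  shows "clinear X" "adj X \<in> P"
proof -
  have "S \<subseteq> {T. clinear T \<and> adj T \<in> P}" using assms(2,3) by auto
  moreover have "subspace {T. clinear T \<and> adj T \<in> P}"
    using assms(4) by (auto simp: subspace_def adj_add adj_scaleR)
  moreover have "closed {T. clinear T \<and> adj T \<in> P}"
    unfolding closed_sequential_limits
  proof (intro allI impI, elim conjE)
    fix T L assume T: "\<forall>n. T n \<in> {T. clinear T \<and> adj T \<in> P}" "T \<longlonglongrightarrow> L"
    then have "clinear L" using closed_sequentially[OF closed_clinear, of T L] by auto
    moreover have "adj L \<in> P"
      using closed_sequentially[OF assms(5) _ tendsto_adj[OF _ T(2)]] T(1) by auto
    ultimately show "L \<in> {T. clinear T \<and> adj T \<in> P}" by simp
  qed
  ultimately have "clspan S \<subseteq> {T. clinear T \<and> adj T \<in> P}" by (rule clspan_minimal)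
  with assms(1) show "clinear X" "adj X \<in> P" by auto
qed

section \<open>Operators obtained from their graphs\<close>

lemma graph_closure_bound:
  fixes G :: "('a::real_normed_vector \<times> 'b::real_normed_vector) set"
  assumes "\<And>x y. (x, y) \<in> G \<Longrightarrow> norm y \<le> M * norm x" "(x, y) \<in> closure G"
  shows "norm y \<le> M * norm x"
proof -
  have "closed {p :: 'a \<times> 'b. norm (snd p) \<le> M * norm (fst p)}"
    by (intro closed_Collect_le continuous_intros)
  then have "closure G \<subseteq> {p. norm (snd p) \<le> M * norm (fst p)}"
    using assms(1) by (intro closure_minimal) auto
  then show ?thesis using assms(2) by auto
qed

text \<open>The bound, applied to differences, turns a convergent sequence in the domain into a
  Cauchy sequence of images. Density is not part of the statement, because the domain may be a
  proper closed subspace such as \<open>hmod C\<close>.\<close>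

lemma graph_closure_exists:
  fixes G :: "('a::real_normed_vector \<times> 'b::banach) set"
  assumes sub: "subspace G" and bd: "\<And>x y. (x, y) \<in> G \<Longrightarrow> norm y \<le> M * norm x"
    and M: "M \<ge> 0" and x: "x \<in> closure (fst ` G)"
  shows "\<exists>y. (x, y) \<in> closure G"
proof -
  obtain X where X: "\<And>n. X n \<in> fst ` G" "X \<longlonglongrightarrow> x" using x unfolding closure_sequential by blast
  then have "\<forall>n. \<exists>y. (X n, y) \<in> G" by force
  then obtain Y where Y: "\<And>n. (X n, Y n) \<in> G" by metis
  have diff: "norm (Y m - Y n) \<le> M * norm (X m - X n)" for m n
    using bd[of "X m - X n" "Y m - Y n"] subspace_diff[OF sub Y[of m] Y[of n]] by simp
  have "Cauchy Y"
  proof (rule metric_CauchyI)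
    fix e :: real assume "e > 0"
    then have "e / (M + 1) > 0" using M by simp
    then obtain N where N: "\<forall>m\<ge>N. \<forall>n\<ge>N. dist (X m) (X n) < e / (M + 1)"
      using metric_CauchyD[OF LIMSEQ_imp_Cauchy[OF X(2)]] by blast
    have "dist (Y m) (Y n) < e" if "m \<ge> N" "n \<ge> N" for m n
    proof -
      have "norm (X m - X n) < e / (M + 1)" using N that by (simp add: dist_norm)
      then have "(M + 1) * norm (X m - X n) < e" using M by (simp add: field_simps)
      then have "M * norm (X m - X n) < e"
        using norm_ge_zero[of "X m - X n"] unfolding distrib_right by linarith
      then show ?thesis using diff[of m n] by (simp add: dist_norm)
    qed
    then show "\<exists>N. \<forall>m\<ge>N. \<forall>n\<ge>N. dist (Y m) (Y n) < e" by blast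
  qed
  then obtain y where "Y \<longlonglongrightarrow> y" using Cauchy_convergent convergent_def by blast
  then have "(\<lambda>n. (X n, Y n)) \<longlonglongrightarrow> (x, y)" by (intro tendsto_Pair X)
  then show ?thesis unfolding closure_sequential using Y by (intro exI[of _ y] exI[of _ "\<lambda>n. (X n, Y n)"]) simp
qed

text \<open>The bound survives in the closure of \<open>G\<close> and, applied to differences, makes
  the closure single-valued; density makes its domain everything.\<close>

lemma graph_extension:
  fixes G :: "('a::real_normed_vector \<times> 'b::banach) set"
  assumes sub: "subspace G" and bd: "\<And>x y. (x, y) \<in> G \<Longrightarrow> norm y \<le> M * norm x"
    and dense: "closure (fst ` G) = UNIV" and M: "M \<ge> 0"
  shows "\<exists>S. norm S \<le> M \<and> (\<forall>(x, y)\<in>G. blinfun_apply S x = y)"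
proof -
  have subc: "subspace (closure G)" using sub by (rule closure_subspace)
  have bdc: "norm y \<le> M * norm x" if "(x, y) \<in> closure G" for x y
    using graph_closure_bound[OF bd that] .
  have uniq: "y = y'" if "(x, y) \<in> closure G" "(x, y') \<in> closure G" for x y y'
    using bdc[of "x - x" "y - y'"] subspace_diff[OF subc that] by simp
  have "\<exists>y. (x, y) \<in> closure G" for x by (rule graph_closure_exists[OF sub bd M]) (simp_all add: dense)
  then obtain s where s: "\<And>x. (x, s x) \<in> closure G" by metis
  have bl: "bounded_linear s"
  proof (rule bounded_linear_intro[where K = M])
    show "s (x + y) = s x + s y" for x y
      using uniq[OF s] subspace_add[OF subc s[of x] s[of y]] by simp
    show "s (r *\<^sub>R x) = r *\<^sub>R s x" for r x
      using uniq[OF s] subspace_scale[OF subc s[of x], of r] by simp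
    show "norm (s x) \<le> norm x * M" for x using bdc[OF s[of x]] by (simp add: mult.commute)
  qed
  have "norm (Blinfun s) \<le> M"
    using bdc[OF s] M by (intro norm_blinfun_bound) (simp_all add: bounded_linear_Blinfun_apply bl)
  moreover have "blinfun_apply (Blinfun s) x = y" if "(x, y) \<in> G" for x y
    using uniq[OF s] that closure_subset by (auto simp: bounded_linear_Blinfun_apply bl)
  ultimately show ?thesis by blast
qed

text \<open>The bound on finite combinations includes well-definedness: a linear relation among the
  \<open>f i\<close> must hold among the \<open>g i\<close>. Real coefficients suffice, since a
  \<open>blinfun\<close> is real-linear; complex linearity is proved separately where it is
  wanted.\<close>

lemma blinfun_extension:
  fixes f :: "'i \<Rightarrow> 'a::real_normed_vector" and g :: "'i \<Rightarrow> 'b::banach"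
  assumes dense: "clspan (range f) = UNIV" and M: "M \<ge> 0"
    and bd: "\<And>F r. finite F \<Longrightarrow> norm (\<Sum>i\<in>F. r i *\<^sub>R g i) \<le> M * norm (\<Sum>i\<in>F. r i *\<^sub>R f i)"
  shows "\<exists>S. norm S \<le> M \<and> (\<forall>i. blinfun_apply S (f i) = g i)"
proof -
  let ?p = "\<lambda>i. (f i, g i)"
  have comb: "\<exists>F r. finite F \<and> p = (\<Sum>i\<in>F. r i *\<^sub>R ?p i)" if p: "p \<in> span (range ?p)" for p
  proof -
    from p obtain T c where T: "finite T" "T \<subseteq> range ?p" "p = (\<Sum>a\<in>T. c a *\<^sub>R a)"
      unfolding span_explicit by blast
    \<comment> \<open>Members of the span are sums over sets of pairs; indices on which the pairs
      are distinct convert them to sums over indices.\<close>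
    then obtain F where F: "inj_on ?p F" "T = ?p ` F" "finite F"
      unfolding subset_image_inj using finite_image_iff by blast
    have "p = (\<Sum>i\<in>F. c (?p i) *\<^sub>R ?p i)" unfolding T(3) F(2) by (rule sum.reindex_cong[OF F(1)]) auto
    then show ?thesis using F(3) by (intro exI[of _ F] exI[of _ "\<lambda>i. c (?p i)"]) simp
  qed
  have "\<exists>S. norm S \<le> M \<and> (\<forall>(x, y)\<in>span (range ?p). blinfun_apply S x = y)"
  proof (rule graph_extension)
    show "norm y \<le> M * norm x" if "(x, y) \<in> span (range ?p)" for x y
    proof -
      obtain F r where "finite F" and e: "(x, y) = (\<Sum>i\<in>F. r i *\<^sub>R ?p i)" using comb[OF \<open>(x, y) \<in> _\<close>] by blast
      have "x = (\<Sum>i\<in>F. r i *\<^sub>R f i)" "y = (\<Sum>i\<in>F. r i *\<^sub>R g i)"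
        using arg_cong[OF e, of fst] arg_cong[OF e, of snd] by (simp_all add: fst_sum snd_sum)
      then show ?thesis using bd[OF \<open>finite F\<close>] by simp
    qed
    have "fst ` span (range ?p) = span (range f)"
      by (subst linear_span_image[symmetric]) (auto simp: image_image linear_fst)
    then show "closure (fst ` span (range ?p)) = UNIV" using dense by simp
  qed (use M in simp_all)
  then obtain S where S: "norm S \<le> M" "\<forall>p\<in>span (range ?p). blinfun_apply S (fst p) = snd p"
    by (auto simp: case_prod_unfold)
  have "blinfun_apply S (f i) = g i" for i
    using bspec[OF S(2) span_base[OF rangeI[of ?p i]]] by simp
  with S(1) show ?thesis by blast
qed

section \<open>Amplification of star-algebras of operators\<close>

lemma cinner_sum_scaleR:
  "cinner (\<Sum>i\<in>F. r i *\<^sub>R f i) (\<Sum>j\<in>G. s j *\<^sub>R g j)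
    = (\<Sum>i\<in>F. \<Sum>j\<in>G. complex_of_real (r i * s j) * cinner (f i) (g j))"
proof -
  have "cinner x (\<Sum>j\<in>G. s j *\<^sub>R g j) = (\<Sum>j\<in>G. complex_of_real (s j) * cinner x (g j))" for x
    using linear_sum[OF bounded_linear.linear[OF bounded_linear_cinner_right[of x]], of "\<lambda>j. s j *\<^sub>R g j" G]
    by (simp add: cinner_scaleR_right)
  note right = this
  have left: "cinner (\<Sum>i\<in>F. r i *\<^sub>R f i) y = (\<Sum>i\<in>F. complex_of_real (r i) * cinner (f i) y)" for y
  proof -
    have "cinner y (\<Sum>i\<in>F. r i *\<^sub>R f i) = (\<Sum>i\<in>F. complex_of_real (r i) * cinner y (f i))"
      using linear_sum[OF bounded_linear.linear[OF bounded_linear_cinner_right[of y]], of "\<lambda>j. r j *\<^sub>R f j" F]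
      by (simp add: cinner_scaleR_right)
    then show ?thesis
      by (subst cinner_commute) (simp add: cinner_commute[of y])
  qed
  show ?thesis by (subst left, subst right) (simp add: sum_distrib_left mult.assoc)
qed

text \<open>Writing \<open>\<eta> T\<close> for a finite combination of the vectors \<open>v T i\<close>, one has
  \<open>(norm (\<eta> T))\<^sup>2 \<le> norm (\<eta> 1) * norm (\<eta> (adj T o T))\<close>.  Hence the supremum \<open>s\<close> of \<open>norm (\<eta> T) / norm T\<close>,
  which is finite, satisfies \<open>s\<^sup>2 \<le> norm (\<eta> 1) * s\<close>.\<close>

lemma star_amplification_bound:
  fixes TT :: "'l::chilbert_space op set" and v :: "'l op \<Rightarrow> 'i \<Rightarrow> 'm::chilbert_space"
  assumes clin: "\<And>T. T \<in> TT \<Longrightarrow> clinear T" and one: "id_blinfun \<in> TT"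
    and mult: "\<And>S T. S \<in> TT \<Longrightarrow> T \<in> TT \<Longrightarrow> S o\<^sub>L T \<in> TT"
    and star: "\<And>T. T \<in> TT \<Longrightarrow> adj T \<in> TT"
    and bd: "\<And>T i. T \<in> TT \<Longrightarrow> norm (v T i) \<le> K i * norm T"
    and cin: "\<And>S T i j. S \<in> TT \<Longrightarrow> T \<in> TT \<Longrightarrow>
      cinner (v S i) (v T j) = cinner (v id_blinfun i) (v (adj S o\<^sub>L T) j)"
    and T: "T \<in> TT" and F: "finite F"
  shows "norm (\<Sum>i\<in>F. r i *\<^sub>R v T i) \<le> norm T * norm (\<Sum>i\<in>F. r i *\<^sub>R v id_blinfun i)"
proof -
  define eta where "eta T = (\<Sum>i\<in>F. r i *\<^sub>R v T i)" for T
  define C where "C = (\<Sum>i\<in>F. \<bar>r i\<bar> * \<bar>K i\<bar>)"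
  have C0: "C \<ge> 0" unfolding C_def by (intro sum_nonneg) simp
  have etaC: "norm (eta T) \<le> C * norm T" if "T \<in> TT" for T
  proof -
    have "norm (eta T) \<le> (\<Sum>i\<in>F. norm (r i *\<^sub>R v T i))" unfolding eta_def by (rule norm_sum)
    also have "\<dots> \<le> (\<Sum>i\<in>F. \<bar>r i\<bar> * (\<bar>K i\<bar> * norm T))"
    proof (rule sum_mono)
      fix i
      have "norm (v T i) \<le> \<bar>K i\<bar> * norm T"
        using bd[OF that, of i] mult_right_mono[OF abs_ge_self[of "K i"] norm_ge_zero[of T]] by linarith
      then show "norm (r i *\<^sub>R v T i) \<le> \<bar>r i\<bar> * (\<bar>K i\<bar> * norm T)" by (simp add: mult_left_mono)
    qed
    finally show ?thesis by (simp add: C_def sum_distrib_right mult.assoc)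
  qed
  have sq: "(norm (eta T))\<^sup>2 \<le> norm (eta id_blinfun) * norm (eta (adj T o\<^sub>L T))" if "T \<in> TT" for T
  proof -
    have "cinner (eta T) (eta T) = cinner (eta id_blinfun) (eta (adj T o\<^sub>L T))"
      unfolding eta_def cinner_sum_scaleR by (simp add: cin[OF that that])
    then have "(norm (eta T))\<^sup>2 = cmod (cinner (eta id_blinfun) (eta (adj T o\<^sub>L T)))"
      by (metis cinner_self_norm norm_of_real abs_power2)
    then show ?thesis using norm_cinner_le by simp
  qed
  \<comment> \<open>For \<open>T = 0\<close> the quotient is \<open>0\<close> by convention; this
    loses nothing, because \<open>etaC\<close> forces \<open>eta 0 = 0\<close> if \<open>0\<close>
    is in \<open>TT\<close>.\<close>
  define s where "s = Sup ((\<lambda>T. norm (eta T) / norm T) ` TT)"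
  have bdd: "bdd_above ((\<lambda>T. norm (eta T) / norm T) ` TT)"
    using etaC C0 by (intro bdd_aboveI2[where M = C]) (simp add: divide_le_eq mult.commute)
  have upper: "norm (eta T) / norm T \<le> s" if "T \<in> TT" for T
    unfolding s_def using that by (intro cSup_upper bdd) simp
  have s0: "s \<ge> 0" using upper[OF one] by (meson divide_nonneg_nonneg norm_ge_zero order_trans)
  have etas: "norm (eta T) \<le> s * norm T" if "T \<in> TT" for T
    using upper[OF that] etaC[OF that] by (cases "T = 0") (simp_all add: divide_le_eq)
  have step: "norm (eta T) / norm T \<le> sqrt (norm (eta id_blinfun) * s)" if "T \<in> TT" for T
  proof -
    have "norm (adj T o\<^sub>L T) \<le> norm T * norm T"
      using norm_blinfun_compose[of "adj T" T] norm_adj_le[OF clin[OF that]]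
      by (meson mult_right_mono norm_ge_zero order_trans)
    then have "norm (eta (adj T o\<^sub>L T)) \<le> s * (norm T * norm T)"
      using etas[OF mult[OF star[OF that] that]] s0 by (meson mult_left_mono order_trans)
    then have "(norm (eta T))\<^sup>2 \<le> norm (eta id_blinfun) * (s * (norm T * norm T))"
      using sq[OF that] by (meson mult_left_mono norm_ge_zero order_trans)
    then have "(norm (eta T) / norm T)\<^sup>2 \<le> norm (eta id_blinfun) * s"
      using s0 by (cases "T = 0") (simp_all add: power_divide divide_le_eq power2_eq_square mult_ac)
    then show ?thesis by (rule real_le_rsqrt)
  qed
  have "s \<le> sqrt (norm (eta id_blinfun) * s)"
    unfolding s_def by (rule cSup_least) (use step one in \<open>auto simp: s_def\<close>)
  then have "s\<^sup>2 \<le> norm (eta id_blinfun) * s"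
    using s0 by (simp add: real_le_rsqrt sqrt_ge_absD)
  then have "s \<le> norm (eta id_blinfun)"
    using s0 by (cases "s = 0") (simp_all add: power2_eq_square)
  then have "norm (eta T) \<le> norm (eta id_blinfun) * norm T"
    using etas[OF T] by (meson mult_right_mono norm_ge_zero order_trans)
  then show ?thesis by (simp add: eta_def mult.commute)
qed

lemma power2_norm_eq_cinner: "(norm x)\<^sup>2 = cmod (cinner x x)"
  unfolding cinner_self_norm norm_of_real by simp

text \<open>Equal inner products give equal norms of corresponding finite combinations. The flip and
  the associator arise in this way.\<close>

lemma isometry_extension:
  fixes f :: "'i \<Rightarrow> 'a::chilbert_space" and g :: "'i \<Rightarrow> 'b::chilbert_space"
  assumes "clspan (range f) = UNIV" "\<And>i j. cinner (g i) (g j) = cinner (f i) (f j)"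
  shows "\<exists>S. \<forall>i. blinfun_apply S (f i) = g i"
proof -
  have "norm (\<Sum>i\<in>F. r i *\<^sub>R g i) \<le> 1 * norm (\<Sum>i\<in>F. r i *\<^sub>R f i)" for F r
  proof -
    have "cinner (\<Sum>i\<in>F. r i *\<^sub>R g i) (\<Sum>i\<in>F. r i *\<^sub>R g i) = cinner (\<Sum>i\<in>F. r i *\<^sub>R f i) (\<Sum>i\<in>F. r i *\<^sub>R f i)"
      unfolding cinner_sum_scaleR by (simp add: assms(2))
    then show ?thesis by (simp add: cinner_self norm_eq_sqrt_inner)
  qed
  then show ?thesis using blinfun_extension[OF assms(1), of 1 g] by auto
qed

section \<open>Tensor products of operators\<close>

lemma norm_tensor: "norm (x \<otimes>\<^sub>h y) = norm x * norm y"
proof -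
  have "complex_of_real ((norm (x \<otimes>\<^sub>h y))\<^sup>2) = complex_of_real ((norm x * norm y)\<^sup>2)"
    by (simp only: cinner_self_norm[symmetric] cinner_tensor power_mult_distrib of_real_mult)
  then show ?thesis by (simp only: of_real_eq_iff) (simp add: power2_eq_iff_nonneg)
qed

lemma bounded_bilinear_tensor: "bounded_bilinear (\<otimes>\<^sub>h)"
  by (standard; (simp add: tensor_linear scaleR_scaleC)?)
    (auto simp: norm_tensor intro!: exI[of _ 1])

text \<open>\<open>ket\<close> and \<open>rket\<close> are creation operators, and their adjoints
  contract a leg with a vector; slices and legs are computed with them.\<close>

definition ket :: "'a::chilbert_space \<Rightarrow> 'b::chilbert_space \<Rightarrow>\<^sub>L ('a, 'b) htensor"
  where "ket x = Blinfun (\<lambda>y. x \<otimes>\<^sub>h y)"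

definition rket :: "'b::chilbert_space \<Rightarrow> 'a::chilbert_space \<Rightarrow>\<^sub>L ('a, 'b) htensor"
  where "rket y = Blinfun (\<lambda>x. x \<otimes>\<^sub>h y)"

lemma ket_apply [simp]: "blinfun_apply (ket x) y = x \<otimes>\<^sub>h y"
  unfolding ket_def
  by (rule bounded_linear_Blinfun_apply[THEN fun_cong])
    (rule bounded_bilinear.bounded_linear_right[OF bounded_bilinear_tensor])

lemma rket_apply [simp]: "blinfun_apply (rket y) x = x \<otimes>\<^sub>h y"
  unfolding rket_def
  by (rule bounded_linear_Blinfun_apply[THEN fun_cong])
    (rule bounded_bilinear.bounded_linear_left[OF bounded_bilinear_tensor])

lemma clinear_ket [simp]: "clinear (ket x)" and clinear_rket [simp]: "clinear (rket y)"
  by (simp_all add: clinear_def tensor_linear)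

lemma norm_ket_le: "norm (ket x) \<le> norm x"
  by (rule norm_blinfun_bound) (simp_all add: norm_tensor)

lemma norm_rket_le: "norm (rket y) \<le> norm y"
  by (rule norm_blinfun_bound) (simp_all add: norm_tensor mult.commute)

lemma ket_add: "ket (x + y) = ket x + ket y"
  and ket_scaleR: "ket (r *\<^sub>R x) = r *\<^sub>R ket x"
  by (auto intro!: blinfun_eqI simp: blinfun.add_left blinfun.scaleR_left tensor_linear scaleR_scaleC)

lemma bounded_linear_ket: "bounded_linear ket"
  by (rule bounded_linear_intro[where K = 1]) (simp_all add: ket_add ket_scaleR norm_ket_le)

lemma adj_ket_tensor [simp]: "blinfun_apply (adj (ket x)) (y \<otimes>\<^sub>h z) = cinner x y *\<^sub>C z"
  by (rule cinner_eqI) (simp add: cinner_adj_right cinner_tensor cinner_scaleC_right)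

lemma adj_rket_tensor [simp]: "blinfun_apply (adj (rket x)) (y \<otimes>\<^sub>h z) = cinner x z *\<^sub>C y"
  by (rule cinner_eqI) (simp add: cinner_adj_right cinner_tensor cinner_scaleC_right mult.commute)

lemma clspan_tensors:
  "clspan (range (\<lambda>(x :: 'a::chilbert_space, y :: 'b::chilbert_space). x \<otimes>\<^sub>h y)) = UNIV"
proof -
  have "range (\<lambda>(x :: 'a, y :: 'b). x \<otimes>\<^sub>h y) = {x \<otimes>\<^sub>h y |x y. True}" by auto
  then show ?thesis using tensor_dense by (simp only:)
qed

lemma clspan_tensors_total:
  assumes S: "clspan S = UNIV" and S': "clspan S' = UNIV"
  shows "clspan {x \<otimes>\<^sub>h y |x y. x \<in> S \<and> y \<in> S'} = UNIV"
proof -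
  let ?P = "clspan {x \<otimes>\<^sub>h y |x y. x \<in> S \<and> y \<in> S'}"
  have "x \<otimes>\<^sub>h y \<in> ?P" if "x \<in> S" for x y
    by (rule clspan_image[OF bounded_bilinear.bounded_linear_right[OF bounded_bilinear_tensor], of S'])
      (use that in \<open>auto simp: S' intro!: clspan_base\<close>)
  then have "x \<otimes>\<^sub>h y \<in> ?P" for x y
    by (rule clspan_image[OF bounded_bilinear.bounded_linear_left[OF bounded_bilinear_tensor], of S])
      (use S in auto)
  then have "clspan (range (\<lambda>(x, y). x \<otimes>\<^sub>h y)) \<subseteq> ?P" by (intro clspan_mono) auto
  then show ?thesis unfolding clspan_tensors by blast
qed

lemma blinfun_eqI_tensor:
  assumes "\<And>x y. blinfun_apply S (x \<otimes>\<^sub>h y) = blinfun_apply T (x \<otimes>\<^sub>h y)" shows "S = T"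
  by (rule blinfun_eqI_total[OF clspan_tensors]) (use assms in auto)

lemma blinfun_eqI_tensor3:
  assumes "\<And>x y z. blinfun_apply S ((x \<otimes>\<^sub>h y) \<otimes>\<^sub>h z) = blinfun_apply T ((x \<otimes>\<^sub>h y) \<otimes>\<^sub>h z)" shows "S = T"
  by (rule blinfun_eqI_total[OF clspan_tensors_total[OF clspan_tensors, of UNIV]]) (use assms in auto)

lemma blinfun_eqI_tensor3':
  assumes "\<And>x y z. blinfun_apply S (x \<otimes>\<^sub>h (y \<otimes>\<^sub>h z)) = blinfun_apply T (x \<otimes>\<^sub>h (y \<otimes>\<^sub>h z))" shows "S = T"
  by (rule blinfun_eqI_total[OF clspan_tensors_total[OF _ clspan_tensors, of UNIV]]) (use assms in auto)

lemma clinear_if_total: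
  assumes "clspan S = UNIV" "\<And>c x. x \<in> S \<Longrightarrow> blinfun_apply T (c *\<^sub>C x) = c *\<^sub>C blinfun_apply T x"
  shows "clinear T"
  unfolding clinear_def
proof (intro allI)
  fix c x
  show "blinfun_apply T (c *\<^sub>C x) = c *\<^sub>C blinfun_apply T x"
    by (rule bounded_linear_eq_on_clspan[OF _ _ assms(2)])
      (auto simp: assms(1) intro!: bounded_linear_compose[OF bounded_linear_scaleC]
        bounded_linear_compose[OF _ bounded_linear_scaleC] blinfun.bounded_linear_right)
qed

lemma adj_eqI_total:
  assumes S: "clspan S = UNIV" and S': "clspan S' = UNIV"
    and eq: "\<And>x y. x \<in> S \<Longrightarrow> y \<in> S' \<Longrightarrow> cinner (blinfun_apply R x) y = cinner x (blinfun_apply T y)"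
  shows "adj T = R"
proof (rule adj_eqI)
  have 1: "cinner (blinfun_apply R x) y = cinner x (blinfun_apply T y)" if "x \<in> S" for x y
    by (rule bounded_linear_eq_on_clspan[of _ _ S'])
      (use that eq in \<open>auto simp: S' intro!: bounded_linear_cinner_right
        bounded_linear_compose[OF bounded_linear_cinner_right] blinfun.bounded_linear_right\<close>)
  have 2: "cinner y (blinfun_apply R x) = cinner (blinfun_apply T y) x" if "x \<in> S" for x y
    using 1[OF that] by (metis cinner_commute)
  have "cinner y (blinfun_apply R x) = cinner (blinfun_apply T y) x" for x y
    by (rule bounded_linear_eq_on_clspan[of _ _ S])
      (use 2 in \<open>auto simp: S intro!: bounded_linear_cinner_right
        bounded_linear_compose[OF bounded_linear_cinner_right] blinfun.bounded_linear_right\<close>)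
  then show "cinner (blinfun_apply R x) y = cinner x (blinfun_apply T y)" for x y
    by (metis cinner_commute)
qed

section \<open>The flip and tensor products of two operators\<close>

lemma flip_exists: "\<exists>R. \<forall>x y. blinfun_apply R (x \<otimes>\<^sub>h y) = y \<otimes>\<^sub>h x"
proof -
  have "\<exists>R. \<forall>i. blinfun_apply R (case i of (x, y) \<Rightarrow> x \<otimes>\<^sub>h y) = (case i of (x, y) \<Rightarrow> y \<otimes>\<^sub>h x)"
    by (rule isometry_extension[OF clspan_tensors]) (auto simp: cinner_tensor mult.commute)
  then show ?thesis by auto
qed

lemma flip_tensor [simp]:
  fixes x :: "'a::chilbert_space" and y :: "'b::chilbert_space"
  shows "blinfun_apply flip (x \<otimes>\<^sub>h y) = y \<otimes>\<^sub>h x"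
proof -
  obtain R :: "('a, 'b) htensor \<Rightarrow>\<^sub>L ('b, 'a) htensor"
    where R: "\<forall>x y. blinfun_apply R (x \<otimes>\<^sub>h y) = y \<otimes>\<^sub>h x" using flip_exists by blast
  have "flip = R"
    unfolding flip_def by (rule the_equality) (use R in \<open>auto intro: blinfun_eqI_tensor\<close>)
  then show ?thesis using R by simp
qed

lemma flip_flip [simp]: "flip o\<^sub>L flip = id_blinfun"
  by (rule blinfun_eqI_tensor) simp

lemma clinear_flip [simp]: "clinear flip"
  by (rule clinear_if_total[OF clspan_tensors]) (auto simp: tensor_linear(3)[symmetric], simp add: tensor_linear)

lemma adj_flip [simp]: "adj flip = flip"
  by (rule adj_eqI_total[OF clspan_tensors clspan_tensors]) (auto simp: cinner_tensor mult.commute)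

lemma norm_isometry_le: assumes "clinear S" "adj S o\<^sub>L S = id_blinfun" shows "norm S \<le> 1"
proof (rule norm_blinfun_bound)
  fix x
  have "cinner (blinfun_apply S x) (blinfun_apply S x) = cinner x (blinfun_apply (adj S o\<^sub>L S) x)"
    by (simp add: cinner_adj_right assms(1))
  then show "norm (blinfun_apply S x) \<le> 1 * norm x"
    unfolding assms(2) by (simp add: cinner_self norm_eq_sqrt_inner)
qed simp

lemma norm_conj_le: assumes "norm S \<le> 1" "norm T \<le> 1" shows "norm (S o\<^sub>L R o\<^sub>L T) \<le> norm R"
proof -
  have "norm (S o\<^sub>L R) \<le> 1 * norm R"
    by (rule order_trans[OF norm_blinfun_compose mult_right_mono[OF assms(1)]]) simp
  from mult_mono[OF this assms(2)] norm_blinfun_compose[of "S o\<^sub>L R" T] show ?thesis by simp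
qed

lemma norm_flip_le: "norm flip \<le> 1"
  by (rule norm_isometry_le) simp_all

text \<open>It is enough to bound \<open>S\<close> tensored with the identity, since the other
  factor follows by conjugation with the flip. As \<open>S\<close> acts between different spaces,
  the amplification bound is applied to \<open>adj S o\<^sub>L S\<close> in the star-algebra of all
  complex-linear operators: with \<open>?b\<close> the image of \<open>?a\<close>,
  \<open>(norm ?b)\<^sup>2 = cmod (cinner ?a ?c)\<close> is at most
  \<open>(norm S * norm ?a)\<^sup>2\<close>.\<close>

lemma op_tensor_exists:
  assumes S: "clinear (S :: 'a::chilbert_space \<Rightarrow>\<^sub>L 'c::chilbert_space)"
    and T: "clinear (T :: 'b::chilbert_space \<Rightarrow>\<^sub>L 'd::chilbert_space)"
  shows "\<exists>R. norm R \<le> norm S * norm T \<and> (\<forall>x y. blinfun_apply R (x \<otimes>\<^sub>h y) = blinfun_apply S x \<otimes>\<^sub>h blinfun_apply T y)"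
proof -
  have left: "\<exists>R. norm R \<le> norm S \<and> (\<forall>x. \<forall>y :: 'm::chilbert_space. blinfun_apply R (x \<otimes>\<^sub>h y) = blinfun_apply S x \<otimes>\<^sub>h y)"
    if S: "clinear S" for S :: "'k::chilbert_space \<Rightarrow>\<^sub>L 'l::chilbert_space"
  proof -
    have bd: "norm (blinfun_apply T x) * norm y \<le> norm x * (norm y * norm T)" for T :: "'k op" and x and y :: 'm
      using mult_right_mono[OF norm_blinfun[of T x] norm_ge_zero[of y]] by (simp add: mult_ac)
    let ?v = "\<lambda>T :: 'k op. \<lambda>(x, y :: 'm). blinfun_apply T x \<otimes>\<^sub>h y"
    have "\<exists>R. norm R \<le> norm S \<and> (\<forall>i. blinfun_apply R (case i of (x, y :: 'm) \<Rightarrow> x \<otimes>\<^sub>h y)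
        = (case i of (x, y) \<Rightarrow> blinfun_apply S x \<otimes>\<^sub>h y))"
    proof (rule blinfun_extension[OF clspan_tensors norm_ge_zero])
      fix F :: "('k \<times> 'm) set" and r :: "'k \<times> 'm \<Rightarrow> real" assume "finite F"
      let ?a = "\<Sum>i\<in>F. r i *\<^sub>R (case i of (x, y) \<Rightarrow> x \<otimes>\<^sub>h y)"
      let ?b = "\<Sum>i\<in>F. r i *\<^sub>R (case i of (x, y) \<Rightarrow> blinfun_apply S x \<otimes>\<^sub>h y)"
      let ?c = "\<Sum>i\<in>F. r i *\<^sub>R ?v (adj S o\<^sub>L S) i"
      have "norm ?c \<le> norm (adj S o\<^sub>L S) * norm (\<Sum>i\<in>F. r i *\<^sub>R ?v id_blinfun i)"
        by (rule star_amplification_bound[where TT = "{T. clinear T}" and K = "\<lambda>(x, y). norm x * norm y"])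
          (auto simp: S \<open>finite F\<close> norm_tensor cinner_tensor cinner_adj_right mult.assoc
            intro!: bd)
      moreover have "norm (adj S o\<^sub>L S) \<le> norm S * norm S"
        using norm_blinfun_compose[of "adj S" S] by (simp add: norm_adj S)
      ultimately have c: "norm ?c \<le> norm S * norm S * norm ?a"
        by (simp add: case_prod_unfold) (meson mult_right_mono norm_ge_zero order_trans)
      have "cinner ?b ?b = cinner ?a ?c"
        unfolding cinner_sum_scaleR
        by (intro sum.cong refl) (auto simp: cinner_tensor cinner_adj_right S)
      then have "(norm ?b)\<^sup>2 = cmod (cinner ?a ?c)" by (simp only: power2_norm_eq_cinner)
      also have "\<dots> \<le> norm ?a * (norm S * norm S * norm ?a)"
        by (rule order_trans[OF norm_cinner_le mult_left_mono[OF c norm_ge_zero]])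
      also have "\<dots> = (norm S * norm ?a)\<^sup>2" by (simp add: power2_eq_square mult_ac)
      finally show "norm ?b \<le> norm S * norm ?a" by (rule power2_le_imp_le) simp
    qed
    then show ?thesis by auto
  qed
  obtain R1 where R1: "norm R1 \<le> norm S" "\<And>x y. blinfun_apply R1 (x \<otimes>\<^sub>h (y :: 'd)) = blinfun_apply S x \<otimes>\<^sub>h y"
    using left[OF S] by blast
  obtain R2 where R2: "norm R2 \<le> norm T" "\<And>x y. blinfun_apply R2 (x \<otimes>\<^sub>h (y :: 'a)) = blinfun_apply T x \<otimes>\<^sub>h y"
    using left[OF T] by blast
  let ?R = "R1 o\<^sub>L (flip o\<^sub>L R2 o\<^sub>L flip)"
  have "norm ?R \<le> norm R1 * norm (flip o\<^sub>L R2 o\<^sub>L flip)" by (rule norm_blinfun_compose)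
  also have "\<dots> \<le> norm S * norm T"
    by (intro mult_mono R1(1) order_trans[OF norm_conj_le[OF norm_flip_le norm_flip_le] R2(1)]) simp_all
  finally have "norm ?R \<le> norm S * norm T" .
  then show ?thesis by (intro exI[of _ ?R]) (simp add: R1 R2)
qed

lemma op_tensor_props:
  assumes "clinear S" "clinear T"
  shows "norm (S \<otimes>\<^sub>o T) \<le> norm S * norm T"
    "\<forall>x y. blinfun_apply (S \<otimes>\<^sub>o T) (x \<otimes>\<^sub>h y) = blinfun_apply S x \<otimes>\<^sub>h blinfun_apply T y"
proof -
  obtain R where R: "norm R \<le> norm S * norm T"
    "\<forall>x y. blinfun_apply R (x \<otimes>\<^sub>h y) = blinfun_apply S x \<otimes>\<^sub>h blinfun_apply T y"
    using op_tensor_exists[OF assms] by blast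
  have "S \<otimes>\<^sub>o T = R"
    unfolding op_tensor_def by (rule the_equality) (use R in \<open>auto intro: blinfun_eqI_tensor\<close>)
  then show "norm (S \<otimes>\<^sub>o T) \<le> norm S * norm T"
    "\<forall>x y. blinfun_apply (S \<otimes>\<^sub>o T) (x \<otimes>\<^sub>h y) = blinfun_apply S x \<otimes>\<^sub>h blinfun_apply T y"
    using R by simp_all
qed

lemmas norm_op_tensor_le = op_tensor_props(1)

lemma op_tensor_apply [simp]:
  "clinear S \<Longrightarrow> clinear T \<Longrightarrow> blinfun_apply (S \<otimes>\<^sub>o T) (x \<otimes>\<^sub>h y) = blinfun_apply S x \<otimes>\<^sub>h blinfun_apply T y"
  using op_tensor_props(2) by blast

lemma clinear_op_tensor [simp]: "clinear S \<Longrightarrow> clinear T \<Longrightarrow> clinear (S \<otimes>\<^sub>o T)"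
  by (rule clinear_if_total[OF clspan_tensors])
    (auto simp: tensor_linear(3)[symmetric] clinearD)

lemma adj_op_tensor: "clinear S \<Longrightarrow> clinear T \<Longrightarrow> adj (S \<otimes>\<^sub>o T) = adj S \<otimes>\<^sub>o adj T"
  by (rule adj_eqI_total[OF clspan_tensors clspan_tensors]) (auto simp: cinner_tensor cinner_adj_left)

lemma op_tensor_compose:
  "clinear S \<Longrightarrow> clinear T \<Longrightarrow> clinear S' \<Longrightarrow> clinear T' \<Longrightarrow>
    (S \<otimes>\<^sub>o T) o\<^sub>L (S' \<otimes>\<^sub>o T') = (S o\<^sub>L S') \<otimes>\<^sub>o (T o\<^sub>L T')"
  by (rule blinfun_eqI_tensor) simp

lemma op_tensor_id [simp]: "id_blinfun \<otimes>\<^sub>o id_blinfun = id_blinfun"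
  by (rule blinfun_eqI_tensor) simp

lemma op_tensor_add_left:
  "clinear S \<Longrightarrow> clinear S' \<Longrightarrow> clinear T \<Longrightarrow> (S + S') \<otimes>\<^sub>o T = S \<otimes>\<^sub>o T + S' \<otimes>\<^sub>o T"
  by (rule blinfun_eqI_tensor) (simp add: blinfun.add_left tensor_linear)

lemma op_tensor_add_right:
  "clinear S \<Longrightarrow> clinear T \<Longrightarrow> clinear T' \<Longrightarrow> S \<otimes>\<^sub>o (T + T') = S \<otimes>\<^sub>o T + S \<otimes>\<^sub>o T'"
  by (rule blinfun_eqI_tensor) (simp add: blinfun.add_left tensor_linear)

lemma op_tensor_scaleR_left: "clinear S \<Longrightarrow> clinear T \<Longrightarrow> (r *\<^sub>R S) \<otimes>\<^sub>o T = r *\<^sub>R (S \<otimes>\<^sub>o T)"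
  and op_tensor_scaleR_right: "clinear S \<Longrightarrow> clinear T \<Longrightarrow> S \<otimes>\<^sub>o (r *\<^sub>R T) = r *\<^sub>R (S \<otimes>\<^sub>o T)"
  by (rule blinfun_eqI_tensor; simp add: blinfun.scaleR_left scaleR_scaleC tensor_linear)+

lemma op_tensor_cscale_right: "clinear S \<Longrightarrow> clinear T \<Longrightarrow> S \<otimes>\<^sub>o cscale c T = cscale c (S \<otimes>\<^sub>o T)"
  by (rule blinfun_eqI_tensor) (simp add: cscale_apply tensor_linear)

section \<open>Rebracketing of threefold tensor products\<close>

lemma assoc_tensor [simp]:
  fixes x :: "'a::chilbert_space" and y :: "'b::chilbert_space" and z :: "'c::chilbert_space"
  shows "blinfun_apply assoc ((x \<otimes>\<^sub>h y) \<otimes>\<^sub>h z) = x \<otimes>\<^sub>h (y \<otimes>\<^sub>h z)"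
proof -
  let ?f = "\<lambda>(x :: 'a, y :: 'b, z :: 'c). (x \<otimes>\<^sub>h y) \<otimes>\<^sub>h z"
    and ?g = "\<lambda>(x :: 'a, y :: 'b, z :: 'c). x \<otimes>\<^sub>h (y \<otimes>\<^sub>h z)"
  have r: "range ?f = {u \<otimes>\<^sub>h z |u z. u \<in> range (\<lambda>(x, y). x \<otimes>\<^sub>h y) \<and> z \<in> UNIV}" by (auto simp: image_iff) blast
  have "\<exists>R. \<forall>i. blinfun_apply R (?f i) = ?g i"
  proof (rule isometry_extension)
    show "clspan (range ?f) = UNIV" unfolding r by (rule clspan_tensors_total[OF clspan_tensors]) simp
  qed (auto simp: cinner_tensor)
  then obtain R where R: "\<And>(x :: 'a) (y :: 'b) (z :: 'c). blinfun_apply R ((x \<otimes>\<^sub>h y) \<otimes>\<^sub>h z) = x \<otimes>\<^sub>h (y \<otimes>\<^sub>h z)"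
    by auto
  have assoc: "assoc = R"
    unfolding assoc_def by (rule the_equality) (use R in \<open>auto intro!: blinfun_eqI_tensor3\<close>)
  show ?thesis unfolding assoc by (rule R)
qed

lemma clinear_assoc [simp]: "clinear assoc"
  by (rule clinear_if_total[OF clspan_tensors_total[OF clspan_tensors, of UNIV]])
    (auto simp: tensor_linear(3)[symmetric])

lemma adj_assoc_tensor [simp]:
  fixes x :: "'a::chilbert_space" and y :: "'b::chilbert_space" and z :: "'c::chilbert_space"
  shows "blinfun_apply (adj assoc) (x \<otimes>\<^sub>h (y \<otimes>\<^sub>h z)) = (x \<otimes>\<^sub>h y) \<otimes>\<^sub>h z"
proof -
  let ?f = "\<lambda>(x :: 'a, y :: 'b, z :: 'c). (x \<otimes>\<^sub>h y) \<otimes>\<^sub>h z"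
    and ?g = "\<lambda>(x :: 'a, y :: 'b, z :: 'c). x \<otimes>\<^sub>h (y \<otimes>\<^sub>h z)"
  have r: "range ?g = {u \<otimes>\<^sub>h z |u z. u \<in> UNIV \<and> z \<in> range (\<lambda>(x, y). x \<otimes>\<^sub>h y)}" by (auto simp: image_iff) blast
  have "\<exists>R. \<forall>i. blinfun_apply R (?g i) = ?f i"
  proof (rule isometry_extension)
    show "clspan (range ?g) = UNIV" unfolding r by (rule clspan_tensors_total[OF _ clspan_tensors]) simp
  qed (auto simp: cinner_tensor)
  then obtain R where R: "\<And>(x :: 'a) (y :: 'b) (z :: 'c). blinfun_apply R (x \<otimes>\<^sub>h (y \<otimes>\<^sub>h z)) = (x \<otimes>\<^sub>h y) \<otimes>\<^sub>h z"
    by auto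
  have "adj assoc = R"
    by (rule adj_eqI_total[OF clspan_tensors_total[OF _ clspan_tensors, of UNIV]
          clspan_tensors_total[OF clspan_tensors, of UNIV]])
      (auto simp: R cinner_tensor)
  then show ?thesis by (simp add: R)
qed

lemma adj_assoc_assoc [simp]: "adj assoc o\<^sub>L assoc = id_blinfun"
  by (rule blinfun_eqI_tensor3) simp

lemma assoc_adj_assoc [simp]: "assoc o\<^sub>L adj assoc = id_blinfun"
  by (rule blinfun_eqI_tensor3') simp

section \<open>Star-homomorphisms and multipliers\<close>

lemmas comp_add_left = bounded_bilinear.add_left[OF bounded_bilinear_blinfun_compose]
  and comp_add_right = bounded_bilinear.add_right[OF bounded_bilinear_blinfun_compose]
  and comp_diff_left = bounded_bilinear.diff_left[OF bounded_bilinear_blinfun_compose]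
  and comp_diff_right = bounded_bilinear.diff_right[OF bounded_bilinear_blinfun_compose]
  and comp_scaleR_left = bounded_bilinear.scaleR_left[OF bounded_bilinear_blinfun_compose]
  and comp_scaleR_right = bounded_bilinear.scaleR_right[OF bounded_bilinear_blinfun_compose]
  and bounded_linear_comp_left = bounded_bilinear.bounded_linear_left[OF bounded_bilinear_blinfun_compose]
  and bounded_linear_comp_right = bounded_bilinear.bounded_linear_right[OF bounded_bilinear_blinfun_compose]

lemma comp_assoc: "(S o\<^sub>L T) o\<^sub>L R = S o\<^sub>L (T o\<^sub>L R)"
  by (rule blinfun_eqI) simp

lemma comp_id [simp]: "id_blinfun o\<^sub>L T = T" "T o\<^sub>L id_blinfun = T"
  by (rule blinfun_eqI; simp)+

lemma cscale_comp_left: "cscale c S o\<^sub>L T = cscale c (S o\<^sub>L T)"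
  by (rule blinfun_eqI) (simp add: cscale_apply)

lemma cscale_comp_right: "clinear S \<Longrightarrow> S o\<^sub>L cscale c T = cscale c (S o\<^sub>L T)"
  by (rule blinfun_eqI) (simp add: cscale_apply clinearD)

lemma cscale_of_real: "cscale (complex_of_real r) T = r *\<^sub>R T"
  by (rule blinfun_eqI) (simp add: cscale_apply scaleC_of_real blinfun.scaleR_left)

lemma cscale_add: "cscale c (S + T) = cscale c S + cscale c T"
  by (rule blinfun_eqI) (simp add: cscale_apply blinfun.add_left scaleC_add_right)

lemma norm_cscale: "norm (cscale c T) \<le> cmod c * norm T"
  by (rule norm_blinfun_bound)
    (auto simp: cscale_apply norm_scaleC mult.assoc intro!: mult_left_mono norm_blinfun)

lemma bounded_linear_cscale:
  "bounded_linear (cscale c :: ('a::chilbert_space \<Rightarrow>\<^sub>L 'b::chilbert_space) \<Rightarrow> _)"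
proof (rule bounded_linear_intro[where K = "cmod c"])
  show "cscale c (r *\<^sub>R T) = r *\<^sub>R cscale c T" for r and T :: "'a \<Rightarrow>\<^sub>L 'b"
    by (rule blinfun_eqI) (simp add: cscale_apply blinfun.scaleR_left scaleR_scaleC scaleC_scaleC mult.commute)
  show "norm (cscale c T) \<le> norm T * cmod c" for T :: "'a \<Rightarrow>\<^sub>L 'b"
    using norm_cscale[of c T] by (simp add: mult.commute)
qed (rule cscale_add)

lemma
  assumes "cstar_alg A"
  shows cstar_clinear: "a \<in> A \<Longrightarrow> clinear a"
    and cstar_zero: "0 \<in> A"
    and cstar_add: "a \<in> A \<Longrightarrow> b \<in> A \<Longrightarrow> a + b \<in> A"
    and cstar_comp: "a \<in> A \<Longrightarrow> b \<in> A \<Longrightarrow> a o\<^sub>L b \<in> A"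
    and cstar_cscale: "a \<in> A \<Longrightarrow> cscale c a \<in> A"
    and cstar_adj: "a \<in> A \<Longrightarrow> adj a \<in> A"
    and cstar_closed: "closed A"
    and cstar_total: "clspan {blinfun_apply a x |a x. a \<in> A} = UNIV"
  using assms unfolding cstar_alg_def by auto

lemma cstar_scaleR: "cstar_alg A \<Longrightarrow> a \<in> A \<Longrightarrow> r *\<^sub>R a \<in> A"
  using cstar_cscale[of A a "complex_of_real r"] by (simp add: cscale_of_real)

lemma cstar_diff: "cstar_alg A \<Longrightarrow> a \<in> A \<Longrightarrow> b \<in> A \<Longrightarrow> a - b \<in> A"
  using cstar_add[of A a "(-1) *\<^sub>R b"] cstar_scaleR[of A b "-1"] by simp

lemma cstar_subspace: "cstar_alg A \<Longrightarrow> subspace A"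
  by (simp add: subspace_def cstar_zero cstar_add cstar_scaleR)

lemma cstar_clspan_subset: "cstar_alg A \<Longrightarrow> S \<subseteq> A \<Longrightarrow> clspan S \<subseteq> A"
  by (intro clspan_minimal cstar_subspace cstar_closed)

section \<open>Contractivity of star-homomorphisms\<close>

lemma norm_adj_comp_self: assumes "clinear a" shows "norm (adj a o\<^sub>L a) \<le> (norm a)\<^sup>2"
  using norm_blinfun_compose[of "adj a" a] by (simp add: norm_adj assms power2_eq_square)

text \<open>A solution of \<open>2 k - k\<^sup>2 = h\<close>, that is, \<open>(1 - k)\<^sup>2 = 1 - h\<close>, is a fixed point of the contraction
  \<open>k \<mapsto> (h + k\<^sup>2) / 2\<close>.\<close>

lemma cstar_half_root:
  assumes A: "cstar_alg A" and h: "h \<in> A" "adj h = h" "norm h < 1"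
  shows "\<exists>k\<in>A. adj k = k \<and> 2 *\<^sub>R k = h + (k o\<^sub>L k)"
proof -
  \<comment> \<open>The smaller root of \<open>\<rho> * \<rho> - 2 * \<rho> + norm h = 0\<close>:
    the ball of radius \<open>\<rho>\<close> is then mapped into itself, and
    \<open>\<rho> < 1\<close> is also the contraction constant.\<close>
  define \<rho> where "\<rho> = 1 - sqrt (1 - norm h)"
  have \<rho>: "0 \<le> \<rho>" "\<rho> < 1" "norm h + \<rho> * \<rho> = 2 * \<rho>"
    using h(3) by (auto simp: \<rho>_def algebra_simps)
  define s where "s = {k \<in> A. adj k = k \<and> norm k \<le> \<rho>}"
  define f where "f k = (1/2) *\<^sub>R (h + (k o\<^sub>L k))" for k
  have "closed s"
    unfolding closed_sequential_limits
  proof (intro allI impI, elim conjE)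
    fix K l assume K: "\<forall>n. K n \<in> s" "K \<longlonglongrightarrow> l"
    have "l \<in> A" using closed_sequentially[OF cstar_closed[OF A] _ K(2)] K(1) by (simp add: s_def)
    moreover have "(\<lambda>n. adj (K n)) \<longlonglongrightarrow> adj l"
      using K by (intro tendsto_adj) (auto simp: s_def intro: cstar_clinear[OF A])
    then have "adj l = l" using K by (auto simp: s_def intro: LIMSEQ_unique)
    moreover have "norm l \<le> \<rho>"
      using K(1) by (intro LIMSEQ_le_const2[OF tendsto_norm[OF K(2)]]) (auto simp: s_def)
    ultimately show "l \<in> s" by (simp add: s_def)
  qed
  then have "complete s" by (simp add: complete_eq_closed)
  moreover have "s \<noteq> {}" using \<rho>(1) cstar_zero[OF A] by (auto simp: s_def intro!: exI[of _ 0])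
  moreover have "f ` s \<subseteq> s"
  proof
    fix g assume "g \<in> f ` s"
    then obtain k where k: "k \<in> A" "adj k = k" "norm k \<le> \<rho>" and g: "g = f k" by (auto simp: s_def)
    have cl: "clinear k" "clinear h" using k h cstar_clinear[OF A] by auto
    have "norm (k o\<^sub>L k) \<le> \<rho> * \<rho>"
      using norm_blinfun_compose[of k k] mult_mono[OF k(3) k(3) \<rho>(1) norm_ge_zero] by linarith
    then have "norm (h + (k o\<^sub>L k)) \<le> 2 * \<rho>" using norm_triangle_ineq[of h "k o\<^sub>L k"] \<rho>(3) by linarith
    then show "g \<in> s"
      using A k h cl
      by (simp add: g s_def f_def cstar_scaleR cstar_add cstar_comp adj_scaleR adj_add adj_compose)
  qed
  moreover have "dist (f k) (f l) \<le> \<rho> * dist k l" if "k \<in> s" "l \<in> s" for k l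
  proof -
    \<comment> \<open>A noncommutative difference of squares; each of its two terms contributes
      \<open>\<rho> * norm (k - l)\<close>, and the factor one half averages them.\<close>
    have "f k - f l = (1/2) *\<^sub>R ((k o\<^sub>L (k - l)) + ((k - l) o\<^sub>L l))"
      by (simp add: f_def comp_diff_left comp_diff_right scaleR_diff_right scaleR_add_right)
    moreover have "norm (k o\<^sub>L (k - l)) \<le> \<rho> * norm (k - l)" "norm ((k - l) o\<^sub>L l) \<le> norm (k - l) * \<rho>"
      using that by (auto simp: s_def intro!: order_trans[OF norm_blinfun_compose] mult_mono \<rho>(1))
    ultimately show ?thesis
      using norm_triangle_ineq[of "k o\<^sub>L (k - l)" "(k - l) o\<^sub>L l"] by (simp add: dist_norm mult.commute)
  qed
  ultimately have "\<exists>!k. k \<in> s \<and> f k = k" by (intro Banach_fix[of s \<rho> f] \<rho>) auto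
  then obtain k where k: "k \<in> s" "f k = k" by blast
  have "2 *\<^sub>R k = 2 *\<^sub>R f k" by (simp only: k(2))
  then have "2 *\<^sub>R k = h + (k o\<^sub>L k)" by (simp add: f_def)
  then show ?thesis using k(1) by (auto simp: s_def)
qed

text \<open>With \<open>k\<close> as above for \<open>h = adj a o a\<close>:
  \<open>(norm (\<phi> a x))\<^sup>2 = 2 (x | \<phi> k x) - (norm (\<phi> k x))\<^sup>2 = (norm x)\<^sup>2 - (norm (x - \<phi> k x))\<^sup>2\<close>.\<close>

lemma star_hom_contractive:
  fixes \<phi> :: "'a::chilbert_space op \<Rightarrow> 'b::chilbert_space op"
  assumes A: "cstar_alg A"
    and clin: "\<And>a. a \<in> A \<Longrightarrow> clinear (\<phi> a)"
    and add: "\<And>a b. a \<in> A \<Longrightarrow> b \<in> A \<Longrightarrow> \<phi> (a + b) = \<phi> a + \<phi> b"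
    and comp: "\<And>a b. a \<in> A \<Longrightarrow> b \<in> A \<Longrightarrow> \<phi> (a o\<^sub>L b) = \<phi> a o\<^sub>L \<phi> b"
    and scale: "\<And>a r. a \<in> A \<Longrightarrow> \<phi> (r *\<^sub>R a) = r *\<^sub>R \<phi> a"
    and star: "\<And>a. a \<in> A \<Longrightarrow> \<phi> (adj a) = adj (\<phi> a)"
    and a: "a \<in> A"
  shows "norm (\<phi> a) \<le> norm a"
proof -
  have unit: "norm (\<phi> a) \<le> 1" if a: "a \<in> A" "norm a < 1" for a
  proof (rule norm_blinfun_bound)
    fix x
    have cl: "clinear a" by (rule cstar_clinear[OF A a(1)])
    have "(norm a)\<^sup>2 < 1" using a(2) by (simp add: abs_square_less_1)
    then have "norm (adj a o\<^sub>L a) < 1" using norm_adj_comp_self[OF cl] by linarith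
    moreover have "adj (adj a o\<^sub>L a) = adj a o\<^sub>L a" using cl by (simp add: adj_compose)
    ultimately obtain k where k: "k \<in> A" "adj k = k" "2 *\<^sub>R k = (adj a o\<^sub>L a) + (k o\<^sub>L k)"
      using cstar_half_root[OF A, of "adj a o\<^sub>L a"] cstar_comp[OF A] cstar_adj[OF A] a by blast
    have "2 *\<^sub>R \<phi> k = \<phi> ((adj a o\<^sub>L a) + (k o\<^sub>L k))" by (simp only: k(3)[symmetric] scale[OF k(1)])
    also have "\<dots> = (adj (\<phi> a) o\<^sub>L \<phi> a) + (\<phi> k o\<^sub>L \<phi> k)"
      using A a k(1) by (simp add: add comp star cstar_comp cstar_adj)
    finally have e: "2 *\<^sub>R blinfun_apply (\<phi> k) x
        = blinfun_apply (adj (\<phi> a)) (blinfun_apply (\<phi> a) x) + blinfun_apply (\<phi> k) (blinfun_apply (\<phi> k) x)"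
      by (metis blinfun.add_left blinfun.scaleR_left blinfun_apply_blinfun_compose)
    have sa: "inner x (blinfun_apply (\<phi> k) y) = inner (blinfun_apply (\<phi> k) x) y" for y
      by (metis Re_cinner cinner_adj_right clin k(1,2) star)
    have "inner x (blinfun_apply (adj (\<phi> a)) (blinfun_apply (\<phi> a) x)) = (norm (blinfun_apply (\<phi> a) x))\<^sup>2"
      by (metis Re_cinner cinner_adj_right clin a(1) power2_norm_eq_inner)
    then have "(norm (blinfun_apply (\<phi> a) x))\<^sup>2 = 2 * inner x (blinfun_apply (\<phi> k) x) - (norm (blinfun_apply (\<phi> k) x))\<^sup>2"
      using arg_cong[OF e, of "inner x"]
      by (simp add: inner_add_right sa power2_norm_eq_inner)
    also have "\<dots> = (norm x)\<^sup>2 - (norm (x - blinfun_apply (\<phi> k) x))\<^sup>2"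
      by (simp add: power2_norm_eq_inner inner_diff inner_commute)
    also have "\<dots> \<le> (norm x)\<^sup>2" by simp
    finally have "norm (blinfun_apply (\<phi> a) x) \<le> norm x" by (rule power2_le_imp_le) simp
    then show "norm (blinfun_apply (\<phi> a) x) \<le> 1 * norm x" by simp
  qed simp
  show ?thesis
  \<comment> \<open>Solving for \<open>k\<close> required \<open>norm a < 1\<close> strictly, so a
    general \<open>a\<close> is divided by an arbitrary \<open>r > norm a\<close>.\<close>
  proof (rule dense_ge)
    fix r assume r: "norm a < r"
    then have r0: "r > 0" by (meson norm_ge_zero le_less_trans)
    have "norm (\<phi> ((1/r) *\<^sub>R a)) \<le> 1"
      using r r0 a by (intro unit cstar_scaleR[OF A]) auto
    then show "norm (\<phi> a) \<le> r" using r0 by (simp add: scale[OF a] field_simps)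
  qed
qed

section \<open>Products are dense in a C*-algebra\<close>

text \<open>For a positive contraction \<open>R\<close> the sequence \<open>s n = (x | R\<^sup>n x)\<close> is nonnegative and convex.\<close>

lemma positive_power_estimate:
  fixes R :: "'a::chilbert_space op"
  assumes sa: "\<And>u v. inner (blinfun_apply R u) v = inner u (blinfun_apply R v)"
    and pos: "\<And>u. 0 \<le> inner u (blinfun_apply R u)"
    and y: "\<And>n. y (Suc n) = blinfun_apply R (y n)"
  shows "(2 * n + 1) * (inner (y n) (y n) - inner (y n) (y (Suc n))) \<le> inner (y 0) (y 0)"
proof -
  have shift: "inner (z i) (z j) = inner (z 0) (z (i + j))"
    if "\<And>n. z (Suc n) = blinfun_apply R (z n)" for z i j
  proof (induction i arbitrary: j)
    case (Suc i)
    then show ?case using Suc[of "Suc j"] by (simp add: that sa)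
  qed simp
  have nonneg: "0 \<le> inner (z 0) (z k)" if z: "\<And>n. z (Suc n) = blinfun_apply R (z n)" for z k
  proof (cases "even k")
    case True
    then obtain j where "k = j + j" by (metis evenE mult_2)
    then show ?thesis using shift[of z j j] z by (metis inner_ge_zero)
  next
    case False
    then obtain j where "k = j + Suc j" by (metis oddE mult_2 add_Suc_right add.commute plus_1_eq_Suc)
    then show ?thesis using shift[of z j "Suc j"] z pos[of "z j"] by metis
  qed
  define s where "s k = inner (y 0) (y k)" for k
  \<comment> \<open>\<open>nonneg\<close>, applied to the sequence of differences
    \<open>y n - y (Suc n)\<close>, says that the second differences of \<open>s\<close> are
    nonnegative.\<close>
  have step: "s (Suc k) - s (Suc (Suc k)) \<le> s k - s (Suc k)" for k
  proof -
    have "0 \<le> inner (y 0 - y (Suc 0)) (y k - y (Suc k))"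
      using nonneg[of "\<lambda>n. y n - y (Suc n)" k] by (simp add: y blinfun.diff_right)
    then show ?thesis
      using shift[of y "Suc 0" k] shift[of y "Suc 0" "Suc k"] y by (simp add: s_def inner_diff)
  qed
  have dec: "s n - s (Suc n) \<le> s m - s (Suc m)" if "m \<le> n" for m n
    by (rule lift_Suc_antimono_le[of "\<lambda>k. s k - s (Suc k)", OF _ that]) (rule step)
  \<comment> \<open>The differences \<open>s k - s (Suc k)\<close> decrease, so
    \<open>2 * n + 1\<close> copies of the last one are at most their telescoping sum.\<close>
  have "(2 * real n + 1) * (s (2 * n) - s (Suc (2 * n))) = (\<Sum>k<2 * n + 1. s (2 * n) - s (Suc (2 * n)))"
    by simp
  also have "\<dots> \<le> (\<Sum>k<2 * n + 1. s k - s (Suc k))"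
    by (intro sum_mono dec) auto
  also have "\<dots> = s 0 - s (2 * n + 1)" by (rule sum_lessThan_telescope')
  also have "\<dots> \<le> s 0" using nonneg[of y, OF y] by (simp add: s_def)
  finally have "(2 * real n + 1) * (s (2 * n) - s (Suc (2 * n))) \<le> s 0" .
  moreover have "s (2 * n) = inner (y n) (y n)" "s (Suc (2 * n)) = inner (y n) (y (Suc n))"
    unfolding s_def shift[of y n n, OF y] shift[of y n "Suc n", OF y] by (simp_all add: mult_2)
  ultimately show ?thesis by (simp add: s_def)
qed

text \<open>The elements \<open>u n = 1 - (1 - adj a o a)\<^sup>n\<close> form an approximate unit for \<open>a\<close>.\<close>

lemma cstar_square_dense:
  assumes A: "cstar_alg A" and a: "a \<in> A"
  shows "a \<in> clspan {b o\<^sub>L c |b c. b \<in> A \<and> c \<in> A}"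
proof -
  have unit: "a \<in> clspan {b o\<^sub>L c |b c. b \<in> A \<and> c \<in> A}" if a: "a \<in> A" "norm a \<le> 1" for a
  proof -
    have cl: "clinear a" by (rule cstar_clinear[OF A a(1)])
    define h where "h = adj a o\<^sub>L a"
    have hA: "h \<in> A" unfolding h_def using a by (intro cstar_comp[OF A] cstar_adj[OF A])
    have hin: "inner u (blinfun_apply h v) = inner (blinfun_apply a u) (blinfun_apply a v)" for u v
      unfolding h_def blinfun_apply_blinfun_compose Re_cinner[symmetric] cinner_adj_right[OF cl] ..
    \<comment> \<open>The recursion for \<open>1 - u (Suc n) = (1 - h) (1 - u n)\<close>, written
      without the identity so that every \<open>u n\<close> lies in \<open>A\<close>.\<close>
    define u where "u n = ((\<lambda>v. v + h - (h o\<^sub>L v)) ^^ n) 0" for n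
    have u: "u 0 = 0" "u (Suc n) = u n + h - (h o\<^sub>L u n)" for n by (simp_all add: u_def)
    have uA: "u n \<in> A" for n
      by (induction n) (auto simp: u intro!: cstar_zero[OF A] cstar_diff[OF A] cstar_add[OF A] cstar_comp[OF A] hA)
    have bound: "norm (a - (a o\<^sub>L u n)) \<le> 1 / sqrt (2 * real n + 1)" for n
    proof (rule norm_blinfun_bound)
      fix x
      \<comment> \<open>Here \<open>y n\<close> is \<open>(1 - h)\<close> applied \<open>n\<close>
        times to \<open>x\<close>, and \<open>inner (y n) (h (y n))\<close> is the squared norm of
        \<open>(a - a u n) x\<close>. Positivity of \<open>1 - h\<close> comes from
        \<open>norm a \<le> 1\<close>.\<close>
      define y where "y n = x - blinfun_apply (u n) x" for n
      have y: "y (Suc n) = blinfun_apply (id_blinfun - h) (y n)" for n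
        by (simp add: y_def u blinfun.diff_left blinfun.diff_right blinfun.add_left)
      have "(2 * real n + 1) * (inner (y n) (y n) - inner (y n) (y (Suc n))) \<le> inner (y 0) (y 0)"
      proof (rule positive_power_estimate[where R = "id_blinfun - h" and y = y, OF _ _ y])
        show "inner (blinfun_apply (id_blinfun - h) u) v = inner u (blinfun_apply (id_blinfun - h) v)" for u v
          using hin[of u v] hin[of v u] by (simp add: blinfun.diff_left inner_diff inner_commute)
        show "0 \<le> inner u (blinfun_apply (id_blinfun - h) u)" for u
        proof -
          have "norm (blinfun_apply a u) \<le> 1 * norm u"
            by (rule order_trans[OF norm_blinfun]) (use a(2) in \<open>intro mult_right_mono, auto\<close>)
          then have "(norm (blinfun_apply a u))\<^sup>2 \<le> (norm u)\<^sup>2" by (simp add: power_mono)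
          then show ?thesis by (simp add: blinfun.diff_left inner_diff hin power2_norm_eq_inner)
        qed
      qed
      moreover have "inner (y n) (y n) - inner (y n) (y (Suc n)) = (norm (blinfun_apply a (y n)))\<^sup>2"
        by (simp add: y blinfun.diff_left inner_diff hin power2_norm_eq_inner)
      moreover have "inner (y 0) (y 0) = (norm x)\<^sup>2" by (simp add: y_def u power2_norm_eq_inner)
      ultimately have "(norm (blinfun_apply a (y n)))\<^sup>2 \<le> (1 / sqrt (2 * real n + 1) * norm x)\<^sup>2"
        by (simp add: power_mult_distrib power_divide field_simps)
      then have "norm (blinfun_apply a (y n)) \<le> 1 / sqrt (2 * real n + 1) * norm x"
        by (rule power2_le_imp_le) simp
      then show "norm (blinfun_apply (a - (a o\<^sub>L u n)) x) \<le> 1 / sqrt (2 * real n + 1) * norm x"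
        by (simp add: y_def blinfun.diff_left blinfun.diff_right)
    qed simp
    have lim: "(\<lambda>n. 1 / sqrt (2 * real n + 1)) \<longlonglongrightarrow> 0"
    proof -
      have "strict_mono (\<lambda>n :: nat. 2 * n + 1)" by (auto simp: strict_mono_def)
      from LIMSEQ_subseq_LIMSEQ[OF lim_1_over_n[where 'a = real] this]
      have "(\<lambda>n. 1 / (2 * real n + 1)) \<longlonglongrightarrow> 0" by (simp add: o_def add.commute)
      from tendsto_real_sqrt[OF this] show ?thesis by (simp add: real_sqrt_divide)
    qed
    have "(\<lambda>n. a - (a o\<^sub>L u n)) \<longlonglongrightarrow> 0"
      by (rule tendsto_norm_zero_cancel, rule tendsto_sandwich[OF _ _ tendsto_const lim])
        (use bound in \<open>auto simp: add.commute\<close>)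
    then have "(\<lambda>n. a o\<^sub>L u n) \<longlonglongrightarrow> a"
      using tendsto_diff[OF tendsto_const[of a]] by fastforce
    moreover have "a o\<^sub>L u n \<in> clspan {b o\<^sub>L c |b c. b \<in> A \<and> c \<in> A}" for n
      using a(1) uA by (intro clspan_base) blast
    ultimately show ?thesis
      using closed_sequentially[OF closed_closure, of "\<lambda>n. a o\<^sub>L u n"] by blast
  qed
  have n: "norm a + 1 > 0" using norm_ge_zero[of a] by linarith
  have "(1 / (norm a + 1)) *\<^sub>R a \<in> clspan {b o\<^sub>L c |b c. b \<in> A \<and> c \<in> A}"
    using n by (intro unit cstar_scaleR[OF A a]) (simp add: divide_le_eq)
  then have "(norm a + 1) *\<^sub>R (1 / (norm a + 1)) *\<^sub>R a \<in> clspan {b o\<^sub>L c |b c. b \<in> A \<and> c \<in> A}"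
    by (rule subspace_scale[OF subspace_clspan])
  then show ?thesis using n by simp
qed

section \<open>Multipliers, morphisms and their extension to multipliers\<close>

lemma
  assumes "T \<in> multipliers A"
  shows mult_clinear: "clinear T"
    and mult_left: "a \<in> A \<Longrightarrow> T o\<^sub>L a \<in> A"
    and mult_right: "a \<in> A \<Longrightarrow> a o\<^sub>L T \<in> A"
  using assms by (auto simp: multipliers_def)

lemma multipliersI:
  "clinear T \<Longrightarrow> (\<And>a. a \<in> A \<Longrightarrow> T o\<^sub>L a \<in> A) \<Longrightarrow> (\<And>a. a \<in> A \<Longrightarrow> a o\<^sub>L T \<in> A) \<Longrightarrow> T \<in> multipliers A"
  by (simp add: multipliers_def)

lemma multipliers_id: "id_blinfun \<in> multipliers A"
  by (rule multipliersI) simp_all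

lemma multipliers_comp: "S \<in> multipliers A \<Longrightarrow> T \<in> multipliers A \<Longrightarrow> S o\<^sub>L T \<in> multipliers A"
proof (rule multipliersI)
  assume ST: "S \<in> multipliers A" "T \<in> multipliers A"
  fix a assume "a \<in> A"
  then show "S o\<^sub>L T o\<^sub>L a \<in> A" using ST by (simp add: comp_assoc mult_left)
  have "a o\<^sub>L S o\<^sub>L T \<in> A" using ST \<open>a \<in> A\<close> by (intro mult_right)
  then show "a o\<^sub>L (S o\<^sub>L T) \<in> A" by (simp add: comp_assoc)
qed (simp add: mult_clinear)

lemma multipliers_adj:
  assumes A: "cstar_alg A" and T: "T \<in> multipliers A" shows "adj T \<in> multipliers A"
proof (rule multipliersI)
  fix a assume a: "a \<in> A"
  have "adj a o\<^sub>L T \<in> A" "T o\<^sub>L adj a \<in> A"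
    using T a by (auto intro: mult_left mult_right cstar_adj[OF A])
  then have "adj (adj a o\<^sub>L T) \<in> A" "adj (T o\<^sub>L adj a) \<in> A" by (simp_all add: cstar_adj[OF A])
  then show "adj T o\<^sub>L a \<in> A" "a o\<^sub>L adj T \<in> A"
    using a T A by (simp_all add: adj_compose mult_clinear cstar_clinear)
qed (use T in \<open>simp add: mult_clinear\<close>)

lemma cstar_subset_multipliers: "cstar_alg A \<Longrightarrow> a \<in> A \<Longrightarrow> a \<in> multipliers A"
  by (rule multipliersI) (auto simp: cstar_clinear cstar_comp)

lemma multipliers_add: "cstar_alg A \<Longrightarrow> S \<in> multipliers A \<Longrightarrow> T \<in> multipliers A \<Longrightarrow> S + T \<in> multipliers A"
  by (rule multipliersI)
    (auto simp: mult_clinear comp_add_left comp_add_right intro!: cstar_add intro: mult_left mult_right)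

lemma multipliers_scaleR: "cstar_alg A \<Longrightarrow> T \<in> multipliers A \<Longrightarrow> r *\<^sub>R T \<in> multipliers A"
  by (rule multipliersI)
    (auto simp: mult_clinear comp_scaleR_left comp_scaleR_right intro!: cstar_scaleR intro: mult_left mult_right)

lemma
  assumes "\<phi> \<in> cstar_mor A B"
  shows mor_mult: "a \<in> A \<Longrightarrow> \<phi> a \<in> multipliers B"
    and mor_clinear: "a \<in> A \<Longrightarrow> clinear (\<phi> a)"
    and mor_add: "a \<in> A \<Longrightarrow> b \<in> A \<Longrightarrow> \<phi> (a + b) = \<phi> a + \<phi> b"
    and mor_comp: "a \<in> A \<Longrightarrow> b \<in> A \<Longrightarrow> \<phi> (a o\<^sub>L b) = \<phi> a o\<^sub>L \<phi> b"
    and mor_cscale: "a \<in> A \<Longrightarrow> \<phi> (cscale c a) = cscale c (\<phi> a)"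
    and mor_scaleR: "a \<in> A \<Longrightarrow> \<phi> (r *\<^sub>R a) = r *\<^sub>R \<phi> a"
    and mor_adj: "a \<in> A \<Longrightarrow> \<phi> (adj a) = adj (\<phi> a)"
    and mor_dense: "clspan {\<phi> a o\<^sub>L b |a b. a \<in> A \<and> b \<in> B} = B"
proof -
  show "\<phi> (cscale c a) = cscale c (\<phi> a)" if "a \<in> A" for a c using assms that by (auto simp: cstar_mor_def)
  from this[of a "complex_of_real r"] show "a \<in> A \<Longrightarrow> \<phi> (r *\<^sub>R a) = r *\<^sub>R \<phi> a" by (simp add: cscale_of_real)
  show 1: "a \<in> A \<Longrightarrow> \<phi> a \<in> multipliers B" using assms by (auto simp: cstar_mor_def)
  then show "a \<in> A \<Longrightarrow> clinear (\<phi> a)" by (rule mult_clinear)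
qed (use assms in \<open>auto simp: cstar_mor_def\<close>)

lemma mor_adj_comp:
  assumes "cstar_alg A" "\<phi> \<in> cstar_mor A B" "a \<in> A" "b \<in> A"
  shows "adj (\<phi> a) o\<^sub>L \<phi> b = \<phi> (adj a o\<^sub>L b)"
  using assms by (simp add: mor_adj mor_comp cstar_adj)

lemma mor_norm_le:
  assumes "cstar_alg A" "\<phi> \<in> cstar_mor A B" "a \<in> A" shows "norm (\<phi> a) \<le> norm a"
  by (rule star_hom_contractive[OF assms(1)])
    (use assms in \<open>auto simp: mor_clinear mor_add mor_comp mor_scaleR mor_adj\<close>)

lemma mor_continuous_on: "cstar_alg A \<Longrightarrow> \<phi> \<in> cstar_mor A B \<Longrightarrow> continuous_on A \<phi>"
  by (rule partial_linear_continuous_on[OF cstar_subspace, where K = 1])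
    (simp_all add: mor_add mor_scaleR mor_norm_le)

lemma total_trans:
  assumes B: "clspan {blinfun_apply b x |b x. b \<in> B} = UNIV"
    and dense: "B \<subseteq> clspan {S o\<^sub>L b |S b. S \<in> R \<and> b \<in> B'}"
  shows "clspan {blinfun_apply S x |S x. S \<in> R} = UNIV"
proof -
  let ?P = "clspan {blinfun_apply S x |S x. S \<in> R}"
  have "blinfun_apply b x \<in> ?P" if "b \<in> B" for b x
  proof (rule clspan_image[OF blinfun.bounded_linear_left[of x]])
    show "b \<in> clspan {S o\<^sub>L b |S b. S \<in> R \<and> b \<in> B'}" using that dense by blast
    fix y assume "y \<in> {S o\<^sub>L b |S b. S \<in> R \<and> b \<in> B'}"
    then obtain S b where "S \<in> R" "y = S o\<^sub>L b" by blast
    then show "blinfun_apply y x \<in> ?P"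
      by (intro clspan_base CollectI exI[of _ S] exI[of _ "blinfun_apply b x"]) simp
  qed
  then have "clspan {blinfun_apply b x |b x. b \<in> B} \<subseteq> ?P" by (intro clspan_mono) auto
  then show ?thesis using B by blast
qed

text \<open>Nondegeneracy of a morphism is defined inside the target algebra; since \<open>B\<close>
  itself has total range, it passes to the Hilbert space. In this form it gives the uniqueness of
  \<open>mor_ext\<close>.\<close>

lemma mor_total:
  assumes "cstar_alg B" "\<phi> \<in> cstar_mor A B"
  shows "clspan {blinfun_apply (\<phi> a) x |a x. a \<in> A} = UNIV"
proof -
  have "clspan {blinfun_apply S x |S x. S \<in> \<phi> ` A} = UNIV"
    by (rule total_trans[OF cstar_total[OF assms(1)], of _ B], subst mor_dense[OF assms(2), symmetric])
      (intro closure_mono span_mono, auto)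
  moreover have "{blinfun_apply S x |S x. S \<in> \<phi> ` A} = {blinfun_apply (\<phi> a) x |a x. a \<in> A}" by auto
  ultimately show ?thesis by simp
qed

lemma blinfun_eqI_range:
  assumes "clspan {blinfun_apply (h a) x |a x. a \<in> A} = UNIV" "\<And>a. a \<in> A \<Longrightarrow> S o\<^sub>L h a = T o\<^sub>L h a"
  shows "S = T"
proof (rule blinfun_eqI_total[OF assms(1)])
  fix y assume "y \<in> {blinfun_apply (h a) x |a x. a \<in> A}"
  then obtain a x where "a \<in> A" "y = blinfun_apply (h a) x" by blast
  then show "blinfun_apply S y = blinfun_apply T y"
    using arg_cong[OF assms(2), of a "\<lambda>R. blinfun_apply R x"] by simp
qed

lemma mor_ext_eqI:
  assumes "clspan {blinfun_apply (h a) x |a x. a \<in> A} = UNIV" "\<And>a. a \<in> A \<Longrightarrow> S o\<^sub>L h a = h (T o\<^sub>L a)"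
  shows "mor_ext A h T = S"
  unfolding mor_ext_def
proof (rule the_equality)
  show "\<forall>a\<in>A. S o\<^sub>L h a = h (T o\<^sub>L a)" using assms(2) by blast
  show "S' = S" if "\<forall>a\<in>A. S' o\<^sub>L h a = h (T o\<^sub>L a)" for S'
    by (rule blinfun_eqI_range[OF assms(1)]) (simp add: that assms(2))
qed

text \<open>\<open>T\<close> is to act by sending \<open>\<pi> Y x\<close> to
  \<open>\<pi> (T o\<^sub>L Y) x\<close>. Inner products of such vectors depend on
  \<open>adj Y o\<^sub>L Y'\<close> alone, so \<open>adj S o\<^sub>L T\<close> can be collected on
  one side and the amplification bound applies. With \<open>YY\<close> an algebra and
  \<open>\<pi> = \<phi>\<close> this extends \<open>\<phi>\<close> to multipliers; with
  \<open>YY = hmod C\<close> it extends \<open>id \<otimes> \<phi>\<close> to adjointable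
  operators.\<close>

lemma star_amplification_exists:
  fixes \<pi> :: "('k::chilbert_space \<Rightarrow>\<^sub>L 'l::chilbert_space) \<Rightarrow> ('m::chilbert_space \<Rightarrow>\<^sub>L 'n::chilbert_space)"
  assumes clin: "\<And>T. T \<in> TT \<Longrightarrow> clinear T" and one: "id_blinfun \<in> TT"
    and mult: "\<And>S T. S \<in> TT \<Longrightarrow> T \<in> TT \<Longrightarrow> S o\<^sub>L T \<in> TT"
    and star: "\<And>T. T \<in> TT \<Longrightarrow> adj T \<in> TT"
    and YY: "\<And>Y. Y \<in> YY \<Longrightarrow> clinear Y" "\<And>T Y. T \<in> TT \<Longrightarrow> Y \<in> YY \<Longrightarrow> T o\<^sub>L Y \<in> YY"
    and \<pi>: "\<And>Y. Y \<in> YY \<Longrightarrow> clinear (\<pi> Y)" "\<And>Y. Y \<in> YY \<Longrightarrow> norm (\<pi> Y) \<le> norm Y"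
    and inn: "\<And>Y Y'. Y \<in> YY \<Longrightarrow> Y' \<in> YY \<Longrightarrow> adj (\<pi> Y) o\<^sub>L \<pi> Y' = \<phi> (adj Y o\<^sub>L Y')"
    and dense: "clspan {blinfun_apply (\<pi> Y) x |Y x. Y \<in> YY} = UNIV"
    and T: "T \<in> TT"
  shows "\<exists>S. norm S \<le> norm T \<and> (\<forall>Y\<in>YY. S o\<^sub>L \<pi> Y = \<pi> (T o\<^sub>L Y))"
proof -
  \<comment> \<open>The extension lemma takes families indexed by a whole type; the pairs with
    \<open>Y\<close> outside \<open>YY\<close> are given the vector \<open>0\<close>, which changes
    no span.\<close>
  let ?v = "\<lambda>T (Y, x). if Y \<in> YY then blinfun_apply (\<pi> (T o\<^sub>L Y)) x else 0"
  have bd: "norm (?v T i) \<le> (case i of (Y, x) \<Rightarrow> norm Y * norm x) * norm T" if "T \<in> TT" for T i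
  proof (cases i)
    case (Pair Y x)
    have "norm (blinfun_apply (\<pi> (T o\<^sub>L Y)) x) \<le> norm T * norm Y * norm x" if "Y \<in> YY"
    proof -
      have "norm (\<pi> (T o\<^sub>L Y)) \<le> norm T * norm Y"
        using \<pi>(2)[OF YY(2)[OF \<open>T \<in> TT\<close> that]] norm_blinfun_compose[of T Y] by linarith
      then show ?thesis by (meson norm_blinfun order_trans mult_right_mono norm_ge_zero)
    qed
    then show ?thesis by (simp add: Pair mult_ac)
  qed
  have cin: "cinner (?v S i) (?v T j) = cinner (?v id_blinfun i) (?v (adj S o\<^sub>L T) j)"
    if ST: "S \<in> TT" "T \<in> TT" for S T i j
  proof -
    obtain Y x Y' x' where ij: "i = (Y, x)" "j = (Y', x')" by (cases i, cases j)
    have "cinner (blinfun_apply (\<pi> (S o\<^sub>L Y)) x) (blinfun_apply (\<pi> (T o\<^sub>L Y')) x')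
        = cinner (blinfun_apply (\<pi> Y) x) (blinfun_apply (\<pi> (adj S o\<^sub>L T o\<^sub>L Y')) x')"
      if Y: "Y \<in> YY" "Y' \<in> YY"
    proof -
      have m: "S o\<^sub>L Y \<in> YY" "T o\<^sub>L Y' \<in> YY" "adj S o\<^sub>L T o\<^sub>L Y' \<in> YY"
        using ST Y by (auto intro: YY(2) mult star)
      have "adj (\<pi> (S o\<^sub>L Y)) o\<^sub>L \<pi> (T o\<^sub>L Y') = adj (\<pi> Y) o\<^sub>L \<pi> (adj S o\<^sub>L T o\<^sub>L Y')"
        unfolding inn[OF m(1,2)] inn[OF Y(1) m(3)]
        by (simp add: adj_compose clin[OF ST(1)] YY(1)[OF Y(1)] comp_assoc)
      from arg_cong[OF this, of "\<lambda>R. cinner x (blinfun_apply R x')"] show ?thesis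
        by (simp add: cinner_adj_right \<pi>(1)[OF m(1)] \<pi>(1)[OF Y(1)])
    qed
    then show ?thesis by (simp add: ij)
  qed
  have dense': "clspan (range (?v id_blinfun)) = UNIV"
  proof -
    have "{blinfun_apply (\<pi> Y) x |Y x. Y \<in> YY} \<subseteq> range (?v id_blinfun)"
      by (auto intro!: image_eqI[where x = "(_, _)"])
    then show ?thesis using dense closure_mono[OF span_mono] by blast
  qed
  have "\<exists>S. norm S \<le> norm T \<and> (\<forall>i. blinfun_apply S (?v id_blinfun i) = ?v T i)"
  proof (rule blinfun_extension[OF dense' norm_ge_zero])
    show "norm (\<Sum>i\<in>F. r i *\<^sub>R ?v T i) \<le> norm T * norm (\<Sum>i\<in>F. r i *\<^sub>R ?v id_blinfun i)" if "finite F" for F r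
      by (rule star_amplification_bound[where TT = TT and K = "\<lambda>(Y, x). norm Y * norm x"])
        (use bd cin T that in \<open>auto intro: clin one mult star\<close>)
  qed
  then obtain S where S: "norm S \<le> norm T" "\<And>i. blinfun_apply S (?v id_blinfun i) = ?v T i" by blast
  have "blinfun_apply S (blinfun_apply (\<pi> Y) x) = blinfun_apply (\<pi> (T o\<^sub>L Y)) x" if "Y \<in> YY" for Y x
    using S(2)[of "(Y, x)"] that by simp
  with S(1) show ?thesis by (intro exI[of _ S]) (auto intro!: blinfun_eqI)
qed

lemma mor_ext_exists:
  assumes A: "cstar_alg A" and B: "cstar_alg B" and \<phi>: "\<phi> \<in> cstar_mor A B" and T: "T \<in> multipliers A"
  shows "\<exists>S. norm S \<le> norm T \<and> (\<forall>a\<in>A. S o\<^sub>L \<phi> a = \<phi> (T o\<^sub>L a))"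
  by (rule star_amplification_exists[where TT = "multipliers A" and \<phi> = \<phi>,
        OF _ _ _ _ _ _ _ _ _ mor_total[OF B \<phi>]])
    (use T in \<open>auto intro: mult_clinear multipliers_id multipliers_comp multipliers_adj[OF A] cstar_clinear[OF A]
      mult_left mor_clinear[OF \<phi>] mor_norm_le[OF A \<phi>] mor_adj_comp[OF A \<phi>]\<close>)

context
  fixes A :: "'a::chilbert_space op set" and B :: "'b::chilbert_space op set" and \<phi>
  assumes A: "cstar_alg A" and B: "cstar_alg B" and \<phi>: "\<phi> \<in> cstar_mor A B"
begin

lemma mor_ext_eqI': "(\<And>a. a \<in> A \<Longrightarrow> S o\<^sub>L \<phi> a = \<phi> (T o\<^sub>L a)) \<Longrightarrow> mor_ext A \<phi> T = S"
  by (rule mor_ext_eqI[OF mor_total[OF B \<phi>]])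

lemma mor_ext_comp_mor: "T \<in> multipliers A \<Longrightarrow> a \<in> A \<Longrightarrow> mor_ext A \<phi> T o\<^sub>L \<phi> a = \<phi> (T o\<^sub>L a)"
  using mor_ext_exists[OF A B \<phi>] mor_ext_eqI' by metis

lemma mor_ext_alg: "a \<in> A \<Longrightarrow> mor_ext A \<phi> a = \<phi> a"
  by (rule mor_ext_eqI') (simp add: mor_comp[OF \<phi>])

lemma mor_ext_id: "mor_ext A \<phi> id_blinfun = id_blinfun"
  by (rule mor_ext_eqI') simp

lemma mor_ext_comp:
  "S \<in> multipliers A \<Longrightarrow> T \<in> multipliers A \<Longrightarrow> mor_ext A \<phi> (S o\<^sub>L T) = mor_ext A \<phi> S o\<^sub>L mor_ext A \<phi> T"
  by (rule mor_ext_eqI') (simp add: comp_assoc mor_ext_comp_mor mult_left)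

lemma mor_ext_add:
  "S \<in> multipliers A \<Longrightarrow> T \<in> multipliers A \<Longrightarrow> mor_ext A \<phi> (S + T) = mor_ext A \<phi> S + mor_ext A \<phi> T"
  by (rule mor_ext_eqI') (simp add: comp_add_left mor_ext_comp_mor mult_left mor_add[OF \<phi>])

lemma mor_ext_scaleR: "T \<in> multipliers A \<Longrightarrow> mor_ext A \<phi> (r *\<^sub>R T) = r *\<^sub>R mor_ext A \<phi> T"
  by (rule mor_ext_eqI') (simp add: comp_scaleR_left mor_ext_comp_mor mult_left mor_scaleR[OF \<phi>])

lemma mor_ext_cscale: "T \<in> multipliers A \<Longrightarrow> mor_ext A \<phi> (cscale c T) = cscale c (mor_ext A \<phi> T)"
  by (rule mor_ext_eqI') (simp add: cscale_comp_left mor_ext_comp_mor mult_left mor_cscale[OF \<phi>])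

lemma mor_ext_adj:
  assumes T: "T \<in> multipliers A" shows "mor_ext A \<phi> (adj T) = adj (mor_ext A \<phi> T)"
proof -
  have "adj (mor_ext A \<phi> T) = mor_ext A \<phi> (adj T)"
  proof (rule adj_eqI_total[OF mor_total[OF B \<phi>] mor_total[OF B \<phi>]])
    fix u v
    assume "u \<in> {blinfun_apply (\<phi> a) x |a x. a \<in> A}" "v \<in> {blinfun_apply (\<phi> a) x |a x. a \<in> A}"
    then obtain a x b y where ab: "a \<in> A" "b \<in> A" and uv: "u = blinfun_apply (\<phi> a) x" "v = blinfun_apply (\<phi> b) y"
      by blast
    have T': "adj T \<in> multipliers A" using T by (rule multipliers_adj[OF A])
    have m: "adj T o\<^sub>L a \<in> A" "T o\<^sub>L b \<in> A" using ab T T' by (auto intro: mult_left)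
    have cl: "clinear T" "clinear a" using T ab A by (auto simp: mult_clinear cstar_clinear)
    have "adj (\<phi> (adj T o\<^sub>L a)) o\<^sub>L \<phi> b = adj (\<phi> a) o\<^sub>L \<phi> (T o\<^sub>L b)"
      using ab m by (simp add: mor_adj_comp[OF A \<phi>] adj_compose cl comp_assoc)
    then have "blinfun_apply (adj (\<phi> (adj T o\<^sub>L a))) v = blinfun_apply (adj (\<phi> a)) (blinfun_apply (\<phi> (T o\<^sub>L b)) y)"
      unfolding uv by (metis blinfun_apply_blinfun_compose)
    then have "cinner (blinfun_apply (\<phi> (adj T o\<^sub>L a)) x) v = cinner u (blinfun_apply (\<phi> (T o\<^sub>L b)) y)"
      unfolding uv cinner_adj_right[OF mor_clinear[OF \<phi> m(1)], symmetric]
        cinner_adj_right[OF mor_clinear[OF \<phi> ab(1)], symmetric] by simp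
    then show "cinner (blinfun_apply (mor_ext A \<phi> (adj T)) u) v = cinner u (blinfun_apply (mor_ext A \<phi> T) v)"
      unfolding uv using mor_ext_comp_mor[OF T' ab(1)] mor_ext_comp_mor[OF T ab(2)]
      by (metis blinfun_apply_blinfun_compose)
  qed
  then show ?thesis by simp
qed

lemma clinear_mor_ext: assumes T: "T \<in> multipliers A" shows "clinear (mor_ext A \<phi> T)"
proof (rule clinear_if_total[OF mor_total[OF B \<phi>]])
  fix c u assume "u \<in> {blinfun_apply (\<phi> a) x |a x. a \<in> A}"
  then obtain a x where a: "a \<in> A" "u = blinfun_apply (\<phi> a) x" by blast
  have "blinfun_apply (mor_ext A \<phi> T) (blinfun_apply (\<phi> a) y) = blinfun_apply (\<phi> (T o\<^sub>L a)) y" for y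
    using mor_ext_comp_mor[OF T a(1)] by (metis blinfun_apply_blinfun_compose)
  moreover have "clinear (\<phi> a)" "clinear (\<phi> (T o\<^sub>L a))" using a T by (auto intro: mor_clinear[OF \<phi>] mult_left)
  ultimately show "blinfun_apply (mor_ext A \<phi> T) (c *\<^sub>C u) = c *\<^sub>C blinfun_apply (mor_ext A \<phi> T) u"
    unfolding a(2) by (simp flip: clinearD)
qed

lemma mor_ext_multipliers: assumes T: "T \<in> multipliers A" shows "mor_ext A \<phi> T \<in> multipliers B"
proof -
  have left: "mor_ext A \<phi> T o\<^sub>L b \<in> B" if T: "T \<in> multipliers A" and b: "b \<in> B" for T b
  proof (rule clspan_subset_vimage[OF bounded_linear_comp_right _ cstar_subspace[OF B] cstar_closed[OF B]])
    show "b \<in> clspan {\<phi> a o\<^sub>L b |a b. a \<in> A \<and> b \<in> B}" using b by (simp add: mor_dense[OF \<phi>])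
    fix y assume "y \<in> {\<phi> a o\<^sub>L b |a b. a \<in> A \<and> b \<in> B}"
    then show "mor_ext A \<phi> T o\<^sub>L y \<in> B"
      using T by (auto simp: comp_assoc[symmetric] mor_ext_comp_mor intro!: mult_left[OF mor_mult[OF \<phi>]] mult_left[OF T])
  qed
  show ?thesis
  proof (rule multipliersI)
    fix b assume b: "b \<in> B"
    show "mor_ext A \<phi> T o\<^sub>L b \<in> B" by (rule left[OF T b])
    \<comment> \<open>Right multiplication is the adjoint of left multiplication by the extension of
      \<open>adj T\<close>.\<close>
    have "adj (mor_ext A \<phi> (adj T) o\<^sub>L adj b) \<in> B"
      using T b by (intro cstar_adj[OF B] left multipliers_adj[OF A])
    then show "b o\<^sub>L mor_ext A \<phi> T \<in> B"
      using T b by (simp add: adj_compose mor_ext_adj clinear_mor_ext multipliers_adj[OF A] cstar_clinear[OF B])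
  qed (rule clinear_mor_ext[OF T])
qed

end

text \<open>The point is nondegeneracy: \<open>\<psi> (\<phi> a o\<^sub>L b) o\<^sub>L c\<close>
  equals \<open>?\<chi> a o\<^sub>L (\<psi> b o\<^sub>L c)\<close>, and the products
  \<open>\<phi> a o\<^sub>L b\<close> span a dense subspace of \<open>B\<close>. The restriction to
  \<open>A\<close> makes the composite extensional, as members of \<open>cstar_mor\<close>
  are.\<close>

lemma mor_compose:
  assumes A: "cstar_alg A" and B: "cstar_alg B" and C: "cstar_alg C"
    and \<phi>: "\<phi> \<in> cstar_mor A B" and \<psi>: "\<psi> \<in> cstar_mor B C"
  shows "(\<lambda>a\<in>A. mor_ext B \<psi> (\<phi> a)) \<in> cstar_mor A C" (is "?\<chi> \<in> _")
proof -
  have \<chi>: "?\<chi> a = mor_ext B \<psi> (\<phi> a)" if "a \<in> A" for a using that by simp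
  have mult: "?\<chi> a \<in> multipliers C" if "a \<in> A" for a
    unfolding \<chi>[OF that] by (intro mor_ext_multipliers[OF B C \<psi>] mor_mult[OF \<phi>] that)
  have "C \<subseteq> clspan {?\<chi> a o\<^sub>L c |a c. a \<in> A \<and> c \<in> C}" (is "_ \<subseteq> ?P")
  proof -
    have "\<psi> b o\<^sub>L c \<in> ?P" if "b \<in> B" and c: "c \<in> C" for b c
    proof (rule clspan_partial_linear[where f = "\<lambda>b. \<psi> b o\<^sub>L c", OF cstar_subspace[OF B] cstar_closed[OF B]])
      show b: "b \<in> clspan {\<phi> a o\<^sub>L b |a b. a \<in> A \<and> b \<in> B}" using that mor_dense[OF \<phi>] by blast
      show "continuous_on B (\<lambda>b. \<psi> b o\<^sub>L c)"
        by (rule bounded_linear.continuous_on[OF bounded_linear_comp_left mor_continuous_on[OF B \<psi>]])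
      fix x assume "x \<in> {\<phi> a o\<^sub>L b |a b. a \<in> A \<and> b \<in> B}"
      then obtain a b where ab: "a \<in> A" "b \<in> B" "x = \<phi> a o\<^sub>L b" by blast
      have "\<psi> x o\<^sub>L c = ?\<chi> a o\<^sub>L (\<psi> b o\<^sub>L c)"
        using ab by (simp add: mor_ext_comp_mor[OF B C \<psi>] mor_mult[OF \<phi>] flip: comp_assoc)
      moreover have "\<psi> b o\<^sub>L c \<in> C" by (rule mult_left[OF mor_mult[OF \<psi> ab(2)] c])
      ultimately show "\<psi> x o\<^sub>L c \<in> ?P" using ab(1) by (intro clspan_base) blast
    qed (auto simp: mor_add[OF \<psi>] mor_scaleR[OF \<psi>] comp_add_left comp_scaleR_left subspace_clspan
        intro: mult_left[OF mor_mult[OF \<phi>]])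
    then have "{\<psi> b o\<^sub>L c |b c. b \<in> B \<and> c \<in> C} \<subseteq> ?P" by blast
    then have "clspan {\<psi> b o\<^sub>L c |b c. b \<in> B \<and> c \<in> C} \<subseteq> ?P" by (rule clspan_mono)
    then show ?thesis unfolding mor_dense[OF \<psi>] .
  qed
  moreover have "clspan {?\<chi> a o\<^sub>L c |a c. a \<in> A \<and> c \<in> C} \<subseteq> C"
    using mult by (intro cstar_clspan_subset[OF C]) (auto intro: mult_left)
  ultimately show ?thesis
    unfolding cstar_mor_def using mult
    by (auto simp: A cstar_add cstar_comp cstar_cscale cstar_adj mor_add[OF \<phi>] mor_comp[OF \<phi>] mor_cscale[OF \<phi>] mor_adj[OF \<phi>]
        mor_ext_add[OF B C \<psi>] mor_ext_comp[OF B C \<psi>] mor_ext_cscale[OF B C \<psi>] mor_ext_adj[OF B C \<psi>] mor_mult[OF \<phi>])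
qed

section \<open>Amplification of morphisms\<close>

text \<open>The left slice of \<open>T\<close> by the vector functional
  \<open>\<lambda>S. cinner x (blinfun_apply S z)\<close>, that is, a matrix coefficient of
  \<open>T\<close> with operator values.\<close>

definition slice :: "'h::chilbert_space \<Rightarrow> ('h, 'k::chilbert_space) htensor op \<Rightarrow> 'h \<Rightarrow> 'k op"
  where "slice x T z = adj (ket x) o\<^sub>L T o\<^sub>L ket z"

lemma clinear_slice [simp]: "clinear T \<Longrightarrow> clinear (slice x T z)"
  by (simp add: slice_def)

lemma cinner_slice: "cinner y (blinfun_apply (slice x T z) w) = cinner (x \<otimes>\<^sub>h y) (blinfun_apply T (z \<otimes>\<^sub>h w))"
  by (simp add: slice_def cinner_adj_right)

lemma slice_add: "slice x (S + T) z = slice x S z + slice x T z"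
  by (simp add: slice_def comp_add_left comp_add_right)

lemma slice_scaleR: "slice x (r *\<^sub>R T) z = r *\<^sub>R slice x T z"
  by (simp add: slice_def comp_scaleR_left comp_scaleR_right)

lemma slice_cscale: "slice x (cscale c T) z = cscale c (slice x T z)"
  by (simp add: slice_def cscale_comp_left cscale_comp_right)

lemma slice_adj: "clinear T \<Longrightarrow> slice x (adj T) z = adj (slice z T x)"
  by (simp add: slice_def adj_compose comp_assoc)

lemma slice_op_tensor:
  "clinear S \<Longrightarrow> clinear T \<Longrightarrow> slice x (S \<otimes>\<^sub>o T) z = cscale (cinner x (blinfun_apply S z)) T"
  by (rule blinfun_eqI_cinner) (simp add: cinner_slice cinner_tensor cscale_apply cinner_scaleC_right)

lemma blinfun_eqI_slices:
  fixes S T :: "('a::chilbert_space, 'b::chilbert_space) htensor op"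
  assumes X: "clspan X = UNIV" and Z: "clspan Z = UNIV"
    and eq: "\<And>x z. x \<in> X \<Longrightarrow> z \<in> Z \<Longrightarrow> slice x S z = slice x T z"
  shows "S = T"
proof (rule blinfun_eqI_total[OF clspan_tensors_total[OF Z, of UNIV]])
  fix u :: "('a, 'b) htensor" assume "u \<in> {z \<otimes>\<^sub>h w |z w. z \<in> Z \<and> w \<in> UNIV}"
  then obtain z w where u: "u = z \<otimes>\<^sub>h w" "z \<in> Z" by blast
  show "blinfun_apply S u = blinfun_apply T u"
  proof (rule cinner_eqI)
    fix v
    have "cinner (blinfun_apply S u) v = cinner (blinfun_apply T u) v"
    proof (rule bounded_linear_eq_on_clspan[OF bounded_linear_cinner_right bounded_linear_cinner_right])
      show "v \<in> clspan {x \<otimes>\<^sub>h y |x y. x \<in> X \<and> y \<in> UNIV}" by (subst clspan_tensors_total[OF X]) simp_all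
      fix v :: "('a, 'b) htensor" assume "v \<in> {x \<otimes>\<^sub>h y |x y. x \<in> X \<and> y \<in> UNIV}"
      then obtain x y where v: "v = x \<otimes>\<^sub>h y" "x \<in> X" by blast
      have "cinner v (blinfun_apply S u) = cinner v (blinfun_apply T u)"
        unfolding u(1) v(1) cinner_slice[symmetric] eq[OF v(2) u(2)] ..
      then show "cinner (blinfun_apply S u) v = cinner (blinfun_apply T u) v"
        by (metis cinner_commute)
    qed
    then show "cinner v (blinfun_apply S u) = cinner v (blinfun_apply T u)" by (metis cinner_commute)
  qed
qed simp

text \<open>The Hilbert module \<open>H \<otimes> C\<close>, realised by operators \<open>K \<rightarrow> H \<otimes> K\<close>, and the algebra of its adjointable
  operators.\<close>

definition hmod :: "'k::chilbert_space op set \<Rightarrow> ('k \<Rightarrow>\<^sub>L ('h::chilbert_space, 'k) htensor) set"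
  where "hmod C = clspan {ket z o\<^sub>L c |z c. c \<in> C}"

definition hops :: "'k::chilbert_space op set \<Rightarrow> ('h::chilbert_space, 'k) htensor op set"
  where "hops C = {T. clinear T \<and> (\<forall>Y\<in>hmod C. T o\<^sub>L Y \<in> hmod C \<and> adj T o\<^sub>L Y \<in> hmod C)}"

lemma subspace_hmod: "subspace (hmod C)"
  unfolding hmod_def by (rule subspace_clspan)

lemma closed_hmod: "closed (hmod C)"
  unfolding hmod_def by simp

lemma ket_comp_hmod: "c \<in> C \<Longrightarrow> ket z o\<^sub>L c \<in> hmod C"
  unfolding hmod_def by (intro clspan_base) blast

lemma hmod_induct:
  assumes "Y \<in> hmod C" "bounded_linear f" "\<And>z c. c \<in> C \<Longrightarrow> f (ket z o\<^sub>L c) \<in> P" "subspace P" "closed P"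
  shows "f Y \<in> P"
  by (rule clspan_subset_vimage[OF assms(2) _ assms(4,5) assms(1)[unfolded hmod_def]]) (use assms(3) in auto)

lemma adj_ket_comp_ket: "adj (ket x) o\<^sub>L (ket z o\<^sub>L T) = cscale (cinner x z) T"
  by (rule blinfun_eqI) (simp add: cscale_apply)

context
  fixes C :: "'k::chilbert_space op set"
  assumes C: "cstar_alg C"
begin

lemma clinear_hmod: assumes "Y \<in> hmod C" shows "clinear (Y :: 'k \<Rightarrow>\<^sub>L ('h::chilbert_space, 'k) htensor)"
  using hmod_induct[OF assms bounded_linear_ident _ subspace_clinear closed_clinear] by (simp add: cstar_clinear[OF C])

lemma hmod_slice: "Y \<in> hmod C \<Longrightarrow> adj (ket x) o\<^sub>L Y \<in> C"
proof (erule hmod_induct[OF _ bounded_linear_comp_right _ cstar_subspace[OF C] cstar_closed[OF C]])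
  fix z c assume c: "c \<in> C"
  show "adj (ket x) o\<^sub>L (ket z o\<^sub>L c) \<in> C" by (simp add: adj_ket_comp_ket cstar_cscale[OF C] c)
qed

text \<open>\<open>adj Y o\<^sub>L Y'\<close> is the \<open>C\<close>-valued inner product of the
  Hilbert module; on a generator it reduces to a coefficient of \<open>Y\<close>.\<close>

lemma hmod_inner: assumes Y: "Y \<in> hmod C" shows "Y' \<in> hmod C \<Longrightarrow> adj Y o\<^sub>L Y' \<in> C"
proof (erule hmod_induct[OF _ bounded_linear_comp_right _ cstar_subspace[OF C] cstar_closed[OF C]])
  fix z c assume c: "c \<in> C"
  have "adj (adj (ket z) o\<^sub>L Y) o\<^sub>L c \<in> C"
    using c Y by (intro cstar_comp[OF C] cstar_adj[OF C] hmod_slice)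
  then show "adj Y o\<^sub>L (ket z o\<^sub>L c) \<in> C" by (simp add: adj_compose clinear_hmod[OF Y] comp_assoc)
qed

lemma hopsI:
  assumes "clinear T" "\<And>z c. c \<in> C \<Longrightarrow> T o\<^sub>L (ket z o\<^sub>L c) \<in> hmod C" "\<And>z c. c \<in> C \<Longrightarrow> adj T o\<^sub>L (ket z o\<^sub>L c) \<in> hmod C"
  shows "T \<in> hops C"
  using assms(1) hmod_induct[OF _ bounded_linear_comp_right assms(2) subspace_hmod closed_hmod]
    hmod_induct[OF _ bounded_linear_comp_right assms(3) subspace_hmod closed_hmod]
  by (auto simp: hops_def)

lemma hops_clinear: "T \<in> hops C \<Longrightarrow> clinear T"
  and hops_hmod: "T \<in> hops C \<Longrightarrow> Y \<in> hmod C \<Longrightarrow> T o\<^sub>L Y \<in> hmod C"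
  and hops_adj: "T \<in> hops C \<Longrightarrow> adj T \<in> hops C"
  by (auto simp: hops_def)

lemma hops_id: "id_blinfun \<in> hops C"
  by (simp add: hops_def)

lemma hops_comp: "S \<in> hops C \<Longrightarrow> T \<in> hops C \<Longrightarrow> S o\<^sub>L T \<in> hops C"
  by (auto simp: hops_def adj_compose comp_assoc)

lemma hops_add: "S \<in> hops C \<Longrightarrow> T \<in> hops C \<Longrightarrow> S + T \<in> hops C"
  by (auto simp: hops_def adj_add comp_add_left intro: subspace_add[OF subspace_hmod])

lemma hops_scaleR: "T \<in> hops C \<Longrightarrow> r *\<^sub>R T \<in> hops C"
  by (auto simp: hops_def adj_scaleR comp_scaleR_left intro: subspace_scale[OF subspace_hmod])

lemma hops_zero: "0 \<in> hops C"
  using hops_scaleR[OF hops_id, of 0] by simp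

lemma subspace_hops: "subspace (hops C)"
  by (simp add: subspace_def hops_zero hops_add hops_scaleR)

lemma closed_hops: "closed (hops C :: ('h::chilbert_space, 'k) htensor op set)"
  unfolding closed_sequential_limits
proof (intro allI impI, elim conjE)
  fix X :: "nat \<Rightarrow> ('h, 'k) htensor op" and l assume X: "\<forall>n. X n \<in> hops C" "X \<longlonglongrightarrow> l"
  then have cl: "clinear (X n)" for n by (blast intro: hops_clinear)
  have l: "clinear l" using closed_sequentially[OF closed_clinear _ X(2)] cl by auto
  have "l o\<^sub>L Y \<in> hmod C" "adj l o\<^sub>L Y \<in> hmod C" if Y: "Y \<in> hmod C" for Y
  proof -
    have t: "(\<lambda>n. X n o\<^sub>L Y) \<longlonglongrightarrow> (l o\<^sub>L Y)" "(\<lambda>n. adj (X n) o\<^sub>L Y) \<longlonglongrightarrow> (adj l o\<^sub>L Y)"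
      using X(2) tendsto_adj[OF cl X(2)] by (auto intro: bounded_linear.tendsto[OF bounded_linear_comp_left])
    have "X n o\<^sub>L Y \<in> hmod C" "adj (X n) o\<^sub>L Y \<in> hmod C" for n
      using X(1) Y by (auto simp: hops_def)
    then show "l o\<^sub>L Y \<in> hmod C" "adj l o\<^sub>L Y \<in> hmod C"
      using closed_sequentially[OF closed_hmod _ t(1)] closed_sequentially[OF closed_hmod _ t(2)] by blast+
  qed
  then show "l \<in> hops C" using l by (simp add: hops_def)
qed

lemma slice_comp_multiplier: "T \<in> hops C \<Longrightarrow> c \<in> C \<Longrightarrow> slice x T z o\<^sub>L c \<in> C"
  unfolding slice_def comp_assoc by (intro hmod_slice hops_hmod ket_comp_hmod)

text \<open>A coefficient of an element of \<open>hmod C\<close> lies in \<open>C\<close>, whereas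
  one of an adjointable operator is only a multiplier. Hence \<open>\<phi>\<close> itself suffices
  for the module, and \<open>mor_ext\<close> is required for operators.\<close>

lemma slice_multipliers: assumes T: "T \<in> hops C" shows "slice x T z \<in> multipliers C"
proof (rule multipliersI)
  fix c assume c: "c \<in> C"
  show "slice x T z o\<^sub>L c \<in> C" by (rule slice_comp_multiplier[OF T c])
  have "adj (slice z (adj T) x o\<^sub>L adj c) \<in> C"
    by (intro cstar_adj[OF C] slice_comp_multiplier hops_adj T c)
  then show "c o\<^sub>L slice x T z \<in> C"
    using c T by (simp add: adj_compose cstar_clinear[OF C] hops_clinear slice_adj)
qed (simp add: hops_clinear[OF T])

lemma op_tensor_hops:
  assumes S: "clinear S" and m: "m \<in> multipliers C" shows "S \<otimes>\<^sub>o m \<in> hops C"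
proof -
  have *: "(S \<otimes>\<^sub>o m) o\<^sub>L (ket z o\<^sub>L c) \<in> hmod C" if "clinear S" "m \<in> multipliers C" "c \<in> C" for S m z c
  proof -
    have "(S \<otimes>\<^sub>o m) o\<^sub>L (ket z o\<^sub>L c) = ket (blinfun_apply S z) o\<^sub>L (m o\<^sub>L c)"
      using that by (intro blinfun_eqI) (simp add: mult_clinear)
    then show ?thesis using that by (simp add: ket_comp_hmod mult_left)
  qed
  show ?thesis
    by (rule hopsI) (use S m in \<open>auto simp: mult_clinear adj_op_tensor intro!: * multipliers_adj[OF C]\<close>)
qed

end

section \<open>The map \<open>id \<otimes> \<phi>\<close> on the module and on its adjointable
  operators\<close>

definition hmod_ext :: "('k::chilbert_space op \<Rightarrow> 'l::chilbert_space op) \<Rightarrow>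
    ('k \<Rightarrow>\<^sub>L ('h::chilbert_space, 'k) htensor) \<Rightarrow> ('l \<Rightarrow>\<^sub>L ('h, 'l) htensor)"
  where "hmod_ext \<phi> Y = (THE S. \<forall>x. adj (ket x) o\<^sub>L S = \<phi> (adj (ket x) o\<^sub>L Y))"

text \<open>No algebra acting on the first leg enters. The same operation therefore serves for
  \<open>dual W \<otimes>\<^sub>C C\<close>, for both steps of a tensor product of morphisms, and
  for first leg \<open>H \<otimes> H\<close>.\<close>

definition amp :: "'k::chilbert_space op set \<Rightarrow> ('k op \<Rightarrow> 'l::chilbert_space op) \<Rightarrow>
    ('h::chilbert_space, 'k) htensor op \<Rightarrow> ('h, 'l) htensor op"
  where "amp C \<phi> T = (THE S. \<forall>x z. slice x S z = mor_ext C \<phi> (slice x T z))"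

lemma blinfun_eqI_adj_ket:
  assumes "\<And>x. adj (ket x) o\<^sub>L S = adj (ket x) o\<^sub>L T" shows "S = T"
proof (rule blinfun_eqI)
  fix u
  have "cinner (x \<otimes>\<^sub>h y) (blinfun_apply S u) = cinner (x \<otimes>\<^sub>h y) (blinfun_apply T u)" for x y
    using arg_cong[OF assms[of x], of "\<lambda>R. cinner y (blinfun_apply R u)"] by (simp add: cinner_adj_right)
  then have *: "cinner (blinfun_apply S u) (x \<otimes>\<^sub>h y) = cinner (blinfun_apply T u) (x \<otimes>\<^sub>h y)" for x y
    by (metis cinner_commute)
  have "cinner (blinfun_apply S u) v = cinner (blinfun_apply T u) v" for v
    by (rule bounded_linear_eq_on_clspan[OF bounded_linear_cinner_right bounded_linear_cinner_right,
          of "range (\<lambda>(x, y). x \<otimes>\<^sub>h y)"]) (auto simp: * clspan_tensors)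
  then show "blinfun_apply S u = blinfun_apply T u" by (intro cinner_eqI) (metis cinner_commute)
qed

context
  fixes C :: "'k::chilbert_space op set" and D :: "'l::chilbert_space op set" and \<phi>
  assumes C: "cstar_alg C" and D: "cstar_alg D" and \<phi>: "\<phi> \<in> cstar_mor C D"
begin

text \<open>A member of \<open>G\<close> pairs an element of the module with its intended image.
  Relations between coefficients of the two pass to the closed span; since \<open>\<phi>\<close> is
  linear and continuous on \<open>C\<close> only, membership in \<open>C\<close> is carried
  along.\<close>

lemma intertwine_clspan:
  assumes R: "bounded_linear R" and R': "bounded_linear R'"
    and gen: "\<And>p. p \<in> G \<Longrightarrow> R (fst p) \<in> C \<and> \<phi> (R (fst p)) = R' (snd p)"
    and p: "p \<in> clspan G"
  shows "R (fst p) \<in> C" "\<phi> (R (fst p)) = R' (snd p)"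
proof -
  interpret R: bounded_linear R by fact
  interpret R': bounded_linear R' by fact
  let ?Q = "{p. R (fst p) \<in> C}" and ?f = "\<lambda>p. \<phi> (R (fst p)) - R' (snd p)"
  note Rf = bounded_linear_compose[OF R bounded_linear_fst]
  note Q = subspace_linear_vimage[OF Rf cstar_subspace[OF C]] closed_linear_vimage[OF Rf cstar_closed[OF C]]
  have G: "G \<subseteq> ?Q" using gen by blast
  from clspan_minimal[OF this Q] p show "R (fst p) \<in> C" by blast
  have "continuous_on ?Q ?f"
    by (intro continuous_on_diff R'.continuous_on continuous_on_snd continuous_on_id
        continuous_on_compose2[OF mor_continuous_on[OF C \<phi>]] R.continuous_on continuous_on_fst) auto
  from clspan_partial_linear[OF Q G _ _ this, of "{0}", OF _ _ _ _ _ p] gen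
  show "\<phi> (R (fst p)) = R' (snd p)"
    by (simp add: R.add R'.add R.scaleR R'.scaleR mor_add[OF \<phi>] mor_scaleR[OF \<phi>] scaleR_diff_right)
qed

text \<open>The closed span of the pairs
  \<open>(ket z o\<^sub>L c, ket z o\<^sub>L \<phi> c)\<close> is a graph: for a pair
  \<open>(Y, S)\<close> in it, \<open>adj S o\<^sub>L S = \<phi> (adj Y o\<^sub>L Y)\<close>, so
  \<open>norm S \<le> norm Y\<close> because \<open>\<phi>\<close> is contractive. Two elements are
  treated at once in order to record that \<open>id \<otimes> \<phi>\<close> intertwines the inner
  products.\<close>

lemma hmod_ext_exists:
  fixes Y Y' :: "'k \<Rightarrow>\<^sub>L ('h::chilbert_space, 'k) htensor"
  assumes Y: "Y \<in> hmod C" and Y': "Y' \<in> hmod C"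
  shows "\<exists>S S'. clinear S \<and> norm S \<le> norm Y \<and> adj S o\<^sub>L S' = \<phi> (adj Y o\<^sub>L Y') \<and>
    (\<forall>x. adj (ket x) o\<^sub>L S = \<phi> (adj (ket x) o\<^sub>L Y)) \<and> (\<forall>x. adj (ket x) o\<^sub>L S' = \<phi> (adj (ket x) o\<^sub>L Y'))"
proof -
  define G where "G = {(ket (z :: 'h) o\<^sub>L c, ket z o\<^sub>L \<phi> c) |z c. c \<in> C}"
  have clin: "clinear S \<and> Y \<in> hmod C" if "(Y, S) \<in> clspan G" for Y S
  proof -
    have "fst p \<in> hmod C \<and> snd p \<in> {T. clinear T}" if "p \<in> G" for p
      using that by (auto simp: G_def ket_comp_hmod mor_clinear[OF \<phi>])
    then show ?thesis
      using clspan_subset_vimage[OF bounded_linear_snd, of G "{T. clinear T}" "(Y, S)"]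
        clspan_subset_vimage[OF bounded_linear_fst, of G "hmod C" "(Y, S)"] that
      by (auto simp: subspace_clinear closed_clinear subspace_hmod closed_hmod)
  qed
  have sl: "adj (ket x) o\<^sub>L S = \<phi> (adj (ket x) o\<^sub>L Y)" if "(Y, S) \<in> clspan G" for Y S x
  proof -
    have "\<phi> (adj (ket x) o\<^sub>L fst (Y, S)) = adj (ket x) o\<^sub>L snd (Y, S)"
    proof (rule intertwine_clspan(2)[OF bounded_linear_comp_right bounded_linear_comp_right _ that])
      fix p assume "p \<in> G"
      then obtain z c where p: "p = (ket z o\<^sub>L c, ket z o\<^sub>L \<phi> c)" "c \<in> C" by (auto simp: G_def)
      show "adj (ket x) o\<^sub>L fst p \<in> C \<and> \<phi> (adj (ket x) o\<^sub>L fst p) = adj (ket x) o\<^sub>L snd p"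
        using p by (simp add: adj_ket_comp_ket cstar_cscale[OF C] mor_cscale[OF \<phi>])
    qed
    then show ?thesis by simp
  qed
  have inn: "adj S o\<^sub>L S' = \<phi> (adj Y o\<^sub>L Y')" if YS: "(Y, S) \<in> clspan G" and YS': "(Y', S') \<in> clspan G" for Y S Y' S'
  proof -
    have "\<phi> (adj Y o\<^sub>L fst (Y', S')) = adj S o\<^sub>L snd (Y', S')"
    proof (rule intertwine_clspan(2)[OF bounded_linear_comp_right bounded_linear_comp_right _ YS'])
      fix p assume "p \<in> G"
      then obtain z c where p: "p = (ket z o\<^sub>L c, ket z o\<^sub>L \<phi> c)" "c \<in> C" by (auto simp: G_def)
      have Y: "Y \<in> hmod C" "clinear Y" "clinear S" using clin[OF YS] clinear_hmod[OF C] by auto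
      \<comment> \<open>The inner product with a generator is the adjoint of a coefficient times
        \<open>c\<close>, to which \<open>sl\<close> applies.\<close>
      have "adj Y o\<^sub>L (ket z o\<^sub>L c) = adj (adj (ket z) o\<^sub>L Y) o\<^sub>L c"
        "adj S o\<^sub>L (ket z o\<^sub>L \<phi> c) = adj (adj (ket z) o\<^sub>L S) o\<^sub>L \<phi> c"
        by (simp_all add: adj_compose Y comp_assoc)
      then show "adj Y o\<^sub>L fst p \<in> C \<and> \<phi> (adj Y o\<^sub>L fst p) = adj S o\<^sub>L snd p"
        using p hmod_slice[OF C Y(1), of z] hmod_inner[OF C Y(1) ket_comp_hmod[OF p(2)]]
        by (simp add: sl[OF YS] mor_adj_comp[OF C \<phi>] cstar_comp[OF C] cstar_adj[OF C])
    qed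
    then show ?thesis by simp
  qed
  have bd: "norm S \<le> norm Y" if YS: "(Y, S) \<in> clspan G" for Y S
  proof (rule norm_blinfun_bound)
    fix \<xi>
    have Y: "Y \<in> hmod C" "clinear Y" "clinear S" using clin[OF YS] clinear_hmod[OF C] by auto
    have "norm (\<phi> (adj Y o\<^sub>L Y)) \<le> (norm Y)\<^sup>2"
      using mor_norm_le[OF C \<phi> hmod_inner[OF C Y(1) Y(1)]] norm_adj_comp_self[OF Y(2)] by linarith
    moreover have "(norm (blinfun_apply S \<xi>))\<^sup>2 = cmod (cinner \<xi> (blinfun_apply (\<phi> (adj Y o\<^sub>L Y)) \<xi>))"
      unfolding inn[OF YS YS, symmetric] power2_norm_eq_cinner by (simp add: cinner_adj_right Y)
    moreover have "\<dots> \<le> norm \<xi> * (norm (\<phi> (adj Y o\<^sub>L Y)) * norm \<xi>)"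
      by (intro order_trans[OF norm_cinner_le] mult_left_mono norm_blinfun) simp
    moreover have "norm \<xi> * (norm (\<phi> (adj Y o\<^sub>L Y)) * norm \<xi>) \<le> norm \<xi> * ((norm Y)\<^sup>2 * norm \<xi>)"
      by (intro mult_left_mono mult_right_mono calculation(1)) simp_all
    ultimately have "(norm (blinfun_apply S \<xi>))\<^sup>2 \<le> norm \<xi> * ((norm Y)\<^sup>2 * norm \<xi>)" by linarith
    also have "\<dots> = (norm Y * norm \<xi>)\<^sup>2" by (simp add: power2_eq_square mult_ac)
    finally show "norm (blinfun_apply S \<xi>) \<le> norm Y * norm \<xi>" by (rule power2_le_imp_le) simp
  qed simp
  have ex: "\<exists>S. (Y, S) \<in> clspan G" if "Y \<in> hmod C" for Y
  proof (rule graph_closure_exists[where M = 1])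
    have "fst ` span G = span (fst ` G)" by (rule linear_span_image[symmetric]) (rule linear_fst)
    moreover have "fst ` G = {ket z o\<^sub>L c |z c. c \<in> C}" by (force simp: G_def)
    ultimately show "Y \<in> closure (fst ` span G)" using that by (simp add: hmod_def)
    show "norm S \<le> 1 * norm Y" if "(Y, S) \<in> span G" for Y S
      using bd[of Y S] that closure_subset by auto
  qed simp_all
  obtain S S' where "(Y, S) \<in> clspan G" "(Y', S') \<in> clspan G" using ex Y Y' by blast
  then show ?thesis using clin bd inn sl by blast
qed

lemma hmod_ext_eqI:
  "(\<And>x. adj (ket x) o\<^sub>L S = \<phi> (adj (ket x) o\<^sub>L Y)) \<Longrightarrow> hmod_ext \<phi> Y = S"
  unfolding hmod_ext_def
  by (rule the_equality) (auto intro: blinfun_eqI_adj_ket)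

lemma
  assumes "Y \<in> hmod C"
  shows hmod_ext_slice: "adj (ket x) o\<^sub>L hmod_ext \<phi> Y = \<phi> (adj (ket x) o\<^sub>L Y)"
    and norm_hmod_ext_le: "norm (hmod_ext \<phi> Y) \<le> norm Y"
    and clinear_hmod_ext: "clinear (hmod_ext \<phi> Y)"
    and hmod_ext_inner: "Y' \<in> hmod C \<Longrightarrow> adj (hmod_ext \<phi> Y) o\<^sub>L hmod_ext \<phi> Y' = \<phi> (adj Y o\<^sub>L Y')"
  using hmod_ext_exists[OF assms assms] hmod_ext_exists[OF assms, of Y'] hmod_ext_eqI by metis+

lemma hmod_ext_ket: assumes "c \<in> C" shows "hmod_ext \<phi> (ket z o\<^sub>L c) = ket z o\<^sub>L \<phi> c"
  by (rule hmod_ext_eqI) (simp add: adj_ket_comp_ket mor_cscale[OF \<phi> assms])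

lemma hmod_ext_total:
  "clspan {z \<otimes>\<^sub>h blinfun_apply (\<phi> c) \<xi> |z c \<xi>. c \<in> C} = (UNIV :: ('h::chilbert_space, 'l) htensor set)"
proof -
  have "{z \<otimes>\<^sub>h blinfun_apply (\<phi> c) \<xi> |z c \<xi>. c \<in> C}
      = {z \<otimes>\<^sub>h y |(z :: 'h) y. z \<in> UNIV \<and> y \<in> {blinfun_apply (\<phi> c) \<xi> |c \<xi>. c \<in> C}}" by auto
  then show ?thesis using clspan_tensors_total[OF _ mor_total[OF D \<phi>], of UNIV] by simp
qed

lemma amp_hmod_exists:
  fixes T :: "('h::chilbert_space, 'k) htensor op"
  assumes T: "T \<in> hops C"
  shows "\<exists>S. norm S \<le> norm T \<and> (\<forall>Y\<in>hmod C. S o\<^sub>L hmod_ext \<phi> Y = hmod_ext \<phi> (T o\<^sub>L Y))"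
proof (rule star_amplification_exists[where TT = "hops C" and \<phi> = \<phi>])
  have "z \<otimes>\<^sub>h blinfun_apply (\<phi> c) \<xi> \<in> {blinfun_apply (hmod_ext \<phi> Y) \<xi> |Y \<xi>. Y \<in> hmod C}" if "c \<in> C" for z :: 'h and c \<xi>
    using that by (intro CollectI exI[of _ "ket z o\<^sub>L c"] exI[of _ \<xi>]) (simp add: ket_comp_hmod hmod_ext_ket)
  then have "{z \<otimes>\<^sub>h blinfun_apply (\<phi> c) \<xi> |(z :: 'h) c \<xi>. c \<in> C} \<subseteq> {blinfun_apply (hmod_ext \<phi> Y) \<xi> |Y \<xi>. Y \<in> hmod C}" by blast
  from closure_mono[OF span_mono[OF this]]
  show "clspan {blinfun_apply (hmod_ext \<phi> Y) \<xi> |Y \<xi>. Y \<in> hmod C} = (UNIV :: ('h, 'l) htensor set)"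
    unfolding hmod_ext_total by blast
qed (use T in \<open>auto intro: hops_clinear[OF C] hops_id[OF C] hops_comp[OF C] hops_adj[OF C] hops_hmod[OF C]
    clinear_hmod[OF C] clinear_hmod_ext norm_hmod_ext_le hmod_ext_inner\<close>)

lemma amp_slice_exists:
  fixes T :: "('h::chilbert_space, 'k) htensor op"
  assumes T: "T \<in> hops C"
  shows "\<exists>S. norm S \<le> norm T \<and> (\<forall>Y\<in>hmod C. S o\<^sub>L hmod_ext \<phi> Y = hmod_ext \<phi> (T o\<^sub>L Y)) \<and>
    (\<forall>x z. slice x S z = mor_ext C \<phi> (slice x T z))"
proof -
  obtain S where S: "norm S \<le> norm T" "\<And>Y. Y \<in> hmod C \<Longrightarrow> S o\<^sub>L hmod_ext \<phi> Y = hmod_ext \<phi> (T o\<^sub>L Y)"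
    using amp_hmod_exists[OF T] by blast
  have "mor_ext C \<phi> (slice x T z) = slice x S z" for x z
  proof (rule mor_ext_eqI'[OF C D \<phi>])
    fix c assume c: "c \<in> C"
    have "slice x S z o\<^sub>L \<phi> c = adj (ket x) o\<^sub>L (S o\<^sub>L hmod_ext \<phi> (ket z o\<^sub>L c))"
      by (simp add: slice_def hmod_ext_ket c comp_assoc)
    also have "\<dots> = \<phi> (slice x T z o\<^sub>L c)"
      by (simp add: S(2) ket_comp_hmod c hmod_ext_slice hops_hmod[OF C T] slice_def comp_assoc)
    finally show "slice x S z o\<^sub>L \<phi> c = \<phi> (slice x T z o\<^sub>L c)" .
  qed
  with S show ?thesis by (intro exI[of _ S]) simp
qed

lemma amp_eqI: "(\<And>x z. slice x S z = mor_ext C \<phi> (slice x T z)) \<Longrightarrow> amp C \<phi> T = S"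
  unfolding amp_def by (rule the_equality) (auto intro: blinfun_eqI_slices[of UNIV UNIV])

lemma
  assumes "T \<in> hops C"
  shows amp_slice: "slice x (amp C \<phi> T) z = mor_ext C \<phi> (slice x T z)"
    and norm_amp_le: "norm (amp C \<phi> T) \<le> norm T"
    and amp_hmod_ext: "Y \<in> hmod C \<Longrightarrow> amp C \<phi> T o\<^sub>L hmod_ext \<phi> Y = hmod_ext \<phi> (T o\<^sub>L Y)"
  using amp_slice_exists[OF assms] amp_eqI by metis+

lemma amp_eqI_total:
  assumes "T \<in> hops C" "clspan X = UNIV" "clspan Z = UNIV"
    "\<And>x z. x \<in> X \<Longrightarrow> z \<in> Z \<Longrightarrow> slice x S z = mor_ext C \<phi> (slice x T z)"
  shows "amp C \<phi> T = S"
  using assms(4) by (intro blinfun_eqI_slices[OF assms(2,3)]) (simp add: amp_slice[OF assms(1)])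

lemma amp_eqI_hmod:
  fixes T :: "('h::chilbert_space, 'k) htensor op"
  assumes T: "T \<in> hops C" and S: "\<And>z c. c \<in> C \<Longrightarrow> S o\<^sub>L (ket z o\<^sub>L \<phi> c) = hmod_ext \<phi> (T o\<^sub>L (ket z o\<^sub>L c))"
  shows "amp C \<phi> T = S"
proof (rule blinfun_eqI_total[OF hmod_ext_total])
  fix u :: "('h, 'l) htensor" assume "u \<in> {z \<otimes>\<^sub>h blinfun_apply (\<phi> c) \<xi> |z c \<xi>. c \<in> C}"
  then obtain z c \<xi> where u: "u = blinfun_apply (ket z o\<^sub>L \<phi> c) \<xi>" "c \<in> C" by auto
  have "amp C \<phi> T o\<^sub>L (ket z o\<^sub>L \<phi> c) = S o\<^sub>L (ket z o\<^sub>L \<phi> c)"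
    using amp_hmod_ext[OF T ket_comp_hmod[OF u(2)], of z] by (simp add: S u(2) hmod_ext_ket)
  from arg_cong[OF this, of "\<lambda>R. blinfun_apply R \<xi>"]
  show "blinfun_apply (amp C \<phi> T) u = blinfun_apply S u" by (simp add: u(1))
qed

text \<open>Coefficients of a product would be infinite sums of products of coefficients, so
  multiplicativity is read off the action on the module, where \<open>amp C \<phi> T\<close>
  intertwines \<open>hmod_ext \<phi>\<close>.\<close>

lemma amp_comp:
  assumes "S \<in> hops C" "T \<in> hops C" shows "amp C \<phi> (S o\<^sub>L T) = amp C \<phi> S o\<^sub>L amp C \<phi> T"
proof (rule amp_eqI_hmod[OF hops_comp[OF C assms]])
  fix z c assume c: "c \<in> C"
  have "amp C \<phi> S o\<^sub>L amp C \<phi> T o\<^sub>L (ket z o\<^sub>L \<phi> c) = amp C \<phi> S o\<^sub>L hmod_ext \<phi> (T o\<^sub>L (ket z o\<^sub>L c))"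
    using amp_hmod_ext[OF assms(2) ket_comp_hmod[OF c], of z] by (simp add: c hmod_ext_ket comp_assoc)
  then show "amp C \<phi> S o\<^sub>L amp C \<phi> T o\<^sub>L (ket z o\<^sub>L \<phi> c) = hmod_ext \<phi> (S o\<^sub>L T o\<^sub>L (ket z o\<^sub>L c))"
    using amp_hmod_ext[OF assms(1) hops_hmod[OF C assms(2) ket_comp_hmod[OF c]], of z] by (simp add: comp_assoc)
qed

lemma amp_add:
  "S \<in> hops C \<Longrightarrow> T \<in> hops C \<Longrightarrow> amp C \<phi> (S + T) = amp C \<phi> S + amp C \<phi> T"
  by (rule amp_eqI) (simp add: slice_add amp_slice mor_ext_add[OF C D \<phi>] slice_multipliers[OF C])

lemma amp_scaleR: "T \<in> hops C \<Longrightarrow> amp C \<phi> (r *\<^sub>R T) = r *\<^sub>R amp C \<phi> T"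
  by (rule amp_eqI) (simp add: slice_scaleR amp_slice mor_ext_scaleR[OF C D \<phi>] slice_multipliers[OF C])

lemma amp_continuous_on: "continuous_on (hops C) (amp C \<phi>)"
  by (rule partial_linear_continuous_on[OF subspace_hops[OF C], where K = 1])
    (simp_all add: amp_add amp_scaleR norm_amp_le)

lemma amp_op_tensor:
  assumes "clinear S" "m \<in> multipliers C"
  shows "amp C \<phi> (S \<otimes>\<^sub>o m) = S \<otimes>\<^sub>o mor_ext C \<phi> m"
  by (rule amp_eqI)
    (simp add: slice_op_tensor assms mult_clinear[OF assms(2)] clinear_mor_ext[OF C D \<phi>] mor_ext_cscale[OF C D \<phi>])

lemma amp_op_tensor_alg: "clinear S \<Longrightarrow> c \<in> C \<Longrightarrow> amp C \<phi> (S \<otimes>\<^sub>o c) = S \<otimes>\<^sub>o \<phi> c"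
  by (simp add: amp_op_tensor cstar_subset_multipliers[OF C] mor_ext_alg[OF C D \<phi>])

lemma amp_op_tensor_id: "clinear S \<Longrightarrow> amp C \<phi> (S \<otimes>\<^sub>o id_blinfun) = S \<otimes>\<^sub>o id_blinfun"
  by (simp add: amp_op_tensor multipliers_id mor_ext_id[OF C D \<phi>])

lemma amp_id: "amp C \<phi> id_blinfun = id_blinfun"
  using amp_op_tensor_id[of id_blinfun] by simp

lemma clinear_amp:
  fixes T :: "('h::chilbert_space, 'k) htensor op"
  assumes T: "T \<in> hops C" shows "clinear (amp C \<phi> T)"
proof (rule clinear_if_total[OF hmod_ext_total])
  fix a and u :: "('h, 'l) htensor" assume "u \<in> {z \<otimes>\<^sub>h blinfun_apply (\<phi> c) \<xi> |z c \<xi>. c \<in> C}"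
  then obtain z c \<xi> where u: "u = z \<otimes>\<^sub>h blinfun_apply (\<phi> c) \<xi>" "c \<in> C" by blast
  have e: "blinfun_apply (amp C \<phi> T) (z \<otimes>\<^sub>h blinfun_apply (\<phi> c) \<eta>) = blinfun_apply (hmod_ext \<phi> (T o\<^sub>L (ket z o\<^sub>L c))) \<eta>" for \<eta>
    using arg_cong[OF amp_hmod_ext[OF T ket_comp_hmod[OF u(2)], of z], of "\<lambda>R. blinfun_apply R \<eta>"]
    by (simp add: hmod_ext_ket u(2))
  have cl: "clinear (\<phi> c)" "clinear (hmod_ext \<phi> (T o\<^sub>L (ket z o\<^sub>L c)))"
    using u(2) by (auto intro: mor_clinear[OF \<phi>] clinear_hmod_ext hops_hmod[OF C T] ket_comp_hmod)
  have "a *\<^sub>C u = z \<otimes>\<^sub>h blinfun_apply (\<phi> c) (a *\<^sub>C \<xi>)" by (simp add: u(1) clinearD[OF cl(1)] tensor_linear)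
  then show "blinfun_apply (amp C \<phi> T) (a *\<^sub>C u) = a *\<^sub>C blinfun_apply (amp C \<phi> T) u"
    by (simp add: e u(1) clinearD[OF cl(2)])
qed

lemma amp_adj: assumes T: "T \<in> hops C" shows "amp C \<phi> (adj T) = adj (amp C \<phi> T)"
  by (rule amp_eqI)
    (simp add: slice_adj clinear_amp[OF T] hops_clinear[OF C T] amp_slice[OF T]
      mor_ext_adj[OF C D \<phi>] slice_multipliers[OF C T])

lemma unitary_amp: assumes T: "T \<in> hops C" "unitary T" shows "unitary (amp C \<phi> T)"
  using T unfolding unitary_def
  by (simp add: clinear_amp hops_adj[OF C] amp_id flip: amp_adj amp_comp)

lemma amp_cscale: "T \<in> hops C \<Longrightarrow> amp C \<phi> (cscale c T) = cscale c (amp C \<phi> T)"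
  by (rule amp_eqI) (simp add: slice_cscale amp_slice mor_ext_cscale[OF C D \<phi>] slice_multipliers[OF C])

end

section \<open>Spatial tensor products\<close>

lemma subspace_multipliers: "cstar_alg A \<Longrightarrow> subspace (multipliers A)"
  by (auto simp: subspace_def multipliers_add multipliers_scaleR cstar_zero intro: cstar_subset_multipliers)

lemma closed_multipliers:
  assumes A: "cstar_alg (A :: 'a::chilbert_space op set)" shows "closed (multipliers A)"
proof -
  have "multipliers A = {T. clinear T} \<inter> (\<Inter>a\<in>A. {T. T o\<^sub>L a \<in> A} \<inter> {T. a o\<^sub>L T \<in> A})"
    by (auto simp: multipliers_def)
  then show ?thesis
    by (auto intro!: closed_Int closed_INT closed_clinear closed_linear_vimage bounded_linear_comp_left
        bounded_linear_comp_right cstar_closed[OF A])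
qed

text \<open>The dual of \<open>W\<close> enters through this property only: it follows at once from the unitarity of \<open>W\<close>,
  whereas the dual is a \<open>C\<^sup>*\<close>-algebra only by modularity.\<close>

definition nondegenerate :: "'h::chilbert_space op set \<Rightarrow> bool"
  where "nondegenerate B \<longleftrightarrow> (\<forall>b\<in>B. clinear b) \<and> clspan {blinfun_apply b x |b x. b \<in> B} = UNIV
    \<and> clspan {blinfun_apply (adj b) x |b x. b \<in> B} = UNIV"

lemma nondegenerate_clinear: "nondegenerate B \<Longrightarrow> b \<in> B \<Longrightarrow> clinear b"
  and nondegenerate_total: "nondegenerate B \<Longrightarrow> clspan {blinfun_apply b x |b x. b \<in> B} = UNIV"
  and nondegenerate_adj_total: "nondegenerate B \<Longrightarrow> clspan {blinfun_apply (adj b) x |b x. b \<in> B} = UNIV"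
  by (auto simp: nondegenerate_def)

lemma cstar_nondegenerate: assumes A: "cstar_alg A" shows "nondegenerate A"
proof -
  have "{blinfun_apply a x |a x. a \<in> A} = {blinfun_apply (adj a) x |a x. a \<in> A}"
    using cstar_adj[OF A] adj_adj cstar_clinear[OF A] by (metis (no_types, lifting))
  then show ?thesis using cstar_total[OF A] cstar_clinear[OF A] by (simp add: nondegenerate_def)
qed

lemma spatial_elementary: "a \<in> A \<Longrightarrow> b \<in> B \<Longrightarrow> a \<otimes>\<^sub>o b \<in> A \<otimes>\<^sub>C B"
  unfolding spatial_def by (intro clspan_base) blast

lemma subspace_spatial: "subspace (A \<otimes>\<^sub>C B)"
  unfolding spatial_def by (rule subspace_clspan)

lemma closed_spatial: "closed (A \<otimes>\<^sub>C B)"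
  unfolding spatial_def by simp

lemma spatial_subset:
  "(\<And>a b. a \<in> A \<Longrightarrow> b \<in> B \<Longrightarrow> a \<otimes>\<^sub>o b \<in> P) \<Longrightarrow> subspace P \<Longrightarrow> closed P \<Longrightarrow> A \<otimes>\<^sub>C B \<subseteq> P"
  unfolding spatial_def by (intro clspan_minimal) auto

lemma spatial_induct:
  assumes "X \<in> A \<otimes>\<^sub>C B" "bounded_linear f" "\<And>a b. a \<in> A \<Longrightarrow> b \<in> B \<Longrightarrow> f (a \<otimes>\<^sub>o b) \<in> P" "subspace P" "closed P"
  shows "f X \<in> P"
  by (rule clspan_subset_vimage[OF assms(2) _ assms(4,5) assms(1)[unfolded spatial_def]]) (use assms(3) in auto)

lemma nondegenerate_adj: assumes "nondegenerate B" shows "nondegenerate (adj ` B)"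
proof -
  have "{blinfun_apply b x |b x. b \<in> adj ` B} = {blinfun_apply (adj b) x |b x. b \<in> B}"
    "{blinfun_apply (adj b) x |b x. b \<in> adj ` B} = {blinfun_apply b x |b x. b \<in> B}"
    using nondegenerate_clinear[OF assms] by force+
  then show ?thesis using assms by (auto simp: nondegenerate_def)
qed

lemma adj_spatial:
  assumes B: "nondegenerate B" and C: "cstar_alg C" and X: "X \<in> B \<otimes>\<^sub>C C"
  shows "clinear X" "adj X \<in> adj ` B \<otimes>\<^sub>C C"
proof -
  have cl: "clinear a" "clinear b" if "a \<in> B" "b \<in> C" for a b
    using that nondegenerate_clinear[OF B] cstar_clinear[OF C] by auto
  show "adj X \<in> adj ` B \<otimes>\<^sub>C C" "clinear X"
    by (rule clspan_adj(2,1)[OF X[unfolded spatial_def] _ _ subspace_spatial closed_spatial],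
      auto simp: cl adj_op_tensor intro!: spatial_elementary cstar_adj[OF C])+
qed

lemma op_tensor_left_clspan:
  assumes "b \<in> clspan S" "clinear a" "\<And>b. b \<in> S \<Longrightarrow> clinear b" "\<And>b. b \<in> S \<Longrightarrow> a \<otimes>\<^sub>o b \<in> P" "subspace P" "closed P"
  shows "a \<otimes>\<^sub>o b \<in> P"
  by (rule clspan_partial_linear[where f = "\<lambda>b. a \<otimes>\<^sub>o b", OF subspace_clinear closed_clinear _ _ _
        partial_linear_continuous_on[where K = "norm a"] assms(4,5,6,1)])
    (use assms(2,3) in \<open>auto simp: op_tensor_add_right op_tensor_scaleR_right norm_op_tensor_le subspace_clinear\<close>)

lemma op_tensor_right_clspan:
  assumes "a \<in> clspan S" "clinear b" "\<And>a. a \<in> S \<Longrightarrow> clinear a" "\<And>a. a \<in> S \<Longrightarrow> a \<otimes>\<^sub>o b \<in> P" "subspace P" "closed P"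
  shows "a \<otimes>\<^sub>o b \<in> P"
  by (rule clspan_partial_linear[where f = "\<lambda>a. a \<otimes>\<^sub>o b", OF subspace_clinear closed_clinear _ _ _
        partial_linear_continuous_on[where K = "norm b"] assms(4,5,6,1)])
    (use assms(2,3) norm_op_tensor_le[of _ b] in
      \<open>auto simp: op_tensor_add_left op_tensor_scaleR_left mult.commute subspace_clinear\<close>)

lemma total_closed_subset:
  assumes "\<And>x. x \<in> S \<Longrightarrow> x \<in> T" "clspan S = UNIV" shows "clspan T = UNIV"
  using closure_mono[OF span_mono[of S T]] assms by blast

context
  fixes B :: "'h::chilbert_space op set" and C :: "'k::chilbert_space op set"
  assumes B: "nondegenerate B" and C: "cstar_alg C"
begin

lemma spatial_subset_hops: "B \<otimes>\<^sub>C C \<subseteq> hops C"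
  by (intro spatial_subset op_tensor_hops[OF C] subspace_hops[OF C] closed_hops[OF C])
    (auto intro: nondegenerate_clinear[OF B] cstar_subset_multipliers[OF C])

lemma spatial_cscale: "X \<in> B \<otimes>\<^sub>C C \<Longrightarrow> cscale c X \<in> B \<otimes>\<^sub>C C"
proof (erule spatial_induct[OF _ bounded_linear_cscale _ subspace_spatial closed_spatial])
  fix a b assume "a \<in> B" "b \<in> C"
  then show "cscale c (a \<otimes>\<^sub>o b) \<in> B \<otimes>\<^sub>C C"
    by (simp flip: op_tensor_cscale_right add: nondegenerate_clinear[OF B] cstar_clinear[OF C] spatial_elementary cstar_cscale[OF C])
qed

lemma spatial_total: "clspan {blinfun_apply X \<xi> |X \<xi>. X \<in> B \<otimes>\<^sub>C C} = UNIV"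
proof (rule total_closed_subset[OF _ clspan_tensors_total[OF nondegenerate_total[OF B] cstar_total[OF C]]])
  fix \<xi> assume "\<xi> \<in> {x \<otimes>\<^sub>h y |x y. x \<in> {blinfun_apply b x |b x. b \<in> B} \<and> y \<in> {blinfun_apply a x |a x. a \<in> C}}"
  then obtain b x c y where "b \<in> B" "c \<in> C" "\<xi> = blinfun_apply (b \<otimes>\<^sub>o c) (x \<otimes>\<^sub>h y)"
    using nondegenerate_clinear[OF B] cstar_clinear[OF C] by fastforce
  then show "\<xi> \<in> {blinfun_apply X \<xi> |X \<xi>. X \<in> B \<otimes>\<^sub>C C}" using spatial_elementary by blast
qed

text \<open>Only \<open>H \<otimes> C C\<close> is reached directly, so the density of \<open>C C\<close> in \<open>C\<close> enters.\<close>

lemma hmod_preserved: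
  assumes X: "clspan X = UNIV"
    and T: "\<And>x c d. x \<in> X \<Longrightarrow> c \<in> C \<Longrightarrow> d \<in> C \<Longrightarrow> T o\<^sub>L (ket x o\<^sub>L (c o\<^sub>L d)) \<in> (hmod C :: ('k \<Rightarrow>\<^sub>L ('h, 'k) htensor) set)"
    and c: "c \<in> C"
  shows "T o\<^sub>L (ket z o\<^sub>L c) \<in> hmod C"
proof (rule clspan_subset_vimage[of "\<lambda>z. T o\<^sub>L (ket z o\<^sub>L c)" X])
  show "bounded_linear (\<lambda>z. T o\<^sub>L (ket z o\<^sub>L c))"
    by (intro bounded_linear_compose[OF bounded_linear_comp_right]
        bounded_linear_compose[OF bounded_linear_comp_left] bounded_linear_ket)
  show "T o\<^sub>L (ket x o\<^sub>L c) \<in> hmod C" if "x \<in> X" for x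
  proof (rule clspan_subset_vimage[OF _ _ subspace_hmod closed_hmod cstar_square_dense[OF C c]])
    show "bounded_linear (\<lambda>c. T o\<^sub>L (ket x o\<^sub>L c))"
      by (intro bounded_linear_compose[OF bounded_linear_comp_right] bounded_linear_comp_right)
  qed (use T that in auto)
qed (simp_all add: X subspace_hmod closed_hmod)

text \<open>For \<open>x = b y\<close> the vector operator \<open>x \<otimes> (c d)\<close> is
  \<open>(b \<otimes> c) (y \<otimes> d)\<close>, and \<open>T (b \<otimes> c)\<close> lies in
  \<open>B \<otimes>\<^sub>C C\<close>, whose elements are adjointable. For \<open>adj T\<close> the
  factor is \<open>adj b\<close>, since \<open>adj T (adj b \<otimes> c)\<close> is the adjoint of
  \<open>(b \<otimes> adj c) T\<close>; this is where totality of the ranges of the adjoints is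
  used.\<close>

lemma multipliers_spatial_subset_hops:
  assumes T: "T \<in> multipliers (B \<otimes>\<^sub>C C)" shows "T \<in> hops C"
proof (rule hopsI[OF C mult_clinear[OF T]])
  show "T o\<^sub>L (ket z o\<^sub>L c) \<in> hmod C" if "c \<in> C" for z c
  proof (rule hmod_preserved[OF nondegenerate_total[OF B] _ that])
    fix x c d assume "x \<in> {blinfun_apply b x |b x. b \<in> B}" and c: "c \<in> C" and d: "d \<in> C"
    then obtain b y where b: "b \<in> B" "x = blinfun_apply b y" by blast
    have "T o\<^sub>L (ket x o\<^sub>L (c o\<^sub>L d)) = (T o\<^sub>L (b \<otimes>\<^sub>o c)) o\<^sub>L (ket y o\<^sub>L d)"
      by (rule blinfun_eqI) (simp add: b c nondegenerate_clinear[OF B] cstar_clinear[OF C])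
    then show "T o\<^sub>L (ket x o\<^sub>L (c o\<^sub>L d)) \<in> hmod C"
      using hops_hmod[OF C _ ket_comp_hmod[OF d]] mult_left[OF T spatial_elementary[OF b(1) c]] spatial_subset_hops
      by auto
  qed
  show "adj T o\<^sub>L (ket z o\<^sub>L c) \<in> hmod C" if "c \<in> C" for z c
  proof (rule hmod_preserved[OF nondegenerate_adj_total[OF B] _ that])
    fix x c d assume "x \<in> {blinfun_apply (adj b) x |b x. b \<in> B}" and c: "c \<in> C" and d: "d \<in> C"
    then obtain b y where b: "b \<in> B" "x = blinfun_apply (adj b) y" by blast
    have cl: "clinear b" "clinear c" using b c by (auto intro: nondegenerate_clinear[OF B] cstar_clinear[OF C])
    have "adj T o\<^sub>L (ket x o\<^sub>L (c o\<^sub>L d)) = adj ((b \<otimes>\<^sub>o adj c) o\<^sub>L T) o\<^sub>L (ket y o\<^sub>L d)"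
      by (rule blinfun_eqI) (simp add: b(2) cl adj_compose adj_op_tensor mult_clinear[OF T])
    then show "adj T o\<^sub>L (ket x o\<^sub>L (c o\<^sub>L d)) \<in> hmod C"
      using hops_hmod[OF C hops_adj[OF C] ket_comp_hmod[OF d]]
        mult_right[OF T spatial_elementary[OF b(1) cstar_adj[OF C c]]] spatial_subset_hops
      by auto
  qed
qed

end

text \<open>A norm bound with any constant gives the continuity in the description. For uniqueness,
  the difference of two candidates vanishes on elementary tensors, hence on their closed
  span.\<close>

lemma mor_tensor_eqI:
  assumes ext: "h \<in> extensional (A \<otimes>\<^sub>C B)"
    and bd: "\<And>X. X \<in> A \<otimes>\<^sub>C B \<Longrightarrow> norm (h X) \<le> K * norm X"
    and add: "\<And>X Y. X \<in> A \<otimes>\<^sub>C B \<Longrightarrow> Y \<in> A \<otimes>\<^sub>C B \<Longrightarrow> h (X + Y) = h X + h Y"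
    and cscale: "\<And>c X. X \<in> A \<otimes>\<^sub>C B \<Longrightarrow> h (cscale c X) = cscale c (h X)"
    and gen: "\<And>a b. a \<in> A \<Longrightarrow> b \<in> B \<Longrightarrow> h (a \<otimes>\<^sub>o b) = \<phi> a \<otimes>\<^sub>o \<psi> b"
  shows "mor_tensor A B \<phi> \<psi> = h"
  unfolding mor_tensor_def
proof (rule the_equality)
  have scale: "h (r *\<^sub>R X) = r *\<^sub>R h X" if "X \<in> A \<otimes>\<^sub>C B" for r X
    using cscale[OF that, of "complex_of_real r"] by (simp add: cscale_of_real)
  have cont: "continuous_on (A \<otimes>\<^sub>C B) h"
    by (rule partial_linear_continuous_on[OF subspace_spatial add scale bd])
  then show "h \<in> extensional (A \<otimes>\<^sub>C B) \<and> continuous_on (A \<otimes>\<^sub>C B) h \<and>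
    (\<forall>X\<in>A \<otimes>\<^sub>C B. \<forall>Y\<in>A \<otimes>\<^sub>C B. h (X + Y) = h X + h Y) \<and>
    (\<forall>c. \<forall>X\<in>A \<otimes>\<^sub>C B. h (cscale c X) = cscale c (h X)) \<and>
    (\<forall>a\<in>A. \<forall>b\<in>B. h (a \<otimes>\<^sub>o b) = \<phi> a \<otimes>\<^sub>o \<psi> b)"
    using assms by blast
  fix g assume g: "g \<in> extensional (A \<otimes>\<^sub>C B) \<and> continuous_on (A \<otimes>\<^sub>C B) g \<and>
    (\<forall>X\<in>A \<otimes>\<^sub>C B. \<forall>Y\<in>A \<otimes>\<^sub>C B. g (X + Y) = g X + g Y) \<and>
    (\<forall>c. \<forall>X\<in>A \<otimes>\<^sub>C B. g (cscale c X) = cscale c (g X)) \<and>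
    (\<forall>a\<in>A. \<forall>b\<in>B. g (a \<otimes>\<^sub>o b) = \<phi> a \<otimes>\<^sub>o \<psi> b)"
  have gscale: "g (r *\<^sub>R X) = r *\<^sub>R g X" if "X \<in> A \<otimes>\<^sub>C B" for r X
    using that g cscale_of_real by metis
  have "g X - h X \<in> {0}" if "X \<in> A \<otimes>\<^sub>C B" for X
  proof (rule clspan_partial_linear[where f = "\<lambda>X. g X - h X", OF subspace_spatial closed_spatial])
    show "X \<in> clspan {a \<otimes>\<^sub>o b |a b. a \<in> A \<and> b \<in> B}" using that by (simp add: spatial_def)
    show "continuous_on (A \<otimes>\<^sub>C B) (\<lambda>X. g X - h X)" using g cont by (intro continuous_on_diff) auto
  qed (use g in \<open>auto simp: add scale gscale gen scaleR_diff_right intro: spatial_elementary\<close>)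
  then show "g = h" using g ext by (intro extensionalityI[of g "A \<otimes>\<^sub>C B" h]) auto
qed

section \<open>The map \<open>id \<otimes> \<phi>\<close> on spatial tensor products and their
  multipliers\<close>

context
  fixes B :: "'h::chilbert_space op set" and C :: "'k::chilbert_space op set" and D :: "'l::chilbert_space op set" and \<phi>
  assumes B: "nondegenerate B" and C: "cstar_alg C" and D: "cstar_alg D" and \<phi>: "\<phi> \<in> cstar_mor C D"
begin

lemma mor_tensor_id_left: "mor_tensor B C (\<lambda>x. x) \<phi> = restrict (amp C \<phi>) (B \<otimes>\<^sub>C C)"
proof (rule mor_tensor_eqI[where K = 1])
  have hops: "X \<in> hops C" if "X \<in> B \<otimes>\<^sub>C C" for X using spatial_subset_hops[OF B C] that by blast
  show "norm (restrict (amp C \<phi>) (B \<otimes>\<^sub>C C) X) \<le> 1 * norm X" if "X \<in> B \<otimes>\<^sub>C C" for X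
    using that by (simp add: norm_amp_le[OF C D \<phi> hops])
  show "restrict (amp C \<phi>) (B \<otimes>\<^sub>C C) (X + Y) = restrict (amp C \<phi>) (B \<otimes>\<^sub>C C) X + restrict (amp C \<phi>) (B \<otimes>\<^sub>C C) Y"
    if "X \<in> B \<otimes>\<^sub>C C" "Y \<in> B \<otimes>\<^sub>C C" for X Y
    using that by (simp add: amp_add[OF C D \<phi>] hops subspace_add[OF subspace_spatial])
  show "restrict (amp C \<phi>) (B \<otimes>\<^sub>C C) (cscale c X) = cscale c (restrict (amp C \<phi>) (B \<otimes>\<^sub>C C) X)"
    if "X \<in> B \<otimes>\<^sub>C C" for c X
    using that by (simp add: amp_cscale[OF C D \<phi>] hops spatial_cscale[OF B C])
  show "restrict (amp C \<phi>) (B \<otimes>\<^sub>C C) (a \<otimes>\<^sub>o c) = a \<otimes>\<^sub>o \<phi> c" if "a \<in> B" "c \<in> C" for a c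
    using that by (simp add: spatial_elementary amp_op_tensor_alg[OF C D \<phi>] nondegenerate_clinear[OF B])
qed simp

lemma amp_spatial_total: "clspan {blinfun_apply (amp C \<phi> X) \<xi> |X \<xi>. X \<in> B \<otimes>\<^sub>C C} = UNIV"
proof (rule total_closed_subset[OF _ clspan_tensors_total[OF nondegenerate_total[OF B] mor_total[OF D \<phi>]]])
  fix \<xi> assume "\<xi> \<in> {x \<otimes>\<^sub>h y |x y. x \<in> {blinfun_apply b x |b x. b \<in> B} \<and> y \<in> {blinfun_apply (\<phi> a) x |a x. a \<in> C}}"
  then obtain b x c y where bc: "b \<in> B" "c \<in> C" "\<xi> = blinfun_apply b x \<otimes>\<^sub>h blinfun_apply (\<phi> c) y" by blast
  then have "\<xi> = blinfun_apply (amp C \<phi> (b \<otimes>\<^sub>o c)) (x \<otimes>\<^sub>h y)"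
    by (simp add: amp_op_tensor_alg[OF C D \<phi>] nondegenerate_clinear[OF B] mor_clinear[OF \<phi>])
  then show "\<xi> \<in> {blinfun_apply (amp C \<phi> X) \<xi> |X \<xi>. X \<in> B \<otimes>\<^sub>C C}" using spatial_elementary bc(1,2) by blast
qed

text \<open>Both definite descriptions in the extension of \<open>id \<otimes> \<phi>\<close> to
  multipliers are resolved here: \<open>amp C \<phi>\<close> is multiplicative, and its values on
  \<open>B \<otimes>\<^sub>C C\<close> have total range.\<close>

lemma mor_ext_mor_tensor_id_left:
  assumes U: "U \<in> multipliers (B \<otimes>\<^sub>C C)"
  shows "mor_ext (B \<otimes>\<^sub>C C) (mor_tensor B C (\<lambda>x. x) \<phi>) U = amp C \<phi> U"
proof (rule mor_ext_eqI)
  have "{blinfun_apply (mor_tensor B C (\<lambda>x. x) \<phi> X) \<xi> |X \<xi>. X \<in> B \<otimes>\<^sub>C C}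
      = {blinfun_apply (amp C \<phi> X) \<xi> |X \<xi>. X \<in> B \<otimes>\<^sub>C C}"
    unfolding mor_tensor_id_left by (rule Collect_cong) (metis restrict_apply')
  then show "clspan {blinfun_apply (mor_tensor B C (\<lambda>x. x) \<phi> X) \<xi> |X \<xi>. X \<in> B \<otimes>\<^sub>C C} = UNIV"
    by (simp only: amp_spatial_total)
  fix X assume X: "X \<in> B \<otimes>\<^sub>C C"
  then have "X \<in> hops C" "U \<in> hops C"
    using spatial_subset_hops[OF B C] multipliers_spatial_subset_hops[OF B C U] by auto
  then show "amp C \<phi> U o\<^sub>L mor_tensor B C (\<lambda>x. x) \<phi> X = mor_tensor B C (\<lambda>x. x) \<phi> (U o\<^sub>L X)"
    unfolding mor_tensor_id_left using X mult_left[OF U X] by (simp add: amp_comp[OF C D \<phi>])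
qed

text \<open>As \<open>\<phi> c o\<^sub>L d\<close> is total in \<open>D\<close>, it suffices to
  treat \<open>b \<otimes> (\<phi> c d)\<close>, which \<open>amp C \<phi> U\<close> sends to
  \<open>amp C \<phi> (U (b \<otimes> c)) (1 \<otimes> d)\<close>. Since
  \<open>U (b \<otimes> c)\<close> is in \<open>B \<otimes>\<^sub>C C\<close>, it can be
  approximated by combinations of elementary tensors, for which the claim is a computation.\<close>

lemma amp_mult_left:
  assumes U: "U \<in> hops C" "\<And>X. X \<in> B \<otimes>\<^sub>C C \<Longrightarrow> U o\<^sub>L X \<in> B \<otimes>\<^sub>C C" and Y: "Y \<in> B \<otimes>\<^sub>C D"
  shows "amp C \<phi> U o\<^sub>L Y \<in> B \<otimes>\<^sub>C D"
proof (rule spatial_induct[OF Y bounded_linear_comp_right _ subspace_spatial closed_spatial])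
  note sub = spatial_subset_hops[OF B C]
  fix b d assume b: "b \<in> B" and d: "d \<in> D"
  have clb: "clinear b" using b by (rule nondegenerate_clinear[OF B])
  have "b \<otimes>\<^sub>o d \<in> {Y. amp C \<phi> U o\<^sub>L Y \<in> B \<otimes>\<^sub>C D}"
  proof (rule op_tensor_left_clspan[OF _ clb])
    show "d \<in> clspan {\<phi> c o\<^sub>L d |c d. c \<in> C \<and> d \<in> D}" using d mor_dense[OF \<phi>] by blast
    fix e assume "e \<in> {\<phi> c o\<^sub>L d |c d. c \<in> C \<and> d \<in> D}"
    then obtain c d where e: "e = \<phi> c o\<^sub>L d" "c \<in> C" "d \<in> D" by blast
    have cl: "clinear (\<phi> c)" "clinear d" using e by (auto intro: mor_clinear[OF \<phi>] cstar_clinear[OF D])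
    show "clinear e" using cl e by simp
    have bc: "b \<otimes>\<^sub>o c \<in> B \<otimes>\<^sub>C C" using b e by (simp add: spatial_elementary)
    have "amp C \<phi> (U o\<^sub>L (b \<otimes>\<^sub>o c)) o\<^sub>L (id_blinfun \<otimes>\<^sub>o d) \<in> B \<otimes>\<^sub>C D"
    proof (rule clspan_partial_linear[where f = "\<lambda>X. amp C \<phi> X o\<^sub>L (id_blinfun \<otimes>\<^sub>o d)",
          OF subspace_hops[OF C] closed_hops[OF C]])
      show "U o\<^sub>L (b \<otimes>\<^sub>o c) \<in> clspan {b \<otimes>\<^sub>o c |b c. b \<in> B \<and> c \<in> C}" using U(2)[OF bc] by (simp add: spatial_def)
      show "continuous_on (hops C) (\<lambda>X. amp C \<phi> X o\<^sub>L (id_blinfun \<otimes>\<^sub>o d))"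
        by (rule bounded_linear.continuous_on[OF bounded_linear_comp_left amp_continuous_on[OF C D \<phi>]])
      fix Y assume "Y \<in> {b \<otimes>\<^sub>o c |b c. b \<in> B \<and> c \<in> C}"
      then obtain b c where bc: "Y = b \<otimes>\<^sub>o c" "b \<in> B" "c \<in> C" by blast
      then show "amp C \<phi> Y o\<^sub>L (id_blinfun \<otimes>\<^sub>o d) \<in> B \<otimes>\<^sub>C D"
        by (simp add: amp_op_tensor_alg[OF C D \<phi>] nondegenerate_clinear[OF B] mor_clinear[OF \<phi>] op_tensor_compose cl
            spatial_elementary mult_left[OF mor_mult[OF \<phi>]] e)
    qed (auto simp: amp_add[OF C D \<phi>] amp_scaleR[OF C D \<phi>] comp_add_left comp_scaleR_left
        subspace_spatial closed_spatial intro: subsetD[OF sub spatial_elementary])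
    moreover have "b \<otimes>\<^sub>o c \<in> hops C" using sub bc by blast
    then have "amp C \<phi> U o\<^sub>L (b \<otimes>\<^sub>o e) = amp C \<phi> (U o\<^sub>L (b \<otimes>\<^sub>o c)) o\<^sub>L (id_blinfun \<otimes>\<^sub>o d)"
      by (simp add: amp_comp[OF C D \<phi> U(1)] amp_op_tensor_alg[OF C D \<phi> clb e(2)] comp_assoc
          op_tensor_compose clb cl e(1))
    ultimately show "b \<otimes>\<^sub>o e \<in> {Y. amp C \<phi> U o\<^sub>L Y \<in> B \<otimes>\<^sub>C D}" by simp
  qed (intro subspace_linear_vimage closed_linear_vimage bounded_linear_comp_right subspace_spatial closed_spatial)+
  then show "amp C \<phi> U o\<^sub>L (b \<otimes>\<^sub>o d) \<in> B \<otimes>\<^sub>C D" by simp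
qed

end

text \<open>Right multiplication is turned into left multiplication by taking adjoints, which replaces \<open>B\<close> by
  \<open>adj ` B\<close>.\<close>

lemma amp_multipliers:
  assumes B: "nondegenerate B" and C: "cstar_alg C" and D: "cstar_alg D" and \<phi>: "\<phi> \<in> cstar_mor C D"
    and U: "U \<in> multipliers (B \<otimes>\<^sub>C C)"
  shows "amp C \<phi> U \<in> multipliers (B \<otimes>\<^sub>C D)"
proof (rule multipliersI)
  have hU: "U \<in> hops C" by (rule multipliers_spatial_subset_hops[OF B C U])
  have clU: "clinear U" "clinear (amp C \<phi> U)" using hU by (auto intro: hops_clinear[OF C] clinear_amp[OF C D \<phi>])
  then show "clinear (amp C \<phi> U)" by simp
  show "amp C \<phi> U o\<^sub>L Y \<in> B \<otimes>\<^sub>C D" if "Y \<in> B \<otimes>\<^sub>C D" for Y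
    by (rule amp_mult_left[OF B C D \<phi> hU mult_left[OF U] that])
  have adjB: "nondegenerate (adj ` B)" by (rule nondegenerate_adj[OF B])
  have BB: "adj ` adj ` B = B" using nondegenerate_clinear[OF B] by (force simp: image_image)
  note adj_B = adj_spatial[OF B] and adj_adjB = adj_spatial[OF adjB, unfolded BB]
  show "Y o\<^sub>L amp C \<phi> U \<in> B \<otimes>\<^sub>C D" if Y: "Y \<in> B \<otimes>\<^sub>C D" for Y
  proof -
    have "adj U o\<^sub>L X \<in> adj ` B \<otimes>\<^sub>C C" if X: "X \<in> adj ` B \<otimes>\<^sub>C C" for X
      using adj_B(2)[OF C mult_right[OF U adj_adjB(2)[OF C X]]] adj_adjB(1)[OF C X] by (simp add: adj_compose clU)
    from amp_mult_left[OF adjB C D \<phi> hops_adj[OF C hU] this adj_B(2)[OF D Y]]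
    have "adj (amp C \<phi> (adj U) o\<^sub>L adj Y) \<in> B \<otimes>\<^sub>C D" by (rule adj_adjB(2)[OF D])
    then show ?thesis
      using adj_B(1)[OF D Y] by (simp add: adj_compose amp_adj[OF C D \<phi> hU] clU)
  qed
qed

section \<open>The dual and its corepresentations\<close>

text \<open>A normal functional is a sum of vector functionals, and the corresponding slices
  \<open>S n\<close> are summable in norm. The complex linearity of their sum is what the elements
  of \<open>dual W\<close> inherit.\<close>

lemma slice_right_exists:
  fixes X :: "('a::chilbert_space, 'b::chilbert_space) htensor op"
  assumes \<omega>: "\<omega> \<in> normal_functionals" and X: "clinear X"
  shows "\<exists>S. clinear S \<and> (\<forall>u v. cinner u (blinfun_apply S v) = \<omega> (slice u X v))"
proof -
  obtain x y :: "nat \<Rightarrow> 'b" where xy: "summable (\<lambda>n. (norm (x n))\<^sup>2)" "summable (\<lambda>n. (norm (y n))\<^sup>2)"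
    and w: "\<omega> = (\<lambda>T. \<Sum>n. cinner (x n) (blinfun_apply T (y n)))"
    using \<omega> unfolding normal_functionals_def by blast
  define S where "S n = adj (rket (x n)) o\<^sub>L X o\<^sub>L rket (y n)" for n
  have cS: "cinner u (blinfun_apply (S n) v) = cinner (x n) (blinfun_apply (slice u X v) (y n))" for u v n
    by (simp add: S_def cinner_adj_right cinner_slice)
  have "norm (S n) \<le> norm X * ((norm (x n))\<^sup>2 + (norm (y n))\<^sup>2)" for n
  proof -
    have "norm (S n) \<le> norm (adj (rket (x n) :: 'a \<Rightarrow>\<^sub>L ('a, 'b) htensor)) * norm X * norm (rket (y n) :: 'a \<Rightarrow>\<^sub>L ('a, 'b) htensor)"
      unfolding S_def by (meson norm_blinfun_compose mult_right_mono norm_ge_zero order_trans)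
    also have "\<dots> \<le> norm (x n) * norm X * norm (y n)"
      by (simp add: norm_adj mult_mono norm_rket_le)
    also have "\<dots> = norm X * (norm (x n) * norm (y n))" by simp
    also have "\<dots> \<le> norm X * ((norm (x n))\<^sup>2 + (norm (y n))\<^sup>2)"
    proof (intro mult_left_mono norm_ge_zero)
      have "0 \<le> norm (x n) * norm (y n)" by simp
      then show "norm (x n) * norm (y n) \<le> (norm (x n))\<^sup>2 + (norm (y n))\<^sup>2"
        using sum_squares_bound[of "norm (x n)" "norm (y n)"] by linarith
    qed
    finally show ?thesis .
  qed
  then have sumS: "summable S"
    by (intro summable_norm_cancel[OF summable_comparison_test'[OF summable_mult[OF summable_add[OF xy]]]]) simp
  have bl: "bounded_linear (\<lambda>T. cinner u (blinfun_apply T v))" for u :: 'a and v :: 'a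
    by (rule bounded_linear_compose[OF bounded_linear_cinner_right blinfun.bounded_linear_left])
  have eq: "cinner u (blinfun_apply (suminf S) v) = \<omega> (slice u X v)" for u v
    unfolding w bounded_linear.suminf[OF bl sumS] cS ..
  have "clinear (suminf S)"
    unfolding clinear_def
  proof (intro allI cinner_eqI)
    fix c v u
    have "clinear (S n)" for n unfolding S_def using X by simp
    then have "cinner u (blinfun_apply (S n) (c *\<^sub>C v)) = c * cinner u (blinfun_apply (S n) v)" for n
      by (simp add: clinearD cinner_scaleC_right)
    then show "cinner u (blinfun_apply (suminf S) (c *\<^sub>C v)) = cinner u (c *\<^sub>C blinfun_apply (suminf S) v)"
      unfolding cinner_scaleC_right bounded_linear.suminf[OF bl sumS]
      by (simp add: suminf_mult bounded_linear.summable[OF bl sumS])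
  qed
  with eq show ?thesis by blast
qed

lemma slice_right_eqI:
  assumes "\<And>u v. cinner u (blinfun_apply S v) = \<omega> (slice u X v)" shows "slice_right \<omega> X = S"
  unfolding slice_right_def
  by (rule the_equality) (auto simp: assms[unfolded slice_def ket_def] intro: blinfun_eqI_cinner)

lemma clinear_slice_right:
  assumes "\<omega> \<in> normal_functionals" "clinear X" shows "clinear (slice_right \<omega> X)"
  using slice_right_exists[OF assms] slice_right_eqI by metis

lemma vector_functional_normal: "(\<lambda>T. cinner x (blinfun_apply T y)) \<in> normal_functionals"
  unfolding normal_functionals_def
proof (intro CollectI exI conjI)
  let ?x = "\<lambda>n :: nat. if n = 0 then x else 0" and ?y = "\<lambda>n :: nat. if n = 0 then y else 0"
  show "summable (\<lambda>n. (norm (?x n))\<^sup>2)" "summable (\<lambda>n. (norm (?y n))\<^sup>2)"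
    by (rule summable_finite[of "{0}"]; simp)+
  show "(\<lambda>T. cinner x (blinfun_apply T y)) = (\<lambda>T. \<Sum>n. cinner (?x n) (blinfun_apply T (?y n)))"
    by (rule ext, subst suminf_finite[of "{0}"]) auto
qed

lemma slice_right_vector_functional:
  "slice_right (\<lambda>T. cinner x (blinfun_apply T y)) X = adj (rket x) o\<^sub>L X o\<^sub>L rket y"
  by (rule slice_right_eqI) (simp add: cinner_adj_right cinner_slice)

lemma clspan_surj_image:
  assumes "clspan S = UNIV" "surj (blinfun_apply T)" shows "clspan (blinfun_apply T ` S) = UNIV"
proof -
  have "blinfun_apply T x \<in> clspan (blinfun_apply T ` S)" for x
    by (rule clspan_image[OF blinfun.bounded_linear_right, of S]) (use assms(1) in \<open>auto intro: clspan_base\<close>)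
  then show ?thesis using assms(2) by (metis UNIV_eq_I surjD)
qed

lemma slices_total:
  fixes U :: "('a::chilbert_space, 'b::chilbert_space) htensor \<Rightarrow>\<^sub>L ('a, 'a) htensor"
  assumes "surj (blinfun_apply U)"
  shows "clspan {blinfun_apply (adj (rket x)) (blinfun_apply U (v \<otimes>\<^sub>h y)) |x v y. True} = UNIV" (is "?P = _")
proof -
  have U: "clspan (blinfun_apply U ` range (\<lambda>(x, y). x \<otimes>\<^sub>h y)) = UNIV"
    by (rule clspan_surj_image[OF clspan_tensors assms])
  have "z \<in> ?P" for z
  proof (cases "z = 0")
    case False
    \<comment> \<open>Any unit vector would do; normalising \<open>z\<close> provides one, and
      \<open>z \<noteq> 0\<close> guarantees that the space has one.\<close>
    define e where "e = (1 / norm z) *\<^sub>R z"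
    have "cinner e e = 1" using False by (simp add: e_def cinner_self_norm)
    then have "z = blinfun_apply (adj (rket e)) (z \<otimes>\<^sub>h e)" by simp
    moreover have "blinfun_apply (adj (rket e)) (z \<otimes>\<^sub>h e) \<in> ?P"
      by (rule clspan_image[OF blinfun.bounded_linear_right, of "blinfun_apply U ` range (\<lambda>(x, y). x \<otimes>\<^sub>h y)"])
        (auto simp: U intro!: clspan_base)
    ultimately show ?thesis by simp
  qed (simp add: subspace_0[OF subspace_clspan])
  then show ?thesis by blast
qed

lemma comp_id_apply:
  assumes "S o\<^sub>L T = id_blinfun" shows "blinfun_apply S (blinfun_apply T x) = x"
proof -
  have "blinfun_apply (S o\<^sub>L T) x = x" unfolding assms by simp
  then show ?thesis by simp
qed

lemma comp_id_surj: "S o\<^sub>L T = id_blinfun \<Longrightarrow> surj (blinfun_apply S)"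
  by (rule surjI[where f = "blinfun_apply T"]) (rule comp_id_apply)

lemma unitary_surj: assumes "unitary U" shows "surj (blinfun_apply U)" "surj (blinfun_apply (adj U))"
  using assms comp_id_surj unfolding unitary_def by blast+

lemma unitary_clinear: "unitary U \<Longrightarrow> clinear U"
  by (simp add: unitary_def)

text \<open>Slices of \<open>adj W\<close> by vector functionals already have total range because
  \<open>adj W\<close> is surjective. Their adjoints are slices of \<open>W\<close>, which is
  surjective too.\<close>

lemma dual_nondegenerate:
  assumes W: "unitary W" shows "nondegenerate (dual W)"
proof -
  have cl: "clinear W" by (rule unitary_clinear[OF W])
  have "dual W \<subseteq> {T. clinear T}"
    unfolding dual_def by (rule closure_minimal[OF _ closed_clinear]) (auto intro: clinear_slice_right simp: cl)
  moreover have b: "adj (rket x) o\<^sub>L adj W o\<^sub>L rket y \<in> dual W" for x y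
    unfolding dual_def slice_right_vector_functional[symmetric]
    by (rule subsetD[OF closure_subset], rule CollectI, rule exI, rule conjI[OF refl vector_functional_normal])
  have "clspan {blinfun_apply b v |b v. b \<in> dual W} = UNIV"
  proof (rule total_closed_subset[OF _ slices_total[OF unitary_surj(2)[OF W]]])
    fix z assume "z \<in> {blinfun_apply (adj (rket x)) (blinfun_apply (adj W) (v \<otimes>\<^sub>h y)) |x v y. True}"
    then obtain x v y where "z = blinfun_apply (adj (rket x) o\<^sub>L adj W o\<^sub>L rket y) v" by auto
    then show "z \<in> {blinfun_apply b v |b v. b \<in> dual W}" using b by blast
  qed
  moreover have "clspan {blinfun_apply (adj b) v |b v. b \<in> dual W} = UNIV"
  proof (rule total_closed_subset[OF _ slices_total[OF unitary_surj(1)[OF W]]])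
    fix z assume "z \<in> {blinfun_apply (adj (rket x)) (blinfun_apply W (v \<otimes>\<^sub>h y)) |x v y. True}"
    then obtain x v y where "z = blinfun_apply (adj (rket x)) (blinfun_apply W (v \<otimes>\<^sub>h y))" by auto
    then have "z = blinfun_apply (adj (adj (rket y) o\<^sub>L adj W o\<^sub>L rket x)) v"
      by (simp add: adj_compose cl)
    then show "z \<in> {blinfun_apply (adj b) v |b v. b \<in> dual W}" using b by blast
  qed
  ultimately show ?thesis by (auto simp: nondegenerate_def)
qed

lemma id_mor_eq_amp:
  assumes "unitary W" "cstar_alg C" "cstar_alg D" "\<phi> \<in> cstar_mor C D" "U \<in> multipliers (dual W \<otimes>\<^sub>C C)"
  shows "id_mor W C \<phi> U = amp C \<phi> U"
  unfolding id_mor_def by (rule mor_ext_mor_tensor_id_left[OF dual_nondegenerate[OF assms(1)] assms(2-)])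

section \<open>Legs and the dual comultiplication on
  \<open>(H \<otimes> H) \<otimes> K\<close>\<close>

text \<open>The operator \<open>leg23 X\<close> on \<open>(H \<otimes> H) \<otimes> K\<close>.\<close>

definition lift23 :: "('b::chilbert_space, 'c::chilbert_space) htensor op
    \<Rightarrow> (('a::chilbert_space, 'b) htensor, 'c) htensor op"
  where "lift23 X = adj assoc o\<^sub>L (id_blinfun \<otimes>\<^sub>o X) o\<^sub>L assoc"

lemma clinear_lift23 [simp]: "clinear X \<Longrightarrow> clinear (lift23 X)"
  by (simp add: lift23_def)

lemma lift23_op_tensor: "clinear S \<Longrightarrow> clinear T \<Longrightarrow> lift23 (S \<otimes>\<^sub>o T) = (id_blinfun \<otimes>\<^sub>o S) \<otimes>\<^sub>o T"
  by (rule blinfun_eqI_tensor3) (simp add: lift23_def)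

lemma comp_cancel: "S o\<^sub>L T = id_blinfun \<Longrightarrow> S o\<^sub>L (T o\<^sub>L R) = R"
  by (simp flip: comp_assoc)

lemma assoc_assoc_cancel: "assoc o\<^sub>L (adj assoc o\<^sub>L X) = X" "adj assoc o\<^sub>L (assoc o\<^sub>L Y) = Y"
  by (simp_all flip: comp_assoc)

lemma lift23_comp: "clinear X \<Longrightarrow> clinear Y \<Longrightarrow> lift23 (X o\<^sub>L Y) = lift23 X o\<^sub>L lift23 Y"
  by (simp add: lift23_def comp_assoc assoc_assoc_cancel op_tensor_compose flip: comp_assoc[of "id_blinfun \<otimes>\<^sub>o X"])

lemma lift23_add: "clinear X \<Longrightarrow> clinear Y \<Longrightarrow> lift23 (X + Y) = lift23 X + lift23 Y"
  by (simp add: lift23_def op_tensor_add_right comp_add_left comp_add_right)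

lemma lift23_cscale: "clinear X \<Longrightarrow> lift23 (cscale c X) = cscale c (lift23 X)"
  by (simp add: lift23_def op_tensor_cscale_right cscale_comp_left cscale_comp_right)

lemma norm_lift23_le:
  fixes X :: "('b::chilbert_space, 'c::chilbert_space) htensor op"
  assumes "clinear X"
  shows "norm (lift23 X :: (('a::chilbert_space, 'b) htensor, 'c) htensor op) \<le> norm X"
proof -
  have "norm (id_blinfun :: 'a op) \<le> 1" by (rule norm_isometry_le) simp_all
  from mult_right_mono[OF this norm_ge_zero[of X]] have "norm ((id_blinfun :: 'a op) \<otimes>\<^sub>o X) \<le> norm X"
    using norm_op_tensor_le[OF clinear_id[where 'a = 'a] assms] by simp
  then show ?thesis
    unfolding lift23_def by (intro order_trans[OF norm_conj_le] norm_isometry_le) simp_all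
qed

lemma reassoc_lift23: "reassoc (lift23 X) = leg23 X"
  by (simp add: reassoc_def lift23_def leg23_def comp_assoc assoc_assoc_cancel)

lemma reassoc_comp: "reassoc (X o\<^sub>L Y) = reassoc X o\<^sub>L reassoc Y"
  by (simp add: reassoc_def comp_assoc assoc_assoc_cancel)

lemma reassoc_inject: "reassoc X = reassoc Y \<longleftrightarrow> X = Y"
proof
  assume "reassoc X = reassoc Y"
  then have "adj assoc o\<^sub>L reassoc X o\<^sub>L assoc = adj assoc o\<^sub>L reassoc Y o\<^sub>L assoc" by simp
  then show "X = Y" by (simp add: reassoc_def comp_assoc assoc_assoc_cancel)
qed simp

lemma leg12_apply:
  "clinear X \<Longrightarrow> blinfun_apply (leg12 X) (x \<otimes>\<^sub>h (y \<otimes>\<^sub>h z)) = blinfun_apply assoc (blinfun_apply X (x \<otimes>\<^sub>h y) \<otimes>\<^sub>h z)"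
  by (simp add: leg12_def reassoc_def)

text \<open>\<open>leg13\<close> is defined by exchanging the last two legs, which would move the
  algebra out of the last place. Exchanging the first two legs of \<open>leg23\<close> gives the
  same operator, and that flip is of the form \<open>S \<otimes>\<^sub>o id_blinfun\<close>, a
  constant for \<open>amp\<close>.\<close>

lemma leg13_lift23:
  fixes X :: "('a::chilbert_space, 'c::chilbert_space) htensor op"
  assumes X: "clinear X"
  shows "leg13 X = reassoc ((flip \<otimes>\<^sub>o id_blinfun) o\<^sub>L lift23 X o\<^sub>L (flip \<otimes>\<^sub>o id_blinfun) :: (('a, 'b::chilbert_space) htensor, 'c) htensor op)"
proof (rule blinfun_eqI_tensor3')
  fix x :: 'a and y :: 'b and z :: 'c
  have 1: "(id_blinfun \<otimes>\<^sub>o flip) o\<^sub>L assoc o\<^sub>L rket y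
      = assoc o\<^sub>L (flip \<otimes>\<^sub>o id_blinfun) o\<^sub>L adj assoc o\<^sub>L (ket y :: ('a, 'c) htensor \<Rightarrow>\<^sub>L _)"
    by (rule blinfun_eqI_tensor) simp
  show "blinfun_apply (leg13 X) (x \<otimes>\<^sub>h (y \<otimes>\<^sub>h z)) = blinfun_apply (reassoc ((flip \<otimes>\<^sub>o id_blinfun) o\<^sub>L lift23 X o\<^sub>L (flip \<otimes>\<^sub>o id_blinfun))) (x \<otimes>\<^sub>h (y \<otimes>\<^sub>h z))"
    using arg_cong[OF 1, of "\<lambda>R. blinfun_apply R (blinfun_apply X (x \<otimes>\<^sub>h z))"]
    by (simp add: leg13_def leg12_apply X reassoc_def lift23_def)
qed

lemma slice_lift23:
  assumes X: "clinear X"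
  shows "slice (x \<otimes>\<^sub>h y) (lift23 X) (z \<otimes>\<^sub>h w) = cscale (cinner x z) (slice y X w)"
proof (rule blinfun_eqI_cinner)
  fix p q
  have "cinner q (blinfun_apply (slice (x \<otimes>\<^sub>h y) (lift23 X) (z \<otimes>\<^sub>h w)) p)
      = cinner (x \<otimes>\<^sub>h (y \<otimes>\<^sub>h q)) (z \<otimes>\<^sub>h blinfun_apply X (w \<otimes>\<^sub>h p))"
    by (simp add: cinner_slice lift23_def X cinner_adj_right)
  then show "cinner q (blinfun_apply (slice (x \<otimes>\<^sub>h y) (lift23 X) (z \<otimes>\<^sub>h w)) p)
      = cinner q (blinfun_apply (cscale (cinner x z) (slice y X w)) p)"
    by (simp add: cinner_tensor cinner_slice cscale_apply cinner_scaleC_right)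
qed

text \<open>Putting a fixed vector \<open>x\<close> in front and rebracketing carries the module
  over \<open>H\<close> into the module over \<open>G \<otimes> H\<close>, and there
  \<open>lift23 X\<close> acts as \<open>X\<close>.\<close>

lemma lift23_hops:
  fixes X :: "('h::chilbert_space, 'k::chilbert_space) htensor op"
  assumes C: "cstar_alg C" and X: "X \<in> hops C"
  shows "(lift23 X :: (('g::chilbert_space, 'h) htensor, 'k) htensor op) \<in> hops C"
proof -
  have *: "lift23 X o\<^sub>L (ket u o\<^sub>L c) \<in> hmod C" if X: "X \<in> hops C" and c: "c \<in> C"
    for X :: "('h, 'k) htensor op" and u :: "('g, 'h) htensor" and c
  proof (rule clspan_subset_vimage[of "\<lambda>u. lift23 X o\<^sub>L (ket u o\<^sub>L c)" "range (\<lambda>(x, y). x \<otimes>\<^sub>h y)"])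
    show "bounded_linear (\<lambda>u :: ('g, 'h) htensor. lift23 X o\<^sub>L (ket u o\<^sub>L c))"
      by (intro bounded_linear_compose[OF bounded_linear_comp_right]
          bounded_linear_compose[OF bounded_linear_comp_left] bounded_linear_ket)
    fix u :: "('g, 'h) htensor" assume "u \<in> range (\<lambda>(x, y). x \<otimes>\<^sub>h y)"
    then obtain x y where u: "u = x \<otimes>\<^sub>h y" by auto
    have "adj assoc o\<^sub>L (ket x o\<^sub>L Y) \<in> (hmod C :: ('k \<Rightarrow>\<^sub>L (('g, 'h) htensor, 'k) htensor) set)" if "Y \<in> hmod C" for Y
    proof (rule hmod_induct[OF that])
      show "bounded_linear (\<lambda>Y. adj assoc o\<^sub>L (ket x o\<^sub>L Y))"
        by (intro bounded_linear_compose[OF bounded_linear_comp_right] bounded_linear_comp_right)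
      fix z :: 'h and d assume "d \<in> C"
      moreover have "adj assoc o\<^sub>L (ket x o\<^sub>L (ket z o\<^sub>L d)) = ket (x \<otimes>\<^sub>h z) o\<^sub>L d"
        by (rule blinfun_eqI) simp
      ultimately show "adj assoc o\<^sub>L (ket x o\<^sub>L (ket z o\<^sub>L d)) \<in> (hmod C :: ('k \<Rightarrow>\<^sub>L (('g, 'h) htensor, 'k) htensor) set)"
        by (simp add: ket_comp_hmod)
    qed (simp_all add: subspace_hmod closed_hmod)
    moreover have "lift23 X o\<^sub>L (ket u o\<^sub>L c) = adj assoc o\<^sub>L (ket x o\<^sub>L (X o\<^sub>L (ket y o\<^sub>L c)))"
      by (rule blinfun_eqI) (simp add: u lift23_def hops_clinear[OF C X])
    ultimately show "lift23 X o\<^sub>L (ket u o\<^sub>L c) \<in> hmod C"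
      using hops_hmod[OF C X ket_comp_hmod[OF c]] by simp
  qed (simp_all add: clspan_tensors subspace_hmod closed_hmod)
  have cl: "clinear X" by (rule hops_clinear[OF C X])
  show ?thesis
    by (rule hopsI[OF C])
      (use X *[OF X] *[OF hops_adj[OF C X]] in \<open>auto simp: cl\<close>, simp add: lift23_def adj_compose adj_op_tensor cl comp_assoc)
qed

context
  fixes C :: "'k::chilbert_space op set" and D :: "'l::chilbert_space op set" and \<phi>
  assumes C: "cstar_alg C" and D: "cstar_alg D" and \<phi>: "\<phi> \<in> cstar_mor C D"
begin

lemma amp_lift23:
  fixes X :: "('h::chilbert_space, 'k) htensor op"
  assumes X: "X \<in> hops C"
  shows "amp C \<phi> (lift23 X :: (('g::chilbert_space, 'h) htensor, 'k) htensor op) = lift23 (amp C \<phi> X)"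
proof (rule amp_eqI_total[OF C D \<phi> lift23_hops[OF C X] clspan_tensors clspan_tensors])
  fix u v :: "('g, 'h) htensor"
  assume "u \<in> range (\<lambda>(x, y). x \<otimes>\<^sub>h y)" "v \<in> range (\<lambda>(x, y). x \<otimes>\<^sub>h y)"
  then obtain x y z w where "u = x \<otimes>\<^sub>h y" "v = z \<otimes>\<^sub>h w" by auto
  then show "slice u (lift23 (amp C \<phi> X)) v = mor_ext C \<phi> (slice u (lift23 X) v)"
    by (simp add: slice_lift23 clinear_amp[OF C D \<phi> X] hops_clinear[OF C X] amp_slice[OF C D \<phi> X]
        mor_ext_cscale[OF C D \<phi>] slice_multipliers[OF C X])
qed

end

text \<open>The dual comultiplication is \<open>1 \<otimes> y\<close> conjugated by
  \<open>flip o\<^sub>L adj W\<close>, so on elementary tensors its amplification is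
  \<open>lift23\<close> conjugated by \<open>F\<close>. This formula makes sense for multipliers and
  is multiplicative there, hence it is the extension.\<close>

lemma dual_comult_id_eq:
  fixes W :: "('h::chilbert_space, 'h) htensor op" and U :: "('h, 'd::chilbert_space) htensor op"
  assumes W: "unitary W" and D: "cstar_alg D" and U: "U \<in> multipliers (dual W \<otimes>\<^sub>C D)"
  defines "F \<equiv> (flip o\<^sub>L adj W) \<otimes>\<^sub>o (id_blinfun :: 'd op)"
  shows "dual_comult_id W D U = reassoc (F o\<^sub>L lift23 U o\<^sub>L adj F)"
proof -
  let ?P = "dual W \<otimes>\<^sub>C D"
  note B = dual_nondegenerate[OF W]
  have clW: "clinear W" by (rule unitary_clinear[OF W])
  have clF: "clinear F" by (simp add: F_def clW)
  have WW: "adj W o\<^sub>L W = id_blinfun" "W o\<^sub>L adj W = id_blinfun" using W by (auto simp: unitary_def)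
  have adjF: "adj F = (W o\<^sub>L flip) \<otimes>\<^sub>o id_blinfun" by (simp add: F_def adj_op_tensor adj_compose clW)
  have *: "flip o\<^sub>L adj W o\<^sub>L (W o\<^sub>L flip) = id_blinfun" "W o\<^sub>L flip o\<^sub>L (flip o\<^sub>L adj W) = id_blinfun"
    by (simp_all add: comp_assoc[of flip] comp_assoc[of W] comp_cancel[OF WW(1)] comp_cancel[OF flip_flip] WW)
  have FF: "F o\<^sub>L adj F = id_blinfun" "adj F o\<^sub>L F = id_blinfun"
    unfolding adjF by (simp_all add: F_def clW op_tensor_compose *)
  note FF' = comp_cancel[OF FF(2)]
  define k where "k X = F o\<^sub>L lift23 X o\<^sub>L adj F" for X
  have clP: "clinear X" if "X \<in> ?P" for X
    using hops_clinear[OF D] spatial_subset_hops[OF B D] that by blast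
  have k: "mor_tensor (dual W) D (dual_comult W) (\<lambda>x. x) = restrict k ?P"
  proof (rule mor_tensor_eqI[where K = "norm F * norm F"])
    show "norm (restrict k ?P X) \<le> norm F * norm F * norm X" if X: "X \<in> ?P" for X
    proof -
      have "norm (k X) \<le> norm (F o\<^sub>L lift23 X) * norm F"
        unfolding k_def using norm_blinfun_compose[of "F o\<^sub>L lift23 X" "adj F"] by (simp add: norm_adj clF)
      also have "\<dots> \<le> norm F * norm X * norm F"
        using norm_lift23_le[OF clP[OF X]]
        by (intro mult_right_mono order_trans[OF norm_blinfun_compose] mult_left_mono) simp_all
      finally show ?thesis using X by (simp add: mult_ac)
    qed
    show "restrict k ?P (X + Y) = restrict k ?P X + restrict k ?P Y" if "X \<in> ?P" "Y \<in> ?P" for X Y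
      using that subspace_add[OF subspace_spatial that]
      by (simp add: k_def lift23_add clP comp_add_left comp_add_right)
    show "restrict k ?P (cscale c X) = cscale c (restrict k ?P X)" if "X \<in> ?P" for c X
      using that by (simp add: k_def spatial_cscale[OF B D] lift23_cscale clP cscale_comp_left cscale_comp_right clF)
    show "restrict k ?P (b \<otimes>\<^sub>o d) = dual_comult W b \<otimes>\<^sub>o d" if bd: "b \<in> dual W" "d \<in> D" for b d
    proof -
      have cl: "clinear b" "clinear d" using bd nondegenerate_clinear[OF B] cstar_clinear[OF D] by auto
      have "k (b \<otimes>\<^sub>o d) = ((flip o\<^sub>L adj W) o\<^sub>L (id_blinfun \<otimes>\<^sub>o b) o\<^sub>L (W o\<^sub>L flip)) \<otimes>\<^sub>o d"
        unfolding k_def adjF by (simp add: F_def lift23_op_tensor cl op_tensor_compose clW)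
      then show ?thesis using bd by (simp add: spatial_elementary dual_comult_def comp_assoc)
    qed
  qed simp
  have "mor_ext ?P (restrict k ?P) U = k U"
  proof (rule mor_ext_eqI)
    show "clspan {blinfun_apply (restrict k ?P X) \<xi> |X \<xi>. X \<in> ?P} = UNIV"
    proof (rule total_closed_subset)
      \<comment> \<open>Up to the surjections \<open>F\<close> and \<open>adj assoc\<close>, the
        operator \<open>k X\<close> is \<open>1 \<otimes> X\<close>, so its vectors are total
        because those of \<open>X\<close> are.\<close>
      let ?S = "{x \<otimes>\<^sub>h y |(x :: 'h) y. x \<in> UNIV \<and> y \<in> {blinfun_apply X \<xi> |X \<xi>. X \<in> ?P}}"
      have S: "clspan ?S = UNIV" by (rule clspan_tensors_total[OF _ spatial_total[OF B D]]) simp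
      have sF: "surj (blinfun_apply F)"
        by (rule comp_id_surj[OF FF(1)])
      have sA: "surj (blinfun_apply (adj assoc :: _ \<Rightarrow>\<^sub>L (('h, 'h) htensor, 'd) htensor))"
        by (rule comp_id_surj[OF adj_assoc_assoc])
      show "clspan (blinfun_apply F ` (blinfun_apply (adj assoc) ` ?S)) = UNIV"
        by (intro clspan_surj_image S sF sA)
      fix \<zeta> assume "\<zeta> \<in> blinfun_apply F ` (blinfun_apply (adj assoc) ` ?S)"
      then obtain x X \<xi> where X: "X \<in> ?P" and \<zeta>: "\<zeta> = blinfun_apply F (blinfun_apply (adj assoc) (x \<otimes>\<^sub>h blinfun_apply X \<xi>))"
        by blast
      have "\<zeta> = blinfun_apply (restrict k ?P X) (blinfun_apply F (blinfun_apply (adj assoc) (x \<otimes>\<^sub>h \<xi>)))"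
        by (simp add: X k_def lift23_def comp_id_apply[OF FF(2)] comp_id_apply[OF assoc_adj_assoc] clP \<zeta>)
      then show "\<zeta> \<in> {blinfun_apply (restrict k ?P X) \<xi> |X \<xi>. X \<in> ?P}" using X by blast
    qed
    show "k U o\<^sub>L restrict k ?P X = restrict k ?P (U o\<^sub>L X)" if X: "X \<in> ?P" for X
      using X mult_left[OF U X]
      by (simp add: k_def lift23_comp clP mult_clinear[OF U] comp_assoc FF')
  qed
  then show ?thesis by (simp add: dual_comult_id_def k k_def)
qed

text \<open>Undoing the injective \<open>reassoc\<close> leaves an equation between copies of
  \<open>lift23 V\<close> and operators \<open>S \<otimes>\<^sub>o id_blinfun\<close>;
  \<open>amp\<close> turns it into the same equation for its value at \<open>V\<close>.\<close>

lemma left_corep_amp: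
  assumes W: "unitary W" and C: "cstar_alg C" and D: "cstar_alg D" and \<phi>: "\<phi> \<in> cstar_mor C D"
    and V: "left_corep W C V"
  shows "left_corep W D (amp C \<phi> V)"
proof -
  note B = dual_nondegenerate[OF W]
  have VM: "V \<in> multipliers (dual W \<otimes>\<^sub>C C)" and Vu: "unitary V"
    and eq: "dual_comult_id W C V = leg23 V o\<^sub>L leg13 V"
    using V by (auto simp: left_corep_def unitary_multipliers_def)
  have Vh: "V \<in> hops C" by (rule multipliers_spatial_subset_hops[OF B C VM])
  let ?U = "amp C \<phi> V"
  have UM: "?U \<in> multipliers (dual W \<otimes>\<^sub>C D)" by (rule amp_multipliers[OF B C D \<phi> VM])
  have Uu: "unitary ?U" by (rule unitary_amp[OF C D \<phi> Vh Vu])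
  have clW: "clinear W" by (rule unitary_clinear[OF W])
  have clV: "clinear V" "clinear ?U" using Vu Uu by (auto intro: unitary_clinear)
  let ?F = "flip o\<^sub>L adj W"
  have "(?F \<otimes>\<^sub>o id_blinfun) o\<^sub>L lift23 V o\<^sub>L (adj ?F \<otimes>\<^sub>o id_blinfun)
      = lift23 V o\<^sub>L ((flip \<otimes>\<^sub>o id_blinfun) o\<^sub>L lift23 V o\<^sub>L (flip \<otimes>\<^sub>o id_blinfun))"
    using eq unfolding dual_comult_id_eq[OF W C VM] reassoc_lift23[symmetric] leg13_lift23[OF clV(1)]
      reassoc_comp[symmetric] reassoc_inject by (simp add: adj_op_tensor clW)
  from arg_cong[OF this, of "amp C \<phi>"]
  have "(?F \<otimes>\<^sub>o id_blinfun) o\<^sub>L lift23 ?U o\<^sub>L (adj ?F \<otimes>\<^sub>o id_blinfun)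
      = lift23 ?U o\<^sub>L ((flip \<otimes>\<^sub>o id_blinfun) o\<^sub>L lift23 ?U o\<^sub>L (flip \<otimes>\<^sub>o id_blinfun))"
    by (simp add: amp_comp[OF C D \<phi>] amp_lift23[OF C D \<phi> Vh] amp_op_tensor_id[OF C D \<phi>] clW
        lift23_hops[OF C Vh] op_tensor_hops[OF C] multipliers_id hops_comp[OF C])
  then have "dual_comult_id W D ?U = leg23 ?U o\<^sub>L leg13 ?U"
    unfolding dual_comult_id_eq[OF W D UM] reassoc_lift23[symmetric] leg13_lift23[OF clV(2)]
      reassoc_comp[symmetric] reassoc_inject by (simp add: adj_op_tensor clW)
  then show ?thesis using UM Uu by (simp add: left_corep_def unitary_multipliers_def)
qed

section \<open>Tensor products and composition of morphisms\<close>

lemmas norm_flip_conj_le = norm_conj_le[OF norm_flip_le norm_flip_le]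

lemma flip_op_tensor_flip: "clinear S \<Longrightarrow> clinear T \<Longrightarrow> flip o\<^sub>L (S \<otimes>\<^sub>o T) o\<^sub>L flip = T \<otimes>\<^sub>o S"
  by (rule blinfun_eqI_tensor) simp

lemma flip_conj_comp: "flip o\<^sub>L (S o\<^sub>L T) o\<^sub>L flip = (flip o\<^sub>L S o\<^sub>L flip) o\<^sub>L (flip o\<^sub>L T o\<^sub>L flip)"
  by (simp add: comp_assoc comp_cancel[OF flip_flip])

lemma adj_flip_conj: "clinear T \<Longrightarrow> adj (flip o\<^sub>L T o\<^sub>L flip) = flip o\<^sub>L adj T o\<^sub>L flip"
  by (simp add: adj_compose comp_assoc)

lemma cstar_alg_spatial:
  assumes A: "cstar_alg A" and B: "cstar_alg B" shows "cstar_alg (A \<otimes>\<^sub>C B)"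
proof -
  note nA = cstar_nondegenerate[OF A]
  have cl: "clinear a" "clinear b" if "a \<in> A" "b \<in> B" for a b using that A B by (auto intro: cstar_clinear)
  have "A \<otimes>\<^sub>C B \<subseteq> {T. clinear T}"
    by (rule spatial_subset[OF _ subspace_clinear closed_clinear]) (simp add: cl)
  moreover have "X o\<^sub>L Y \<in> A \<otimes>\<^sub>C B" if X: "X \<in> A \<otimes>\<^sub>C B" and Y: "Y \<in> A \<otimes>\<^sub>C B" for X Y
  proof (rule spatial_induct[OF X bounded_linear_comp_left _ subspace_spatial closed_spatial])
    fix a b assume ab: "a \<in> A" "b \<in> B"
    show "(a \<otimes>\<^sub>o b) o\<^sub>L Y \<in> A \<otimes>\<^sub>C B"
      by (rule spatial_induct[OF Y bounded_linear_comp_right _ subspace_spatial closed_spatial])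
        (simp add: op_tensor_compose ab cl spatial_elementary cstar_comp[OF A] cstar_comp[OF B])
  qed
  moreover have "adj X \<in> A \<otimes>\<^sub>C B" if "X \<in> A \<otimes>\<^sub>C B" for X
    by (rule clspan_adj(2)[OF that[unfolded spatial_def] _ _ subspace_spatial closed_spatial])
      (auto simp: cl adj_op_tensor intro!: spatial_elementary cstar_adj[OF A] cstar_adj[OF B])
  ultimately show ?thesis
    using spatial_total[OF nA B] spatial_cscale[OF nA B] subspace_spatial[of A B]
    by (auto simp: cstar_alg_def closed_spatial subspace_def)
qed

lemma op_tensor_multipliers:
  assumes A: "cstar_alg A" and B: "cstar_alg B" and m: "m \<in> multipliers A" and n: "n \<in> multipliers B"
  shows "m \<otimes>\<^sub>o n \<in> multipliers (A \<otimes>\<^sub>C B)"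
proof (rule multipliersI)
  have cl: "clinear m" "clinear n" using m n by (auto intro: mult_clinear)
  then show "clinear (m \<otimes>\<^sub>o n)" by simp
  have ab: "clinear a" "clinear b" if "a \<in> A" "b \<in> B" for a b using that A B by (auto intro: cstar_clinear)
  fix X assume X: "X \<in> A \<otimes>\<^sub>C B"
  show "(m \<otimes>\<^sub>o n) o\<^sub>L X \<in> A \<otimes>\<^sub>C B"
    by (rule spatial_induct[OF X bounded_linear_comp_right _ subspace_spatial closed_spatial])
      (simp add: op_tensor_compose ab cl spatial_elementary mult_left[OF m] mult_left[OF n])
  show "X o\<^sub>L (m \<otimes>\<^sub>o n) \<in> A \<otimes>\<^sub>C B"
    by (rule spatial_induct[OF X bounded_linear_comp_left _ subspace_spatial closed_spatial])
      (simp add: op_tensor_compose ab cl spatial_elementary mult_right[OF m] mult_right[OF n])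
qed

context
  fixes A :: "'a::chilbert_space op set" and B :: "'b::chilbert_space op set"
    and A' :: "'c::chilbert_space op set" and B' :: "'d::chilbert_space op set" and \<phi> \<psi>
  assumes A: "cstar_alg A" and B: "cstar_alg B" and A': "cstar_alg A'" and B': "cstar_alg B'"
    and \<phi>: "\<phi> \<in> cstar_mor A B" and \<psi>: "\<psi> \<in> cstar_mor A' B'"
begin

lemma mor_tensor_elementary_clinear:
  "a \<in> A \<Longrightarrow> clinear a" "b \<in> A' \<Longrightarrow> clinear b" "a \<in> A \<Longrightarrow> clinear (\<phi> a)" "b \<in> A' \<Longrightarrow> clinear (\<psi> b)"
  using A A' \<phi> \<psi> by (auto intro: cstar_clinear mor_clinear)

text \<open>\<open>amp\<close> acts on the last leg only, so \<open>\<phi> \<otimes> \<psi>\<close>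
  is composed of \<open>amp A' \<psi>\<close>, a flip, \<open>amp A \<phi>\<close> and a flip back.
  The second amplification is legitimate because the flipped value at \<open>a \<otimes> b\<close>
  is \<open>\<psi> b \<otimes> a\<close>, again with an algebra element in the last place.\<close>

lemma amp_flip_hops:
  assumes X: "X \<in> A \<otimes>\<^sub>C A'" shows "X \<in> hops A'" "flip o\<^sub>L amp A' \<psi> X o\<^sub>L flip \<in> hops A"
proof -
  have sub: "A \<otimes>\<^sub>C A' \<subseteq> hops A'" by (rule spatial_subset_hops[OF cstar_nondegenerate[OF A] A'])
  then show "X \<in> hops A'" using X by blast
  show "flip o\<^sub>L amp A' \<psi> X o\<^sub>L flip \<in> hops A"
  proof (rule clspan_partial_linear[where f = "\<lambda>X. flip o\<^sub>L amp A' \<psi> X o\<^sub>L flip",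
        OF subspace_hops[OF A'] closed_hops[OF A'] _ _ _ _ _ subspace_hops[OF A] closed_hops[OF A]])
    show "X \<in> clspan {a \<otimes>\<^sub>o b |a b. a \<in> A \<and> b \<in> A'}" using X by (simp add: spatial_def)
    show "{a \<otimes>\<^sub>o b |a b. a \<in> A \<and> b \<in> A'} \<subseteq> hops A'" using sub spatial_elementary by blast
    show "continuous_on (hops A') (\<lambda>X :: ('a, 'c) htensor op. flip o\<^sub>L amp A' \<psi> X o\<^sub>L flip)"
      by (intro bounded_linear.continuous_on[OF bounded_linear_comp_left]
          bounded_linear.continuous_on[OF bounded_linear_comp_right] amp_continuous_on[OF A' B' \<psi>])
    fix X assume "X \<in> {a \<otimes>\<^sub>o b |a b. a \<in> A \<and> b \<in> A'}"
    then obtain a b where "X = a \<otimes>\<^sub>o b" "a \<in> A" "b \<in> A'" by blast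
    then show "flip o\<^sub>L amp A' \<psi> X o\<^sub>L flip \<in> hops A"
      by (simp add: amp_op_tensor_alg[OF A' B' \<psi>] mor_tensor_elementary_clinear flip_op_tensor_flip op_tensor_hops[OF A]
          cstar_subset_multipliers[OF A])
  qed (simp_all add: amp_add[OF A' B' \<psi>] amp_scaleR[OF A' B' \<psi>] comp_add_left comp_add_right
      comp_scaleR_left comp_scaleR_right)
qed

lemma mor_tensor_eq_restrict_amp:
  "mor_tensor A A' \<phi> \<psi> = (\<lambda>X\<in>A \<otimes>\<^sub>C A'. flip o\<^sub>L amp A \<phi> (flip o\<^sub>L amp A' \<psi> X o\<^sub>L flip) o\<^sub>L flip)"
proof -
  let ?h = "\<lambda>X. flip o\<^sub>L amp A \<phi> (flip o\<^sub>L amp A' \<psi> X o\<^sub>L flip) o\<^sub>L flip"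
  let ?P = "A \<otimes>\<^sub>C A'"
  have "mor_tensor A A' \<phi> \<psi> = restrict ?h ?P"
  proof (rule mor_tensor_eqI[where K = 1])
    show "norm (restrict ?h ?P X) \<le> 1 * norm X" if "X \<in> ?P" for X
      using that order_trans[OF norm_flip_conj_le order_trans[OF norm_amp_le[OF A B \<phi> amp_flip_hops(2)[OF that]]
          order_trans[OF norm_flip_conj_le norm_amp_le[OF A' B' \<psi> amp_flip_hops(1)[OF that]]]]] by simp
    show "restrict ?h ?P (X + Y) = restrict ?h ?P X + restrict ?h ?P Y" if "X \<in> ?P" "Y \<in> ?P" for X Y
      using that subspace_add[OF subspace_spatial that] amp_flip_hops[OF that(1)] amp_flip_hops[OF that(2)]
      by (simp add: amp_add[OF A' B' \<psi>] amp_add[OF A B \<phi>] comp_add_left comp_add_right)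
    show "restrict ?h ?P (cscale c X) = cscale c (restrict ?h ?P X)" if "X \<in> ?P" for c X
      using that amp_flip_hops[OF that]
      by (simp add: spatial_cscale[OF cstar_nondegenerate[OF A] A'] amp_cscale[OF A' B' \<psi>] amp_cscale[OF A B \<phi>]
          cscale_comp_left cscale_comp_right)
    show "restrict ?h ?P (a \<otimes>\<^sub>o b) = \<phi> a \<otimes>\<^sub>o \<psi> b" if "a \<in> A" "b \<in> A'" for a b
      using that by (simp add: spatial_elementary amp_op_tensor_alg[OF A' B' \<psi>] amp_op_tensor_alg[OF A B \<phi>]
          mor_tensor_elementary_clinear flip_op_tensor_flip)
  qed simp
  then show ?thesis .
qed

lemma mor_tensor_eq_amp:
  "X \<in> A \<otimes>\<^sub>C A' \<Longrightarrow> mor_tensor A A' \<phi> \<psi> X = flip o\<^sub>L amp A \<phi> (flip o\<^sub>L amp A' \<psi> X o\<^sub>L flip) o\<^sub>L flip"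
  by (simp add: mor_tensor_eq_restrict_amp)

lemma mor_tensor_elementary: "a \<in> A \<Longrightarrow> b \<in> A' \<Longrightarrow> mor_tensor A A' \<phi> \<psi> (a \<otimes>\<^sub>o b) = \<phi> a \<otimes>\<^sub>o \<psi> b"
  by (simp add: mor_tensor_eq_amp spatial_elementary amp_op_tensor_alg[OF A' B' \<psi>] amp_op_tensor_alg[OF A B \<phi>]
      mor_tensor_elementary_clinear flip_op_tensor_flip)

lemma mor_tensor_cstar_mor: "mor_tensor A A' \<phi> \<psi> \<in> cstar_mor (A \<otimes>\<^sub>C A') (B \<otimes>\<^sub>C B')" (is "?H \<in> _")
proof -
  let ?P = "A \<otimes>\<^sub>C A'" and ?R = "B \<otimes>\<^sub>C B'"
  note P = cstar_alg_spatial[OF A A'] and R = cstar_alg_spatial[OF B B']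
  note H = mor_tensor_eq_amp
  have clg: "clinear (flip o\<^sub>L amp A' \<psi> X o\<^sub>L flip)" "clinear (amp A' \<psi> X)" "clinear (amp A \<phi> (flip o\<^sub>L amp A' \<psi> X o\<^sub>L flip))"
    if "X \<in> ?P" for X
    using amp_flip_hops[OF that] by (auto intro: hops_clinear[OF A] clinear_amp[OF A B \<phi>] clinear_amp[OF A' B' \<psi>])
  have add: "?H (X + Y) = ?H X + ?H Y" if "X \<in> ?P" "Y \<in> ?P" for X Y
    using that subspace_add[OF subspace_spatial that] amp_flip_hops[OF that(1)] amp_flip_hops[OF that(2)]
    by (simp add: H amp_add[OF A' B' \<psi>] amp_add[OF A B \<phi>] comp_add_left comp_add_right)
  have comp: "?H (X o\<^sub>L Y) = ?H X o\<^sub>L ?H Y" if XY: "X \<in> ?P" "Y \<in> ?P" for X Y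
  proof -
    have "flip o\<^sub>L amp A' \<psi> (X o\<^sub>L Y) o\<^sub>L flip = (flip o\<^sub>L amp A' \<psi> X o\<^sub>L flip) o\<^sub>L (flip o\<^sub>L amp A' \<psi> Y o\<^sub>L flip)"
      using amp_flip_hops(1)[OF XY(1)] amp_flip_hops(1)[OF XY(2)] by (simp add: amp_comp[OF A' B' \<psi>] flip_conj_comp)
    then have "amp A \<phi> (flip o\<^sub>L amp A' \<psi> (X o\<^sub>L Y) o\<^sub>L flip)
        = amp A \<phi> (flip o\<^sub>L amp A' \<psi> X o\<^sub>L flip) o\<^sub>L amp A \<phi> (flip o\<^sub>L amp A' \<psi> Y o\<^sub>L flip)"
      by (simp only: amp_comp[OF A B \<phi> amp_flip_hops(2)[OF XY(1)] amp_flip_hops(2)[OF XY(2)]])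
    then show ?thesis using XY cstar_comp[OF P XY] by (simp add: H flip_conj_comp)
  qed
  have cscale: "?H (cscale c X) = cscale c (?H X)" if "X \<in> ?P" for c X
    using that amp_flip_hops[OF that]
    by (simp add: H cstar_cscale[OF P] amp_cscale[OF A' B' \<psi>] amp_cscale[OF A B \<phi>] cscale_comp_left cscale_comp_right)
  have star: "?H (adj X) = adj (?H X)" if X: "X \<in> ?P" for X
  proof -
    have "flip o\<^sub>L amp A' \<psi> (adj X) o\<^sub>L flip = adj (flip o\<^sub>L amp A' \<psi> X o\<^sub>L flip)"
      by (simp add: amp_adj[OF A' B' \<psi> amp_flip_hops(1)[OF X]] adj_flip_conj clg[OF X])
    then have "amp A \<phi> (flip o\<^sub>L amp A' \<psi> (adj X) o\<^sub>L flip) = adj (amp A \<phi> (flip o\<^sub>L amp A' \<psi> X o\<^sub>L flip))"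
      by (simp only: amp_adj[OF A B \<phi> amp_flip_hops(2)[OF X]])
    then show ?thesis
      using X cstar_adj[OF P X] by (simp add: H adj_flip_conj clg[OF X])
  qed
  have norm: "norm (?H X) \<le> 1 * norm X" if "X \<in> ?P" for X
    using that order_trans[OF norm_flip_conj_le order_trans[OF norm_amp_le[OF A B \<phi> amp_flip_hops(2)[OF that]]
        order_trans[OF norm_flip_conj_le norm_amp_le[OF A' B' \<psi> amp_flip_hops(1)[OF that]]]]] by (simp add: H)
  have scale: "?H (r *\<^sub>R X) = r *\<^sub>R ?H X" if "X \<in> ?P" for r X
    using cscale[OF that, of "complex_of_real r"] by (simp add: cscale_of_real)
  have mult: "?H X \<in> multipliers ?R" if "X \<in> ?P" for X
  proof (rule clspan_partial_linear[where f = ?H, OF subspace_spatial closed_spatial _ _ _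
        partial_linear_continuous_on[OF subspace_spatial _ _ norm] _ subspace_multipliers[OF R] closed_multipliers[OF R]])
    show "X \<in> clspan {a \<otimes>\<^sub>o b |a b. a \<in> A \<and> b \<in> A'}" using that by (simp add: spatial_def)
    fix Y assume "Y \<in> {a \<otimes>\<^sub>o b |a b. a \<in> A \<and> b \<in> A'}"
    then show "?H Y \<in> multipliers ?R"
      by (auto simp: mor_tensor_elementary intro!: op_tensor_multipliers[OF B B'] mor_mult[OF \<phi>] mor_mult[OF \<psi>])
  qed (use add scale norm in \<open>auto intro: spatial_elementary\<close>)
  \<comment> \<open>Nondegeneracy, one leg at a time: first \<open>b'\<close> is approximated by
    products \<open>\<psi> a' o\<^sub>L d'\<close>, then \<open>b\<close> by products
    \<open>\<phi> a o\<^sub>L d\<close>.\<close>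
  have "?R \<subseteq> clspan {?H X o\<^sub>L Y |X Y. X \<in> ?P \<and> Y \<in> ?R}" (is "_ \<subseteq> ?Q")
  proof (rule spatial_subset[OF _ subspace_clspan closed_closure])
    fix b b' assume b: "b \<in> B" and b': "b' \<in> B'"
    have cb: "clinear b" using b by (rule cstar_clinear[OF B])
    show "b \<otimes>\<^sub>o b' \<in> ?Q"
    proof (rule op_tensor_left_clspan[OF _ cb _ _ subspace_clspan closed_closure])
      show "b' \<in> clspan {\<psi> a o\<^sub>L d |a d. a \<in> A' \<and> d \<in> B'}" using b' mor_dense[OF \<psi>] by blast
      fix e' assume "e' \<in> {\<psi> a o\<^sub>L d |a d. a \<in> A' \<and> d \<in> B'}"
      then obtain a' d' where e': "e' = \<psi> a' o\<^sub>L d'" "a' \<in> A'" "d' \<in> B'" by blast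
      show ce': "clinear e'" using e' by (simp add: mor_tensor_elementary_clinear cstar_clinear[OF B'])
      show "b \<otimes>\<^sub>o e' \<in> ?Q"
      proof (rule op_tensor_right_clspan[OF _ ce' _ _ subspace_clspan closed_closure])
        show "b \<in> clspan {\<phi> a o\<^sub>L d |a d. a \<in> A \<and> d \<in> B}" using b mor_dense[OF \<phi>] by blast
        fix e assume "e \<in> {\<phi> a o\<^sub>L d |a d. a \<in> A \<and> d \<in> B}"
        then obtain a d where e: "e = \<phi> a o\<^sub>L d" "a \<in> A" "d \<in> B" by blast
        show "clinear e" using e by (simp add: mor_tensor_elementary_clinear cstar_clinear[OF B])
        have "e \<otimes>\<^sub>o e' = ?H (a \<otimes>\<^sub>o a') o\<^sub>L (d \<otimes>\<^sub>o d')"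
          using e e' by (simp add: mor_tensor_elementary op_tensor_compose mor_tensor_elementary_clinear
              cstar_clinear[OF B] cstar_clinear[OF B'])
        then show "e \<otimes>\<^sub>o e' \<in> ?Q"
          using spatial_elementary[OF e(2) e'(2)] spatial_elementary[OF e(3) e'(3)] by (intro clspan_base) blast
      qed
    qed
  qed
  moreover have "?Q \<subseteq> ?R"
    using mult by (intro cstar_clspan_subset[OF R]) (auto intro: mult_left)
  ultimately show ?thesis
    unfolding cstar_mor_def using mult add comp cscale star
    by (auto simp: PiE_iff extensional_def mor_tensor_eq_restrict_amp)
qed

lemma mor_ext_mor_tensor:
  assumes m: "m \<in> multipliers A" and n: "n \<in> multipliers A'"
  shows "mor_ext (A \<otimes>\<^sub>C A') (mor_tensor A A' \<phi> \<psi>) (m \<otimes>\<^sub>o n) = mor_ext A \<phi> m \<otimes>\<^sub>o mor_ext A' \<psi> n" (is "?S = ?T")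
proof (rule blinfun_eqI_total[OF clspan_tensors_total[OF mor_total[OF B \<phi>] mor_total[OF B' \<psi>]]])
  fix u
  assume "u \<in> {x \<otimes>\<^sub>h y |x y. x \<in> {blinfun_apply (\<phi> a) x |a x. a \<in> A} \<and> y \<in> {blinfun_apply (\<psi> a) x |a x. a \<in> A'}}"
  then obtain a x b y where ab: "a \<in> A" "b \<in> A'" and u: "u = blinfun_apply (\<phi> a \<otimes>\<^sub>o \<psi> b) (x \<otimes>\<^sub>h y)"
    by (fastforce simp: mor_tensor_elementary_clinear)
  have cl: "clinear m" "clinear n" "clinear (mor_ext A \<phi> m)" "clinear (mor_ext A' \<psi> n)"
    using m n by (auto intro: mult_clinear clinear_mor_ext[OF A B \<phi>] clinear_mor_ext[OF A' B' \<psi>])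
  have "?S o\<^sub>L mor_tensor A A' \<phi> \<psi> (a \<otimes>\<^sub>o b) = mor_tensor A A' \<phi> \<psi> ((m \<otimes>\<^sub>o n) o\<^sub>L (a \<otimes>\<^sub>o b))"
    by (rule mor_ext_comp_mor[OF cstar_alg_spatial[OF A A'] cstar_alg_spatial[OF B B'] mor_tensor_cstar_mor
          op_tensor_multipliers[OF A A' m n] spatial_elementary[OF ab]])
  also have "\<dots> = ?T o\<^sub>L (\<phi> a \<otimes>\<^sub>o \<psi> b)"
    using ab by (simp add: op_tensor_compose cl mor_tensor_elementary_clinear mor_tensor_elementary mult_left[OF m]
        mult_left[OF n] mor_ext_comp_mor[OF A B \<phi> m] mor_ext_comp_mor[OF A' B' \<psi> n])
  finally have "?S o\<^sub>L (\<phi> a \<otimes>\<^sub>o \<psi> b) = ?T o\<^sub>L (\<phi> a \<otimes>\<^sub>o \<psi> b)" using ab by (simp add: mor_tensor_elementary)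
  from arg_cong[OF this, of "\<lambda>R. blinfun_apply R (x \<otimes>\<^sub>h y)"]
  show "blinfun_apply ?S u = blinfun_apply ?T u" by (simp add: u)
qed

end

section \<open>Composition of morphisms\<close>

context
  fixes C :: "'c::chilbert_space op set" and D :: "'d::chilbert_space op set" and E :: "'e::chilbert_space op set" and \<phi> \<psi>
  assumes C: "cstar_alg C" and D: "cstar_alg D" and E: "cstar_alg E"
    and \<phi>: "\<phi> \<in> cstar_mor C D" and \<psi>: "\<psi> \<in> cstar_mor D E"
begin

lemma mor_ext_mor_compose:
  assumes m: "m \<in> multipliers C"
  shows "mor_ext C (\<lambda>a\<in>C. mor_ext D \<psi> (\<phi> a)) m = mor_ext D \<psi> (mor_ext C \<phi> m)"
proof (rule mor_ext_eqI'[OF C E mor_compose[OF C D E \<phi> \<psi>]])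
  fix a assume a: "a \<in> C"
  have "mor_ext D \<psi> (mor_ext C \<phi> m) o\<^sub>L mor_ext D \<psi> (\<phi> a) = mor_ext D \<psi> (mor_ext C \<phi> m o\<^sub>L \<phi> a)"
    by (rule mor_ext_comp[OF D E \<psi> mor_ext_multipliers[OF C D \<phi> m] mor_mult[OF \<phi> a], symmetric])
  then show "mor_ext D \<psi> (mor_ext C \<phi> m) o\<^sub>L (\<lambda>a\<in>C. mor_ext D \<psi> (\<phi> a)) a = (\<lambda>a\<in>C. mor_ext D \<psi> (\<phi> a)) (m o\<^sub>L a)"
    using a mult_left[OF m a] by (simp add: mor_ext_comp_mor[OF C D \<phi> m])
qed

text \<open>Both sides have the coefficients of \<open>T\<close> extended by \<open>\<phi>\<close>
  and then by \<open>\<psi>\<close>. The hypothesis on \<open>amp C \<phi> T\<close> is met for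
  \<open>\<Delta>A\<close> because \<open>U\<close> is a multiplier, and for
  \<open>\<phi> \<otimes> \<phi>\<close> because both legs of \<open>V\<close> are
  adjointable.\<close>

lemma amp_mor_compose:
  assumes T: "T \<in> hops C" and T': "amp C \<phi> T \<in> hops D"
  shows "amp C (\<lambda>a\<in>C. mor_ext D \<psi> (\<phi> a)) T = amp D \<psi> (amp C \<phi> T)"
  by (rule amp_eqI[OF C E mor_compose[OF C D E \<phi> \<psi>]])
    (simp add: amp_slice[OF D E \<psi> T'] amp_slice[OF C D \<phi> T] mor_ext_mor_compose slice_multipliers[OF C T])

end

section \<open>The legs 12 and 13 over a tensor product of algebras\<close>

lemma clinear_leg12 [simp]: "clinear T \<Longrightarrow> clinear (leg12 T)"
  by (simp add: leg12_def reassoc_def)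

lemma clinear_leg13 [simp]: "clinear T \<Longrightarrow> clinear (leg13 T)"
  by (simp add: leg13_def)

lemma adj_leg12: "clinear T \<Longrightarrow> adj (leg12 T) = leg12 (adj T)"
  by (simp add: leg12_def reassoc_def adj_compose adj_op_tensor comp_assoc)

lemma adj_leg13: "clinear T \<Longrightarrow> adj (leg13 T) = leg13 (adj T)"
  by (simp add: leg13_def adj_compose adj_op_tensor adj_leg12 comp_assoc)

lemma cinner_assoc: "cinner (x \<otimes>\<^sub>h (y \<otimes>\<^sub>h z)) (blinfun_apply assoc u) = cinner ((x \<otimes>\<^sub>h y) \<otimes>\<^sub>h z) u"
  using cinner_adj_left[OF clinear_assoc, of "x \<otimes>\<^sub>h (y \<otimes>\<^sub>h z)" u] by simp

lemma blinfun_eqI_cinner_tensor: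
  fixes S T :: "('a::chilbert_space, 'b::chilbert_space) htensor op"
  assumes "\<And>x y p q. cinner (p \<otimes>\<^sub>h q) (blinfun_apply S (x \<otimes>\<^sub>h y)) = cinner (p \<otimes>\<^sub>h q) (blinfun_apply T (x \<otimes>\<^sub>h y))"
  shows "S = T"
  by (rule blinfun_eqI_slices[of UNIV UNIV]) (auto intro!: blinfun_eqI_cinner simp: cinner_slice assms)

lemma slice_leg12: "clinear T \<Longrightarrow> slice x (leg12 T) z = slice x T z \<otimes>\<^sub>o id_blinfun"
  by (rule blinfun_eqI_cinner_tensor) (simp add: cinner_slice leg12_apply cinner_assoc cinner_tensor)

lemma slice_leg13:
  fixes T :: "('a::chilbert_space, 'c::chilbert_space) htensor op"
  assumes T: "clinear T"
  shows "slice x (leg13 T) z = (id_blinfun :: 'b::chilbert_space op) \<otimes>\<^sub>o slice x T z"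
proof (rule blinfun_eqI_cinner_tensor)
  fix p r :: 'b and q s :: 'c
  have "cinner (x \<otimes>\<^sub>h (p \<otimes>\<^sub>h q)) (blinfun_apply (id_blinfun \<otimes>\<^sub>o flip) v) = cinner (x \<otimes>\<^sub>h (q \<otimes>\<^sub>h p)) v" for v
    using cinner_adj_left[of "id_blinfun \<otimes>\<^sub>o flip" "x \<otimes>\<^sub>h (p \<otimes>\<^sub>h q)" v] by (simp add: adj_op_tensor)
  then show "cinner (p \<otimes>\<^sub>h q) (blinfun_apply (slice x (leg13 T) z) (r \<otimes>\<^sub>h s))
      = cinner (p \<otimes>\<^sub>h q) (blinfun_apply (id_blinfun \<otimes>\<^sub>o slice x T z) (r \<otimes>\<^sub>h s))"
    by (simp add: cinner_slice leg13_def leg12_apply T cinner_assoc cinner_tensor)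
qed

text \<open>On \<open>z \<otimes> (c \<otimes> d)\<close> the operator gives
  \<open>T (z \<otimes> c)\<close> tensored with \<open>d\<close> and rebracketed. Since
  \<open>T (z \<otimes> c)\<close> is in \<open>hmod C\<close>, it may be replaced by a generator
  \<open>z' \<otimes> c'\<close>.\<close>

lemma leg12_hops:
  fixes T :: "('h::chilbert_space, 'k::chilbert_space) htensor op" and C' :: "'l::chilbert_space op set"
  assumes C: "cstar_alg C" and C': "cstar_alg C'" and T: "T \<in> hops C"
  shows "leg12 T \<in> hops (C \<otimes>\<^sub>C C')"
proof -
  let ?M = "hmod (C \<otimes>\<^sub>C C') :: (_ \<Rightarrow>\<^sub>L ('h, ('k, 'l) htensor) htensor) set"
  have *: "leg12 T o\<^sub>L (ket z o\<^sub>L e) \<in> ?M" if T: "T \<in> hops C" and e: "e \<in> C \<otimes>\<^sub>C C'"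
    for T :: "('h, 'k) htensor op" and z e
  proof (rule spatial_induct[OF e _ _ subspace_hmod closed_hmod])
    show "bounded_linear (\<lambda>e. leg12 T o\<^sub>L (ket z o\<^sub>L e))"
      by (intro bounded_linear_compose[OF bounded_linear_comp_right] bounded_linear_comp_right)
    fix c d assume c: "c \<in> C" and d: "d \<in> C'"
    have clcd: "clinear c" "clinear d" "clinear T" using c d T by (auto intro: cstar_clinear[OF C] cstar_clinear[OF C'] hops_clinear[OF C])
    have Y: "T o\<^sub>L (ket z o\<^sub>L c) \<in> hmod C" by (rule hops_hmod[OF C T ket_comp_hmod[OF c]])
    have "(T o\<^sub>L (ket z o\<^sub>L c)) \<otimes>\<^sub>o d \<in> {R. assoc o\<^sub>L R \<in> ?M}"
    proof (rule op_tensor_right_clspan[OF Y[unfolded hmod_def] clcd(2)])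
      fix Y assume "Y \<in> {ket (z :: 'h) o\<^sub>L c |z c. c \<in> C}"
      then obtain z :: 'h and c where Y: "Y = ket z o\<^sub>L c" "c \<in> C" by blast
      then show "clinear Y" by (simp add: cstar_clinear[OF C])
      have "assoc o\<^sub>L (Y \<otimes>\<^sub>o d) = ket z o\<^sub>L (c \<otimes>\<^sub>o d)"
        by (rule blinfun_eqI_tensor) (simp add: Y cstar_clinear[OF C] clcd)
      then show "Y \<otimes>\<^sub>o d \<in> {R. assoc o\<^sub>L R \<in> ?M}" using Y(2) d by (simp add: ket_comp_hmod spatial_elementary)
    qed (intro subspace_linear_vimage closed_linear_vimage bounded_linear_comp_right subspace_hmod closed_hmod)+
    moreover have "leg12 T o\<^sub>L (ket z o\<^sub>L (c \<otimes>\<^sub>o d)) = assoc o\<^sub>L ((T o\<^sub>L (ket z o\<^sub>L c)) \<otimes>\<^sub>o d)"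
      by (rule blinfun_eqI_tensor) (simp add: clcd leg12_apply)
    ultimately show "leg12 T o\<^sub>L (ket z o\<^sub>L (c \<otimes>\<^sub>o d)) \<in> ?M" by simp
  qed
  have "clinear T" by (rule hops_clinear[OF C T])
  then show ?thesis
    by (intro hopsI[OF cstar_alg_spatial[OF C C']])
      (simp_all add: adj_leg12 *[OF T] *[OF hops_adj[OF C T]])
qed

text \<open>\<open>?F\<close> exchanges the last two legs on the module side and, to match, on the
  right; it carries the module of \<open>C' \<otimes>\<^sub>C C\<close> to that of
  \<open>C \<otimes>\<^sub>C C'\<close> and back, which reduces the claim to
  \<open>leg12\<close>.\<close>

lemma leg13_hops:
  fixes T :: "('h::chilbert_space, 'k::chilbert_space) htensor op" and C' :: "'l::chilbert_space op set"
  assumes C: "cstar_alg C" and C': "cstar_alg C'" and T: "T \<in> hops C"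
  shows "leg13 T \<in> hops (C' \<otimes>\<^sub>C C)"
proof -
  let ?F = "\<lambda>R. (id_blinfun \<otimes>\<^sub>o flip) o\<^sub>L R o\<^sub>L flip"
  have flipY: "?F Y \<in> hmod (A \<otimes>\<^sub>C B)" if A: "cstar_alg A" and B: "cstar_alg B" and Y: "Y \<in> hmod (B \<otimes>\<^sub>C A)"
    for A :: "'x::chilbert_space op set" and B :: "'y::chilbert_space op set"
      and Y :: "('y, 'x) htensor \<Rightarrow>\<^sub>L ('h, ('y, 'x) htensor) htensor"
  proof (rule hmod_induct[OF Y _ _ subspace_hmod closed_hmod])
    show "bounded_linear ?F"
      by (intro bounded_linear_compose[OF bounded_linear_comp_left] bounded_linear_comp_right)
    fix z :: 'h and e assume e: "e \<in> B \<otimes>\<^sub>C A"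
    have "flip o\<^sub>L e o\<^sub>L flip \<in> A \<otimes>\<^sub>C B"
    proof (rule spatial_induct[OF e _ _ subspace_spatial closed_spatial])
      show "bounded_linear (\<lambda>e. flip o\<^sub>L e o\<^sub>L flip)"
        by (intro bounded_linear_compose[OF bounded_linear_comp_left] bounded_linear_comp_right)
    qed (simp add: flip_op_tensor_flip cstar_clinear[OF A] cstar_clinear[OF B] spatial_elementary)
    moreover have "?F (ket z o\<^sub>L e) = ket z o\<^sub>L (flip o\<^sub>L e o\<^sub>L flip)" by (rule blinfun_eqI) simp
    ultimately show "?F (ket z o\<^sub>L e) \<in> hmod (A \<otimes>\<^sub>C B)" by (simp add: ket_comp_hmod)
  qed
  have *: "leg13 T o\<^sub>L Y \<in> hmod (C' \<otimes>\<^sub>C C)" if T: "T \<in> hops C" and Y: "Y \<in> hmod (C' \<otimes>\<^sub>C C)"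
    for T :: "('h, 'k) htensor op" and Y
  proof -
    have "?F (leg12 T o\<^sub>L ?F Y) = leg13 T o\<^sub>L Y"
      by (simp add: leg13_def comp_assoc)
    then show ?thesis
      using flipY[OF C' C hops_hmod[OF cstar_alg_spatial[OF C C'] leg12_hops[OF C C' T] flipY[OF C C' Y]]] by simp
  qed
  have "clinear T" by (rule hops_clinear[OF C T])
  then show ?thesis by (simp add: hops_def adj_leg13 *[OF T] *[OF hops_adj[OF C T]])
qed

context
  fixes C :: "'k::chilbert_space op set" and D :: "'l::chilbert_space op set" and \<phi>
    and T :: "('h::chilbert_space, 'k) htensor op"
  assumes C: "cstar_alg C" and D: "cstar_alg D" and \<phi>: "\<phi> \<in> cstar_mor C D" and T: "T \<in> hops C"
begin

text \<open>The coefficients of \<open>leg12 T\<close> are those of \<open>T\<close> tensored with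
  the identity, on which \<open>\<phi> \<otimes> \<phi>\<close> extends factor by factor. For
  \<open>leg13\<close> the identity stands on the left.\<close>

lemma amp_leg12: "amp (C \<otimes>\<^sub>C C) (mor_tensor C C \<phi> \<phi>) (leg12 T) = leg12 (amp C \<phi> T)"
  by (rule amp_eqI[OF cstar_alg_spatial[OF C C] cstar_alg_spatial[OF D D] mor_tensor_cstar_mor[OF C D C D \<phi> \<phi>]])
    (simp add: slice_leg12 hops_clinear[OF C T] clinear_amp[OF C D \<phi> T] amp_slice[OF C D \<phi> T]
      mor_ext_mor_tensor[OF C D C D \<phi> \<phi>] slice_multipliers[OF C T] multipliers_id mor_ext_id[OF C D \<phi>])

lemma amp_leg13: "amp (C \<otimes>\<^sub>C C) (mor_tensor C C \<phi> \<phi>) (leg13 T) = leg13 (amp C \<phi> T)"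
  by (rule amp_eqI[OF cstar_alg_spatial[OF C C] cstar_alg_spatial[OF D D] mor_tensor_cstar_mor[OF C D C D \<phi> \<phi>]])
    (simp add: slice_leg13 hops_clinear[OF C T] clinear_amp[OF C D \<phi> T] amp_slice[OF C D \<phi> T]
      mor_ext_mor_tensor[OF C D C D \<phi> \<phi>] slice_multipliers[OF C T] multipliers_id mor_ext_id[OF C D \<phi>])

end

section \<open>Bicharacters and Hopf homomorphisms\<close>

theorem proposition4p2:
  fixes W :: "('h::chilbert_space, 'h) htensor op"
    and C :: "'h op set" and \<Delta>C :: "'h op \<Rightarrow> ('h, 'h) htensor op"
    and Cu :: "'u::chilbert_space op set" and V :: "('h, 'u) htensor op"
    and \<Delta>u :: "'u op \<Rightarrow> ('u, 'u) htensor op"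
    and A :: "'a::chilbert_space op set" and \<Delta>A :: "'a op \<Rightarrow> ('a, 'a) htensor op"
  assumes "quantum_group W C \<Delta>C"
    and "universal_corep W Cu V TYPE('a)"
    and "universal_corep W Cu V TYPE(('a, 'a) htensor)"
    and "universal_comult W Cu V \<Delta>u"
    and "cstar_bialgebra A \<Delta>A"
  shows "bij_betw (\<lambda>\<phi>. id_mor W Cu \<phi> V) (hopf_homs Cu \<Delta>u A \<Delta>A) (bicharacters W A \<Delta>A)"
proof -
  have W: "unitary W" using assms(1) by (simp add: quantum_group_def multiplicative_unitary_def)
  have Cu: "cstar_alg Cu" and V: "left_corep W Cu V" using assms(2) by (auto simp: universal_corep_def)
  have A: "cstar_alg A" and \<Delta>A: "\<Delta>A \<in> cstar_mor A (A \<otimes>\<^sub>C A)" using assms(5) by (auto simp: cstar_bialgebra_def)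
  have \<Delta>u: "\<Delta>u \<in> cstar_mor Cu (Cu \<otimes>\<^sub>C Cu)" and \<Delta>uV: "id_mor W Cu \<Delta>u V = leg12 V o\<^sub>L leg13 V"
    using assms(4) by (auto simp: universal_comult_def)
  note CC = cstar_alg_spatial[OF Cu Cu] and AA = cstar_alg_spatial[OF A A]
  note B = dual_nondegenerate[OF W]
  have VM: "V \<in> multipliers (dual W \<otimes>\<^sub>C Cu)" using V by (simp add: left_corep_def unitary_multipliers_def)
  have Vh: "V \<in> hops Cu" by (rule multipliers_spatial_subset_hops[OF B Cu VM])
  note id_mor_V = id_mor_eq_amp[OF W Cu _ _ VM]
  have corep: "left_corep W D (id_mor W Cu \<phi> V)" if "cstar_alg D" "\<phi> \<in> cstar_mor Cu D"
    for D :: "'d::chilbert_space op set" and \<phi>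
    using left_corep_amp[OF W Cu that V] id_mor_V[OF that] by simp
  have unique: "\<exists>!\<phi>. \<phi> \<in> cstar_mor Cu A \<and> U = id_mor W Cu \<phi> V" if "left_corep W A U" for U
    using assms(2) A that by (auto simp: universal_corep_def)
  have unique2: "\<exists>!\<phi>. \<phi> \<in> cstar_mor Cu (A \<otimes>\<^sub>C A) \<and> U = id_mor W Cu \<phi> V" if "left_corep W (A \<otimes>\<^sub>C A) U" for U
    using assms(3) AA that by (auto simp: universal_corep_def)
  \<comment> \<open>Proved for all morphisms from \<open>Cu\<close> to \<open>A\<close>: one
    direction makes the map land in the bicharacters, the other lifts a bicharacter to a Hopf
    homomorphism.\<close>
  have hopf_iff: "\<phi> \<in> hopf_homs Cu \<Delta>u A \<Delta>A \<longleftrightarrow> id_mor W Cu \<phi> V \<in> bicharacters W A \<Delta>A"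
    if \<phi>: "\<phi> \<in> cstar_mor Cu A" for \<phi>
  proof -
    let ?U = "id_mor W Cu \<phi> V" and ?\<phi>\<phi> = "mor_tensor Cu Cu \<phi> \<phi>"
    let ?\<chi> = "\<lambda>c\<in>Cu. mor_ext A \<Delta>A (\<phi> c)" and ?\<xi> = "\<lambda>c\<in>Cu. mor_ext (Cu \<otimes>\<^sub>C Cu) ?\<phi>\<phi> (\<Delta>u c)"
    have U: "?U = amp Cu \<phi> V" by (rule id_mor_V[OF A \<phi>])
    have lU: "left_corep W A ?U" by (rule corep[OF A \<phi>])
    then have UM: "?U \<in> multipliers (dual W \<otimes>\<^sub>C A)" by (simp add: left_corep_def unitary_multipliers_def)
    have Uh: "?U \<in> hops A" by (rule multipliers_spatial_subset_hops[OF B A UM])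
    have \<phi>\<phi>: "?\<phi>\<phi> \<in> cstar_mor (Cu \<otimes>\<^sub>C Cu) (A \<otimes>\<^sub>C A)" by (rule mor_tensor_cstar_mor[OF Cu A Cu A \<phi> \<phi>])
    have \<chi>: "?\<chi> \<in> cstar_mor Cu (A \<otimes>\<^sub>C A)" by (rule mor_compose[OF Cu A AA \<phi> \<Delta>A])
    have \<xi>: "?\<xi> \<in> cstar_mor Cu (A \<otimes>\<^sub>C A)" by (rule mor_compose[OF Cu CC AA \<Delta>u \<phi>\<phi>])
    have \<chi>V: "id_mor W Cu ?\<chi> V = id_mor W A \<Delta>A ?U"
      unfolding id_mor_V[OF AA \<chi>] id_mor_eq_amp[OF W A AA \<Delta>A UM]
      using Uh by (simp add: U amp_mor_compose[OF Cu A AA \<phi> \<Delta>A Vh])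
    have amp\<Delta>: "amp Cu \<Delta>u V = leg12 V o\<^sub>L leg13 V" using \<Delta>uV unfolding id_mor_V[OF CC \<Delta>u] .
    have legs: "leg12 V \<in> hops (Cu \<otimes>\<^sub>C Cu)" "leg13 V \<in> hops (Cu \<otimes>\<^sub>C Cu)"
      using leg12_hops[OF Cu Cu Vh] leg13_hops[OF Cu Cu Vh] .
    have "amp Cu ?\<xi> V = amp (Cu \<otimes>\<^sub>C Cu) ?\<phi>\<phi> (amp Cu \<Delta>u V)"
      by (rule amp_mor_compose[OF Cu CC AA \<Delta>u \<phi>\<phi> Vh]) (simp add: amp\<Delta> hops_comp[OF CC] legs)
    then have \<xi>V: "id_mor W Cu ?\<xi> V = leg12 ?U o\<^sub>L leg13 ?U"
      unfolding id_mor_V[OF AA \<xi>] U amp\<Delta>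
      by (simp add: amp_comp[OF CC AA \<phi>\<phi> legs] amp_leg12[OF Cu A \<phi> Vh] amp_leg13[OF Cu A \<phi> Vh])
    \<comment> \<open>The Hopf condition is pointwise on \<open>Cu\<close>; the restricted
      composites turn it into an equality of functions, to which the universal property
      applies.\<close>
    have "\<phi> \<in> hopf_homs Cu \<Delta>u A \<Delta>A \<longleftrightarrow> ?\<chi> = ?\<xi>"
      using \<phi> by (auto simp: hopf_homs_def fun_eq_iff restrict_def)
    also have "\<dots> \<longleftrightarrow> id_mor W Cu ?\<chi> V = id_mor W Cu ?\<xi> V"
      \<comment> \<open>Uniqueness for test algebras on the Hilbert space of
        \<open>A \<otimes>\<^sub>C A\<close>: morphisms into this algebra are equal if they have the
        same corepresentation.\<close>
      using unique2[OF corep[OF AA \<chi>]] \<chi> \<xi> by metis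
    also have "\<dots> \<longleftrightarrow> ?U \<in> bicharacters W A \<Delta>A"
      using lU unfolding \<chi>V \<xi>V by (simp add: bicharacters_def left_corep_def)
    finally show ?thesis .
  qed
  show ?thesis
  proof (rule bij_betwI')
    fix \<phi> \<psi> assume "\<phi> \<in> hopf_homs Cu \<Delta>u A \<Delta>A" "\<psi> \<in> hopf_homs Cu \<Delta>u A \<Delta>A"
    then have "\<phi> \<in> cstar_mor Cu A" "\<psi> \<in> cstar_mor Cu A" by (auto simp: hopf_homs_def)
    then show "id_mor W Cu \<phi> V = id_mor W Cu \<psi> V \<longleftrightarrow> \<phi> = \<psi>"
      using unique[OF corep[OF A]] by metis
  next
    fix \<phi> assume \<phi>: "\<phi> \<in> hopf_homs Cu \<Delta>u A \<Delta>A"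
    then have "\<phi> \<in> cstar_mor Cu A" by (simp add: hopf_homs_def)
    then show "id_mor W Cu \<phi> V \<in> bicharacters W A \<Delta>A" using \<phi> hopf_iff by blast
  next
    fix U assume U: "U \<in> bicharacters W A \<Delta>A"
    then have "left_corep W A U" by (simp add: bicharacters_def left_corep_def)
    then obtain \<phi> where "\<phi> \<in> cstar_mor Cu A" "U = id_mor W Cu \<phi> V" using unique by blast
    then show "\<exists>\<phi>\<in>hopf_homs Cu \<Delta>u A \<Delta>A. U = id_mor W Cu \<phi> V" using U hopf_iff by blast
  qed
qed

end
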